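(* Let $\mathfrak g$ and $\mathfrak h$ be two discrete dglas. Then there is a quasi-isomorphism $$\hat{\mathcal C}(\mathfrak g*\mathfrak h)\ \simeq\ \hat{\mathcal C}(\mathfrak g)\times\hat{\mathcal C}(\mathfrak h),$$ where $\mathfrak g*\mathfrak h$ is the free (non-completed) product of $\mathfrak g$ and $\mathfrak h$.
   Context: $\Bbbk$ is a field of characteristic zero. A (discrete) dgla is a homologically $\mathbb Z$-graded differential graded Lie algebra over $\Bbbk$, with no topology; the free product is the coproduct in the category of dglas. For a discrete dgla $\mathfrak g$, $\mathfrak g^*$ is its linear dual, a linearly compact graded space with $(\mathfrak g^* )^i=(\mathfrak g_i)^*$, and $(\Sigma\mathfrak g^* )^i=(\mathfrak g^* )^{i-1}$. $\hat{\mathcal C}(\mathfrak g)$ is the complete non-unital commutative dg algebra with underlying graded algebra the completed non-unital symmetric algebra $\hat S_+\Sigma\mathfrak g^*$ (the product over $n\ge 1$ of the completed symmetric powers of $\Sigma\mathfrak g^*$) and differential $d=d_I+d_{II}$, where $d_I$ is induced by the internal differential of $\mathfrak g$ and $d_{II}$ is the continuous derivation determined by its restriction to $\Sigma\mathfrak g^*$, which is induced by the bracket $\mathfrak g\otimes\mathfrak g\to\mathfrak g$. (Thus $\hat{\mathcal C}(\mathfrak g)$ is the reduced Chevalley–Eilenberg cochain complex of $\mathfrak g$ with trivial coefficients.) *)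

theory Defs
  imports "HOL-Algebra.Algebraic_Closure_Type" "HOL-Analysis.Function_Topology"
    "HOL-Analysis.Product_Topology"
begin

section \<open>Differential graded Lie algebras\<close>

text \<open>
  The ground field is a type \<open>'k\<close> of class \<open>field_char_0\<close>; seen as a ring record it is
  \<^const>\<open>ring_of_type_algebra\<close>, and a vector space is an HOL-Algebra module over it.  The record
  type of modules extends rings, so it has fields \<open>mult\<close> and \<open>one\<close>; these are never used.
  A graded object is given by its homogeneous components; \<open>brk L i j\<close> and \<open>bdry L i\<close> are the
  restrictions of the bracket to \<open>L\<^sub>i \<times> L\<^sub>j\<close> and of the differential to \<open>L\<^sub>i\<close>.
\<close>

record ('k, 'a) dgla =
  homog :: "int \<Rightarrow> ('k, 'a) module"
  brk :: "int \<Rightarrow> int \<Rightarrow> 'a \<Rightarrow> 'a \<Rightarrow> 'a"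
  bdry :: "int \<Rightarrow> 'a \<Rightarrow> 'a"

abbreviation gr :: "('k, 'a) dgla \<Rightarrow> int \<Rightarrow> 'a set"
  where "gr L i \<equiv> carrier (homog L i)"

abbreviation vector_space_over :: "('k::field_char_0, 'a) module \<Rightarrow> bool"
  where "vector_space_over V \<equiv> Module.module (ring_of_type_algebra :: 'k ring) V"

locale dgla =
  fixes L :: "('k::field_char_0, 'a) dgla"
  assumes vs: "vector_space_over (homog L i)"
    and brk_closed: "x \<in> gr L i \<Longrightarrow> y \<in> gr L j \<Longrightarrow> brk L i j x y \<in> gr L (i + j)"
    and brk_add_left: "x \<in> gr L i \<Longrightarrow> x' \<in> gr L i \<Longrightarrow> y \<in> gr L j \<Longrightarrow>
      brk L i j (x \<oplus>\<^bsub>homog L i\<^esub> x') y = brk L i j x y \<oplus>\<^bsub>homog L (i + j)\<^esub> brk L i j x' y"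
    and brk_add_right: "x \<in> gr L i \<Longrightarrow> y \<in> gr L j \<Longrightarrow> y' \<in> gr L j \<Longrightarrow>
      brk L i j x (y \<oplus>\<^bsub>homog L j\<^esub> y') = brk L i j x y \<oplus>\<^bsub>homog L (i + j)\<^esub> brk L i j x y'"
    and brk_smult_left: "x \<in> gr L i \<Longrightarrow> y \<in> gr L j \<Longrightarrow>
      brk L i j (c \<odot>\<^bsub>homog L i\<^esub> x) y = c \<odot>\<^bsub>homog L (i + j)\<^esub> brk L i j x y"
    and brk_smult_right: "x \<in> gr L i \<Longrightarrow> y \<in> gr L j \<Longrightarrow>
      brk L i j x (c \<odot>\<^bsub>homog L j\<^esub> y) = c \<odot>\<^bsub>homog L (i + j)\<^esub> brk L i j x y"
    and brk_antisym: "x \<in> gr L i \<Longrightarrow> y \<in> gr L j \<Longrightarrow>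
      brk L i j x y = (- ((-1) powi (i * j))) \<odot>\<^bsub>homog L (i + j)\<^esub> brk L j i y x"
    and jacobi: "x \<in> gr L i \<Longrightarrow> y \<in> gr L j \<Longrightarrow> z \<in> gr L l \<Longrightarrow>
      brk L i (j + l) x (brk L j l y z) =
        brk L (i + j) l (brk L i j x y) z \<oplus>\<^bsub>homog L (i + j + l)\<^esub>
        ((-1) powi (i * j)) \<odot>\<^bsub>homog L (i + j + l)\<^esub> brk L j (i + l) y (brk L i l x z)"
    and bdry_closed: "x \<in> gr L i \<Longrightarrow> bdry L i x \<in> gr L (i - 1)"
    and bdry_add: "x \<in> gr L i \<Longrightarrow> x' \<in> gr L i \<Longrightarrow>
      bdry L i (x \<oplus>\<^bsub>homog L i\<^esub> x') = bdry L i x \<oplus>\<^bsub>homog L (i - 1)\<^esub> bdry L i x'"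
    and bdry_smult: "x \<in> gr L i \<Longrightarrow>
      bdry L i (c \<odot>\<^bsub>homog L i\<^esub> x) = c \<odot>\<^bsub>homog L (i - 1)\<^esub> bdry L i x"
    and bdry_bdry: "x \<in> gr L i \<Longrightarrow> bdry L (i - 1) (bdry L i x) = \<zero>\<^bsub>homog L (i - 2)\<^esub>"
    and leibniz: "x \<in> gr L i \<Longrightarrow> y \<in> gr L j \<Longrightarrow>
      bdry L (i + j) (brk L i j x y) =
        brk L (i - 1) j (bdry L i x) y \<oplus>\<^bsub>homog L (i + j - 1)\<^esub>
        ((-1) powi i) \<odot>\<^bsub>homog L (i + j - 1)\<^esub> brk L i (j - 1) x (bdry L j y)"

definition dgla_hom ::
    "('k, 'a) dgla \<Rightarrow> ('k, 'b) dgla \<Rightarrow> (int \<Rightarrow> 'a \<Rightarrow> 'b) \<Rightarrow> bool"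
  where "dgla_hom L M \<phi> \<longleftrightarrow>
    (\<forall>i. \<forall>x\<in>gr L i. \<phi> i x \<in> gr M i) \<and>
    (\<forall>i. \<forall>x\<in>gr L i. \<forall>y\<in>gr L i. \<phi> i (x \<oplus>\<^bsub>homog L i\<^esub> y) = \<phi> i x \<oplus>\<^bsub>homog M i\<^esub> \<phi> i y) \<and>
    (\<forall>i c. \<forall>x\<in>gr L i. \<phi> i (c \<odot>\<^bsub>homog L i\<^esub> x) = c \<odot>\<^bsub>homog M i\<^esub> \<phi> i x) \<and>
    (\<forall>i j. \<forall>x\<in>gr L i. \<forall>y\<in>gr L j. \<phi> (i + j) (brk L i j x y) = brk M i j (\<phi> i x) (\<phi> j y)) \<and>
    (\<forall>i. \<forall>x\<in>gr L i. \<phi> (i - 1) (bdry L i x) = bdry M i (\<phi> i x))"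


section \<open>The free product of two dglas\<close>

text \<open>
  The coproduct is presented by generators and relations: its elements are formal expressions in
  the elements of \<open>G\<close> and \<open>H\<close>, modulo the least congruence that forces the dgla axioms and makes
  the two inclusions morphisms of dglas.  That this has the universal property of the coproduct is
  shown below (\<open>free_product_is_dgla\<close>, \<open>free_product_universal\<close>).
\<close>

datatype ('k, 'a, 'b) fp_term =
    InL int 'a
  | InR int 'b
  | Zero int
  | Plus "('k, 'a, 'b) fp_term" "('k, 'a, 'b) fp_term"
  | Scal 'k "('k, 'a, 'b) fp_term"
  | Brk "('k, 'a, 'b) fp_term" "('k, 'a, 'b) fp_term"
  | Bdry "('k, 'a, 'b) fp_term"

primrec fp_deg :: "('k, 'a, 'b) fp_term \<Rightarrow> int" where
  "fp_deg (InL i x) = i"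
| "fp_deg (InR i y) = i"
| "fp_deg (Zero i) = i"
| "fp_deg (Plus s t) = fp_deg s"
| "fp_deg (Scal c t) = fp_deg t"
| "fp_deg (Brk s t) = fp_deg s + fp_deg t"
| "fp_deg (Bdry t) = fp_deg t - 1"

primrec fp_wf :: "('k, 'a) dgla \<Rightarrow> ('k, 'b) dgla \<Rightarrow> ('k, 'a, 'b) fp_term \<Rightarrow> bool" where
  "fp_wf G H (InL i x) \<longleftrightarrow> x \<in> gr G i"
| "fp_wf G H (InR i y) \<longleftrightarrow> y \<in> gr H i"
| "fp_wf G H (Zero i) \<longleftrightarrow> True"
| "fp_wf G H (Plus s t) \<longleftrightarrow> fp_wf G H s \<and> fp_wf G H t \<and> fp_deg s = fp_deg t"
| "fp_wf G H (Scal c t) \<longleftrightarrow> fp_wf G H t"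
| "fp_wf G H (Brk s t) \<longleftrightarrow> fp_wf G H s \<and> fp_wf G H t"
| "fp_wf G H (Bdry t) \<longleftrightarrow> fp_wf G H t"

definition fp_terms :: "('k, 'a) dgla \<Rightarrow> ('k, 'b) dgla \<Rightarrow> int \<Rightarrow> ('k, 'a, 'b) fp_term set"
  where "fp_terms G H i = {t. fp_wf G H t \<and> fp_deg t = i}"

inductive fp_eq ::
    "('k::field_char_0, 'a) dgla \<Rightarrow> ('k, 'b) dgla \<Rightarrow> ('k, 'a, 'b) fp_term \<Rightarrow> ('k, 'a, 'b) fp_term \<Rightarrow> bool"
  for G :: "('k::field_char_0, 'a) dgla" and H :: "('k, 'b) dgla"
  where
    refl: "s \<in> fp_terms G H i \<Longrightarrow> fp_eq G H s s"
  | sym: "fp_eq G H s t \<Longrightarrow> fp_eq G H t s"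
  | trans: "fp_eq G H s t \<Longrightarrow> fp_eq G H t u \<Longrightarrow> fp_eq G H s u"
  \<comment> \<open>compatibility with the operations\<close>
  | Plus: "fp_eq G H s s' \<Longrightarrow> fp_eq G H t t' \<Longrightarrow> fp_deg s = fp_deg t \<Longrightarrow>
      fp_eq G H (Plus s t) (Plus s' t')"
  | Scal: "fp_eq G H s s' \<Longrightarrow> fp_eq G H (Scal c s) (Scal c s')"
  | Brk: "fp_eq G H s s' \<Longrightarrow> fp_eq G H t t' \<Longrightarrow> fp_eq G H (Brk s t) (Brk s' t')"
  | Bdry: "fp_eq G H s s' \<Longrightarrow> fp_eq G H (Bdry s) (Bdry s')"
  \<comment> \<open>vector space axioms in each degree\<close>
  | add_assoc: "s \<in> fp_terms G H i \<Longrightarrow> t \<in> fp_terms G H i \<Longrightarrow> u \<in> fp_terms G H i \<Longrightarrow>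
      fp_eq G H (Plus (Plus s t) u) (Plus s (Plus t u))"
  | add_comm: "s \<in> fp_terms G H i \<Longrightarrow> t \<in> fp_terms G H i \<Longrightarrow> fp_eq G H (Plus s t) (Plus t s)"
  | add_zero: "s \<in> fp_terms G H i \<Longrightarrow> fp_eq G H (Plus (Zero i) s) s"
  | add_neg: "s \<in> fp_terms G H i \<Longrightarrow> fp_eq G H (Plus (Scal (-1) s) s) (Zero i)"
  | scal_add_left: "s \<in> fp_terms G H i \<Longrightarrow>
      fp_eq G H (Scal (a + b) s) (Plus (Scal a s) (Scal b s))"
  | scal_add_right: "s \<in> fp_terms G H i \<Longrightarrow> t \<in> fp_terms G H i \<Longrightarrow>
      fp_eq G H (Scal a (Plus s t)) (Plus (Scal a s) (Scal a t))"
  | scal_mult: "s \<in> fp_terms G H i \<Longrightarrow> fp_eq G H (Scal (a * b) s) (Scal a (Scal b s))"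
  | scal_one: "s \<in> fp_terms G H i \<Longrightarrow> fp_eq G H (Scal 1 s) s"
  \<comment> \<open>dgla axioms\<close>
  | brk_add_left: "s \<in> fp_terms G H i \<Longrightarrow> s' \<in> fp_terms G H i \<Longrightarrow> t \<in> fp_terms G H j \<Longrightarrow>
      fp_eq G H (Brk (Plus s s') t) (Plus (Brk s t) (Brk s' t))"
  | brk_add_right: "s \<in> fp_terms G H i \<Longrightarrow> t \<in> fp_terms G H j \<Longrightarrow> t' \<in> fp_terms G H j \<Longrightarrow>
      fp_eq G H (Brk s (Plus t t')) (Plus (Brk s t) (Brk s t'))"
  | brk_smult_left: "s \<in> fp_terms G H i \<Longrightarrow> t \<in> fp_terms G H j \<Longrightarrow>
      fp_eq G H (Brk (Scal c s) t) (Scal c (Brk s t))"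
  | brk_smult_right: "s \<in> fp_terms G H i \<Longrightarrow> t \<in> fp_terms G H j \<Longrightarrow>
      fp_eq G H (Brk s (Scal c t)) (Scal c (Brk s t))"
  | brk_antisym: "s \<in> fp_terms G H i \<Longrightarrow> t \<in> fp_terms G H j \<Longrightarrow>
      fp_eq G H (Brk s t) (Scal (- ((-1) powi (i * j))) (Brk t s))"
  | jacobi: "s \<in> fp_terms G H i \<Longrightarrow> t \<in> fp_terms G H j \<Longrightarrow> u \<in> fp_terms G H l \<Longrightarrow>
      fp_eq G H (Brk s (Brk t u)) (Plus (Brk (Brk s t) u) (Scal ((-1) powi (i * j)) (Brk t (Brk s u))))"
  | bdry_add: "s \<in> fp_terms G H i \<Longrightarrow> t \<in> fp_terms G H i \<Longrightarrow>
      fp_eq G H (Bdry (Plus s t)) (Plus (Bdry s) (Bdry t))"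
  | bdry_smult: "s \<in> fp_terms G H i \<Longrightarrow> fp_eq G H (Bdry (Scal c s)) (Scal c (Bdry s))"
  | bdry_bdry: "s \<in> fp_terms G H i \<Longrightarrow> fp_eq G H (Bdry (Bdry s)) (Zero (i - 2))"
  | leibniz: "s \<in> fp_terms G H i \<Longrightarrow> t \<in> fp_terms G H j \<Longrightarrow>
      fp_eq G H (Bdry (Brk s t)) (Plus (Brk (Bdry s) t) (Scal ((-1) powi i) (Brk s (Bdry t))))"
  \<comment> \<open>the inclusions are morphisms\<close>
  | InL_add: "x \<in> gr G i \<Longrightarrow> x' \<in> gr G i \<Longrightarrow>
      fp_eq G H (InL i (x \<oplus>\<^bsub>homog G i\<^esub> x')) (Plus (InL i x) (InL i x'))"
  | InL_smult: "x \<in> gr G i \<Longrightarrow> fp_eq G H (InL i (c \<odot>\<^bsub>homog G i\<^esub> x)) (Scal c (InL i x))"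
  | InL_brk: "x \<in> gr G i \<Longrightarrow> x' \<in> gr G j \<Longrightarrow>
      fp_eq G H (InL (i + j) (brk G i j x x')) (Brk (InL i x) (InL j x'))"
  | InL_bdry: "x \<in> gr G i \<Longrightarrow> fp_eq G H (InL (i - 1) (bdry G i x)) (Bdry (InL i x))"
  | InR_add: "y \<in> gr H i \<Longrightarrow> y' \<in> gr H i \<Longrightarrow>
      fp_eq G H (InR i (y \<oplus>\<^bsub>homog H i\<^esub> y')) (Plus (InR i y) (InR i y'))"
  | InR_smult: "y \<in> gr H i \<Longrightarrow> fp_eq G H (InR i (c \<odot>\<^bsub>homog H i\<^esub> y)) (Scal c (InR i y))"
  | InR_brk: "y \<in> gr H i \<Longrightarrow> y' \<in> gr H j \<Longrightarrow>
      fp_eq G H (InR (i + j) (brk H i j y y')) (Brk (InR i y) (InR j y'))"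
  | InR_bdry: "y \<in> gr H i \<Longrightarrow> fp_eq G H (InR (i - 1) (bdry H i y)) (Bdry (InR i y))"

definition fp_class ::
    "('k::field_char_0, 'a) dgla \<Rightarrow> ('k, 'b) dgla \<Rightarrow> ('k, 'a, 'b) fp_term \<Rightarrow> ('k, 'a, 'b) fp_term set"
  where "fp_class G H t = {u. fp_eq G H t u}"

definition free_product ::
    "('k::field_char_0, 'a) dgla \<Rightarrow> ('k, 'b) dgla \<Rightarrow> ('k, ('k, 'a, 'b) fp_term set) dgla"
  where "free_product G H = \<lparr>
    homog = (\<lambda>i. \<lparr>
      carrier = fp_class G H ` fp_terms G H i,
      monoid.mult = undefined,
      monoid.one = undefined,
      ring.zero = fp_class G H (Zero i),
      ring.add = (\<lambda>S T. \<Union>s\<in>S. \<Union>t\<in>T. fp_class G H (Plus s t)),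
      module.smult = (\<lambda>c S. \<Union>s\<in>S. fp_class G H (Scal c s))\<rparr>),
    brk = (\<lambda>i j S T. \<Union>s\<in>S. \<Union>t\<in>T. fp_class G H (Brk s t)),
    bdry = (\<lambda>i S. \<Union>s\<in>S. fp_class G H (Bdry s))\<rparr>"

locale two_dglas = G: dgla G + H: dgla H
  for G :: "('k::field_char_0, 'a) dgla" and H :: "('k, 'b) dgla"
begin

lemma gr_closed:
  "x \<in> gr G i \<Longrightarrow> x' \<in> gr G i \<Longrightarrow> x \<oplus>\<^bsub>homog G i\<^esub> x' \<in> gr G i"
  "x \<in> gr G i \<Longrightarrow> c \<odot>\<^bsub>homog G i\<^esub> x \<in> gr G i"
  "y \<in> gr H i \<Longrightarrow> y' \<in> gr H i \<Longrightarrow> y \<oplus>\<^bsub>homog H i\<^esub> y' \<in> gr H i"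
  "y \<in> gr H i \<Longrightarrow> c \<odot>\<^bsub>homog H i\<^esub> y \<in> gr H i"
proof -
  interpret g: Module.module "ring_of_type_algebra :: 'k ring" "homog G i" by (rule G.vs)
  interpret h: Module.module "ring_of_type_algebra :: 'k ring" "homog H i" by (rule H.vs)
  show "x \<in> gr G i \<Longrightarrow> x' \<in> gr G i \<Longrightarrow> x \<oplus>\<^bsub>homog G i\<^esub> x' \<in> gr G i" by simp
  show "y \<in> gr H i \<Longrightarrow> y' \<in> gr H i \<Longrightarrow> y \<oplus>\<^bsub>homog H i\<^esub> y' \<in> gr H i" by simp
  show "x \<in> gr G i \<Longrightarrow> c \<odot>\<^bsub>homog G i\<^esub> x \<in> gr G i"
    by (rule g.smult_closed) (auto simp: ring_of_type_algebra_def)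
  show "y \<in> gr H i \<Longrightarrow> c \<odot>\<^bsub>homog H i\<^esub> y \<in> gr H i"
    by (rule h.smult_closed) (auto simp: ring_of_type_algebra_def)
qed

lemma fp_eq_wf: "fp_eq G H s t \<Longrightarrow> fp_wf G H s \<and> fp_wf G H t \<and> fp_deg s = fp_deg t"
  by (induction rule: fp_eq.induct)
    (simp_all add: fp_terms_def gr_closed G.brk_closed H.brk_closed G.bdry_closed H.bdry_closed)

lemma fp_class_eqI:
  assumes "fp_eq G H s t"
  shows "fp_class G H s = fp_class G H t"
  unfolding fp_class_def
  using fp_eq.trans[OF assms] fp_eq.trans[OF fp_eq.sym[OF assms]] by (intro Collect_cong iffI)

lemma fp_class_self: "s \<in> fp_terms G H i \<Longrightarrow> s \<in> fp_class G H s"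
  by (auto simp: fp_class_def intro: fp_eq.refl)

lemma terms_intros:
  "x \<in> gr G i \<Longrightarrow> InL i x \<in> fp_terms G H i"
  "y \<in> gr H i \<Longrightarrow> InR i y \<in> fp_terms G H i"
  "Zero i \<in> fp_terms G H i"
  "s \<in> fp_terms G H i \<Longrightarrow> t \<in> fp_terms G H i \<Longrightarrow> Plus s t \<in> fp_terms G H i"
  "s \<in> fp_terms G H i \<Longrightarrow> Scal c s \<in> fp_terms G H i"
  "s \<in> fp_terms G H i \<Longrightarrow> t \<in> fp_terms G H j \<Longrightarrow> Brk s t \<in> fp_terms G H (i + j)"
  "s \<in> fp_terms G H i \<Longrightarrow> Bdry s \<in> fp_terms G H (i - 1)"
  by (auto simp: fp_terms_def)

lemma UN_class:
  assumes "s \<in> fp_terms G H i" "\<And>u. fp_eq G H s u \<Longrightarrow> f u = C"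
  shows "(\<Union>u\<in>fp_class G H s. f u) = C"
  using assms fp_class_self[OF assms(1)] by (auto simp: fp_class_def)

lemma fp_ops:
  "gr (free_product G H) i = fp_class G H ` fp_terms G H i"
  "\<zero>\<^bsub>homog (free_product G H) i\<^esub> = fp_class G H (Zero i)"
  "s \<in> fp_terms G H i \<Longrightarrow> t \<in> fp_terms G H i \<Longrightarrow>
    fp_class G H s \<oplus>\<^bsub>homog (free_product G H) i\<^esub> fp_class G H t = fp_class G H (Plus s t)"
  "s \<in> fp_terms G H i \<Longrightarrow>
    c \<odot>\<^bsub>homog (free_product G H) i\<^esub> fp_class G H s = fp_class G H (Scal c s)"
  "s \<in> fp_terms G H i \<Longrightarrow> t \<in> fp_terms G H j \<Longrightarrow>
    brk (free_product G H) i j (fp_class G H s) (fp_class G H t) = fp_class G H (Brk s t)"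
  "s \<in> fp_terms G H i \<Longrightarrow>
    bdry (free_product G H) i (fp_class G H s) = fp_class G H (Bdry s)"
proof -
  show "fp_class G H s \<oplus>\<^bsub>homog (free_product G H) i\<^esub> fp_class G H t = fp_class G H (Plus s t)"
    if s: "s \<in> fp_terms G H i" and t: "t \<in> fp_terms G H i"
  proof -
    have "fp_deg s = fp_deg t" using s t by (simp add: fp_terms_def)
    then have "fp_class G H (Plus u v) = fp_class G H (Plus s t)"
      if "fp_eq G H s u" "fp_eq G H t v" for u v
      using that by (intro fp_class_eqI[symmetric] fp_eq.Plus)
    then show ?thesis unfolding free_product_def by (simp add: UN_class[OF s] UN_class[OF t])
  qed
  show "c \<odot>\<^bsub>homog (free_product G H) i\<^esub> fp_class G H s = fp_class G H (Scal c s)"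
    if s: "s \<in> fp_terms G H i"
  proof -
    have "fp_class G H (Scal c u) = fp_class G H (Scal c s)" if "fp_eq G H s u" for u
      using that by (intro fp_class_eqI[symmetric] fp_eq.Scal)
    then show ?thesis unfolding free_product_def by (simp add: UN_class[OF s])
  qed
  show "brk (free_product G H) i j (fp_class G H s) (fp_class G H t) = fp_class G H (Brk s t)"
    if s: "s \<in> fp_terms G H i" and t: "t \<in> fp_terms G H j"
  proof -
    have "fp_class G H (Brk u v) = fp_class G H (Brk s t)"
      if "fp_eq G H s u" "fp_eq G H t v" for u v
      using that by (intro fp_class_eqI[symmetric] fp_eq.Brk)
    then show ?thesis unfolding free_product_def by (simp add: UN_class[OF s] UN_class[OF t])
  qed
  show "bdry (free_product G H) i (fp_class G H s) = fp_class G H (Bdry s)"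
    if s: "s \<in> fp_terms G H i"
  proof -
    have "fp_class G H (Bdry u) = fp_class G H (Bdry s)" if "fp_eq G H s u" for u
      using that by (intro fp_class_eqI[symmetric] fp_eq.Bdry)
    then show ?thesis unfolding free_product_def by (simp add: UN_class[OF s])
  qed
qed (simp_all add: free_product_def)

lemma free_product_vs: "vector_space_over (homog (free_product G H) i)"
proof (rule moduleI)
  show "cring (ring_of_type_algebra :: 'k ring)"
    by (rule cring_from_type_algebra)
  show "abelian_group (homog (free_product G H) i)"
  proof (rule abelian_groupI)
    fix x y z
    assume "x \<in> gr (free_product G H) i"
    then obtain s where s: "s \<in> fp_terms G H i" "x = fp_class G H s" by (auto simp: fp_ops)
    show "\<zero>\<^bsub>homog (free_product G H) i\<^esub> \<oplus>\<^bsub>homog (free_product G H) i\<^esub> x = x"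
      using s by (auto simp: fp_ops terms_intros fp_class_eqI[OF fp_eq.add_zero])
    show "\<exists>y\<in>gr (free_product G H) i.
        y \<oplus>\<^bsub>homog (free_product G H) i\<^esub> x = \<zero>\<^bsub>homog (free_product G H) i\<^esub>"
      by (rule bexI[of _ "fp_class G H (Scal (-1) s)"])
        (use s in \<open>auto simp: fp_ops terms_intros fp_class_eqI[OF fp_eq.add_neg]\<close>)
    assume "y \<in> gr (free_product G H) i"
    then obtain t where t: "t \<in> fp_terms G H i" "y = fp_class G H t" by (auto simp: fp_ops)
    show "x \<oplus>\<^bsub>homog (free_product G H) i\<^esub> y \<in> gr (free_product G H) i"
      using s t by (auto simp: fp_ops terms_intros)
    show "x \<oplus>\<^bsub>homog (free_product G H) i\<^esub> y = y \<oplus>\<^bsub>homog (free_product G H) i\<^esub> x"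
      using s t by (auto simp: fp_ops terms_intros fp_class_eqI[OF fp_eq.add_comm])
    assume "z \<in> gr (free_product G H) i"
    then obtain u where u: "u \<in> fp_terms G H i" "z = fp_class G H u" by (auto simp: fp_ops)
    show "x \<oplus>\<^bsub>homog (free_product G H) i\<^esub> y \<oplus>\<^bsub>homog (free_product G H) i\<^esub> z =
        x \<oplus>\<^bsub>homog (free_product G H) i\<^esub> (y \<oplus>\<^bsub>homog (free_product G H) i\<^esub> z)"
      using s t u by (auto simp: fp_ops terms_intros fp_class_eqI[OF fp_eq.add_assoc])
  qed (auto simp: fp_ops terms_intros)
next
  note K = ring_of_type_algebra_def
  fix a b :: 'k and x y
  assume "x \<in> gr (free_product G H) i"
  then obtain s where s: "s \<in> fp_terms G H i" "x = fp_class G H s" by (auto simp: fp_ops)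
  show "a \<odot>\<^bsub>homog (free_product G H) i\<^esub> x \<in> gr (free_product G H) i"
    using s by (auto simp: fp_ops terms_intros)
  show "(a \<oplus>\<^bsub>ring_of_type_algebra\<^esub> b) \<odot>\<^bsub>homog (free_product G H) i\<^esub> x =
      a \<odot>\<^bsub>homog (free_product G H) i\<^esub> x \<oplus>\<^bsub>homog (free_product G H) i\<^esub>
      b \<odot>\<^bsub>homog (free_product G H) i\<^esub> x"
    using s by (simp add: K fp_ops terms_intros fp_class_eqI[OF fp_eq.scal_add_left])
  show "(a \<otimes>\<^bsub>ring_of_type_algebra\<^esub> b) \<odot>\<^bsub>homog (free_product G H) i\<^esub> x =
      a \<odot>\<^bsub>homog (free_product G H) i\<^esub> (b \<odot>\<^bsub>homog (free_product G H) i\<^esub> x)"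
    using s by (simp add: K fp_ops terms_intros fp_class_eqI[OF fp_eq.scal_mult])
  show "\<one>\<^bsub>ring_of_type_algebra\<^esub> \<odot>\<^bsub>homog (free_product G H) i\<^esub> x = x"
    using s by (simp add: K fp_ops terms_intros fp_class_eqI[OF fp_eq.scal_one])
  assume "y \<in> gr (free_product G H) i"
  then obtain t where t: "t \<in> fp_terms G H i" "y = fp_class G H t" by (auto simp: fp_ops)
  show "a \<odot>\<^bsub>homog (free_product G H) i\<^esub> (x \<oplus>\<^bsub>homog (free_product G H) i\<^esub> y) =
      a \<odot>\<^bsub>homog (free_product G H) i\<^esub> x \<oplus>\<^bsub>homog (free_product G H) i\<^esub>
      a \<odot>\<^bsub>homog (free_product G H) i\<^esub> y"
    using s t by (simp add: fp_ops terms_intros fp_class_eqI[OF fp_eq.scal_add_right])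
qed

theorem free_product_is_dgla: "dgla (free_product G H)"
proof (rule dgla.intro, goal_cases)
  case (1 i)
  show ?case by (rule free_product_vs)
next
  case (2 x i y j)
  then show ?case by (auto simp: fp_ops terms_intros)
next
  case (3 x i x' y j)
  then show ?case by (auto simp: fp_ops terms_intros fp_class_eqI[OF fp_eq.brk_add_left])
next
  case (4 x i y j y')
  then show ?case by (auto simp: fp_ops terms_intros fp_class_eqI[OF fp_eq.brk_add_right])
next
  case (5 x i y j c)
  then show ?case by (auto simp: fp_ops terms_intros fp_class_eqI[OF fp_eq.brk_smult_left])
next
  case (6 x i y j c)
  then show ?case by (auto simp: fp_ops terms_intros fp_class_eqI[OF fp_eq.brk_smult_right])
next
  case (7 x i y j)
  then obtain s t where "s \<in> fp_terms G H i" "x = fp_class G H s"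
    "t \<in> fp_terms G H j" "y = fp_class G H t" by (auto simp: fp_ops)
  moreover from this have "Brk t s \<in> fp_terms G H (i + j)" by (auto simp: fp_terms_def)
  ultimately show ?case by (simp add: fp_ops fp_class_eqI[OF fp_eq.brk_antisym, of s i t j])
next
  case (8 x i y j z l)
  then obtain s t u where "s \<in> fp_terms G H i" "x = fp_class G H s"
    "t \<in> fp_terms G H j" "y = fp_class G H t" "u \<in> fp_terms G H l" "z = fp_class G H u"
    by (auto simp: fp_ops)
  moreover from this have "Brk t (Brk s u) \<in> fp_terms G H (i + j + l)"
    "Brk (Brk s t) u \<in> fp_terms G H (i + j + l)"
    by (auto simp: fp_terms_def)
  ultimately show ?case
    by (simp add: fp_ops terms_intros fp_class_eqI[OF fp_eq.jacobi, of s i t j u l])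
next
  case (9 x i)
  then show ?case by (auto simp: fp_ops terms_intros)
next
  case (10 x i x')
  then show ?case by (auto simp: fp_ops terms_intros fp_class_eqI[OF fp_eq.bdry_add])
next
  case (11 x i c)
  then show ?case by (auto simp: fp_ops terms_intros fp_class_eqI[OF fp_eq.bdry_smult])
next
  case (12 x i)
  then show ?case by (auto simp: fp_ops terms_intros fp_class_eqI[OF fp_eq.bdry_bdry])
next
  case (13 x i y j)
  then obtain s t where "s \<in> fp_terms G H i" "x = fp_class G H s"
    "t \<in> fp_terms G H j" "y = fp_class G H t" by (auto simp: fp_ops)
  moreover from this have "Brk (Bdry s) t \<in> fp_terms G H (i + j - 1)"
     "Brk s (Bdry t) \<in> fp_terms G H (i + j - 1)" by (auto simp: fp_terms_def)
  ultimately show ?case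
    by (simp add: fp_ops terms_intros fp_class_eqI[OF fp_eq.leibniz, of s i t j])
qed

definition incl_left :: "int \<Rightarrow> 'a \<Rightarrow> ('k, 'a, 'b) fp_term set"
  where "incl_left i x = fp_class G H (InL i x)"

definition incl_right :: "int \<Rightarrow> 'b \<Rightarrow> ('k, 'a, 'b) fp_term set"
  where "incl_right i y = fp_class G H (InR i y)"

lemmas InLR_eqs =
  fp_eq.InL_add[THEN fp_class_eqI] fp_eq.InL_smult[THEN fp_class_eqI]
  fp_eq.InL_brk[THEN fp_class_eqI] fp_eq.InL_bdry[THEN fp_class_eqI]
  fp_eq.InR_add[THEN fp_class_eqI] fp_eq.InR_smult[THEN fp_class_eqI]
  fp_eq.InR_brk[THEN fp_class_eqI] fp_eq.InR_bdry[THEN fp_class_eqI]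

lemma incl_left_hom: "dgla_hom G (free_product G H) incl_left"
  unfolding dgla_hom_def incl_left_def
  by (auto simp: fp_ops terms_intros InLR_eqs)

lemma incl_right_hom: "dgla_hom H (free_product G H) incl_right"
  unfolding dgla_hom_def incl_right_def
  by (auto simp: fp_ops terms_intros InLR_eqs)

end

primrec fp_eval ::
    "('k, 'c) dgla \<Rightarrow> (int \<Rightarrow> 'a \<Rightarrow> 'c) \<Rightarrow> (int \<Rightarrow> 'b \<Rightarrow> 'c) \<Rightarrow> ('k, 'a, 'b) fp_term \<Rightarrow> 'c" where
  "fp_eval Q \<alpha> \<beta> (InL i x) = \<alpha> i x"
| "fp_eval Q \<alpha> \<beta> (InR i y) = \<beta> i y"
| "fp_eval Q \<alpha> \<beta> (Zero i) = \<zero>\<^bsub>homog Q i\<^esub>"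
| "fp_eval Q \<alpha> \<beta> (Plus s t) = fp_eval Q \<alpha> \<beta> s \<oplus>\<^bsub>homog Q (fp_deg s)\<^esub> fp_eval Q \<alpha> \<beta> t"
| "fp_eval Q \<alpha> \<beta> (Scal c t) = c \<odot>\<^bsub>homog Q (fp_deg t)\<^esub> fp_eval Q \<alpha> \<beta> t"
| "fp_eval Q \<alpha> \<beta> (Brk s t) = brk Q (fp_deg s) (fp_deg t) (fp_eval Q \<alpha> \<beta> s) (fp_eval Q \<alpha> \<beta> t)"
| "fp_eval Q \<alpha> \<beta> (Bdry t) = bdry Q (fp_deg t) (fp_eval Q \<alpha> \<beta> t)"

context dgla
begin

lemma vs_ops:
  shows vs_add_closed: "x \<in> gr L i \<Longrightarrow> y \<in> gr L i \<Longrightarrow> x \<oplus>\<^bsub>homog L i\<^esub> y \<in> gr L i"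
    and vs_smult_closed: "x \<in> gr L i \<Longrightarrow> c \<odot>\<^bsub>homog L i\<^esub> x \<in> gr L i"
    and vs_zero_closed: "\<zero>\<^bsub>homog L i\<^esub> \<in> gr L i"
    and vs_assoc: "x \<in> gr L i \<Longrightarrow> y \<in> gr L i \<Longrightarrow> z \<in> gr L i \<Longrightarrow>
      x \<oplus>\<^bsub>homog L i\<^esub> y \<oplus>\<^bsub>homog L i\<^esub> z = x \<oplus>\<^bsub>homog L i\<^esub> (y \<oplus>\<^bsub>homog L i\<^esub> z)"
    and vs_comm: "x \<in> gr L i \<Longrightarrow> y \<in> gr L i \<Longrightarrow> x \<oplus>\<^bsub>homog L i\<^esub> y = y \<oplus>\<^bsub>homog L i\<^esub> x"
    and vs_zero: "x \<in> gr L i \<Longrightarrow> \<zero>\<^bsub>homog L i\<^esub> \<oplus>\<^bsub>homog L i\<^esub> x = x"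
    and vs_neg: "x \<in> gr L i \<Longrightarrow> (-1) \<odot>\<^bsub>homog L i\<^esub> x \<oplus>\<^bsub>homog L i\<^esub> x = \<zero>\<^bsub>homog L i\<^esub>"
    and vs_l_distr: "x \<in> gr L i \<Longrightarrow>
      (a + b) \<odot>\<^bsub>homog L i\<^esub> x = a \<odot>\<^bsub>homog L i\<^esub> x \<oplus>\<^bsub>homog L i\<^esub> b \<odot>\<^bsub>homog L i\<^esub> x"
    and vs_r_distr: "x \<in> gr L i \<Longrightarrow> y \<in> gr L i \<Longrightarrow>
      a \<odot>\<^bsub>homog L i\<^esub> (x \<oplus>\<^bsub>homog L i\<^esub> y) = a \<odot>\<^bsub>homog L i\<^esub> x \<oplus>\<^bsub>homog L i\<^esub> a \<odot>\<^bsub>homog L i\<^esub> y"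
    and vs_smult_assoc: "x \<in> gr L i \<Longrightarrow>
      (a * b) \<odot>\<^bsub>homog L i\<^esub> x = a \<odot>\<^bsub>homog L i\<^esub> (b \<odot>\<^bsub>homog L i\<^esub> x)"
    and vs_one: "x \<in> gr L i \<Longrightarrow> 1 \<odot>\<^bsub>homog L i\<^esub> x = x"
proof -
  interpret M: Module.module "ring_of_type_algebra :: 'k ring" "homog L i" by (rule vs)
  note K = ring_of_type_algebra_def
  show "x \<in> gr L i \<Longrightarrow> y \<in> gr L i \<Longrightarrow> x \<oplus>\<^bsub>homog L i\<^esub> y \<in> gr L i" by simp
  show *: "x \<in> gr L i \<Longrightarrow> c \<odot>\<^bsub>homog L i\<^esub> x \<in> gr L i" for x c
    by (rule M.smult_closed) (auto simp: K)
  show "\<zero>\<^bsub>homog L i\<^esub> \<in> gr L i" by simp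
  show "x \<in> gr L i \<Longrightarrow> y \<in> gr L i \<Longrightarrow> z \<in> gr L i \<Longrightarrow>
      x \<oplus>\<^bsub>homog L i\<^esub> y \<oplus>\<^bsub>homog L i\<^esub> z = x \<oplus>\<^bsub>homog L i\<^esub> (y \<oplus>\<^bsub>homog L i\<^esub> z)"
    by (rule M.a_assoc)
  show "x \<in> gr L i \<Longrightarrow> y \<in> gr L i \<Longrightarrow> x \<oplus>\<^bsub>homog L i\<^esub> y = y \<oplus>\<^bsub>homog L i\<^esub> x"
    by (rule M.a_comm)
  show "x \<in> gr L i \<Longrightarrow> \<zero>\<^bsub>homog L i\<^esub> \<oplus>\<^bsub>homog L i\<^esub> x = x" by simp
  show ld: "x \<in> gr L i \<Longrightarrow>
      (a + b) \<odot>\<^bsub>homog L i\<^esub> x = a \<odot>\<^bsub>homog L i\<^esub> x \<oplus>\<^bsub>homog L i\<^esub> b \<odot>\<^bsub>homog L i\<^esub> x" for a b x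
    using M.smult_l_distr[of a b x] by (simp add: K)
  show one: "x \<in> gr L i \<Longrightarrow> 1 \<odot>\<^bsub>homog L i\<^esub> x = x" for x
    using M.smult_one[of x] by (simp add: K)
  show "x \<in> gr L i \<Longrightarrow> (-1) \<odot>\<^bsub>homog L i\<^esub> x \<oplus>\<^bsub>homog L i\<^esub> x = \<zero>\<^bsub>homog L i\<^esub>"
    using ld[of x "-1" 1] one[of x] M.smult_l_null[of x] by (simp add: K)
  show "x \<in> gr L i \<Longrightarrow> y \<in> gr L i \<Longrightarrow>
      a \<odot>\<^bsub>homog L i\<^esub> (x \<oplus>\<^bsub>homog L i\<^esub> y) = a \<odot>\<^bsub>homog L i\<^esub> x \<oplus>\<^bsub>homog L i\<^esub> a \<odot>\<^bsub>homog L i\<^esub> y"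
    using M.smult_r_distr[of a x y] by (simp add: K)
  show "x \<in> gr L i \<Longrightarrow>
      (a * b) \<odot>\<^bsub>homog L i\<^esub> x = a \<odot>\<^bsub>homog L i\<^esub> (b \<odot>\<^bsub>homog L i\<^esub> x)"
    using M.smult_assoc1[of a b x] by (simp add: K)
qed

end

context two_dglas
begin

lemma fp_eval_closed:
  assumes "dgla Q" "dgla_hom G Q \<alpha>" "dgla_hom H Q \<beta>"
  shows "fp_wf G H s \<Longrightarrow> fp_eval Q \<alpha> \<beta> s \<in> gr Q (fp_deg s)"
proof -
  interpret Q: dgla Q by fact
  show "fp_wf G H s \<Longrightarrow> fp_eval Q \<alpha> \<beta> s \<in> gr Q (fp_deg s)"
    by (induction s)
      (use assms in \<open>auto simp: dgla_hom_def Q.vs_ops(1-3) Q.brk_closed Q.bdry_closed\<close>)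
qed

lemma fp_eval_cong:
  assumes Q: "dgla Q" and \<alpha>: "dgla_hom G Q \<alpha>" and \<beta>: "dgla_hom H Q \<beta>"
  shows "fp_eq G H s t \<Longrightarrow> fp_eval Q \<alpha> \<beta> s = fp_eval Q \<alpha> \<beta> t"
proof -
  interpret Q: dgla Q by fact
  have cl: "s \<in> fp_terms G H i \<Longrightarrow> fp_deg s = i \<and> fp_eval Q \<alpha> \<beta> s \<in> gr Q i" for s i
    using fp_eval_closed[OF assms] by (auto simp: fp_terms_def)
  show "fp_eq G H s t \<Longrightarrow> fp_eval Q \<alpha> \<beta> s = fp_eval Q \<alpha> \<beta> t"
  proof (induction rule: fp_eq.induct)
    case (Plus s s' t t')
    then show ?case using fp_eq_wf[OF Plus(1)] fp_eq_wf[OF Plus(2)] by simp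
  next
    case (Scal s s' c)
    then show ?case using fp_eq_wf[OF Scal(1)] by simp
  next
    case (Brk s s' t t')
    then show ?case using fp_eq_wf[OF Brk(1)] fp_eq_wf[OF Brk(2)] by simp
  next
    case (Bdry s s')
    then show ?case using fp_eq_wf[OF Bdry(1)] by simp
  next
    case (brk_antisym s i t j)
    then show ?case
      using cl[of s i] cl[of t j] Q.brk_antisym[of "fp_eval Q \<alpha> \<beta> s" i "fp_eval Q \<alpha> \<beta> t" j]
      by (simp add: add.commute)
  next
    case (jacobi s i t j u l)
    then show ?case
      using cl[of s i] cl[of t j] cl[of u l]
        Q.jacobi[of "fp_eval Q \<alpha> \<beta> s" i "fp_eval Q \<alpha> \<beta> t" j "fp_eval Q \<alpha> \<beta> u" l]
      by (simp add: add_ac)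
  next
    case (leibniz s i t j)
    then show ?case
      using cl[of s i] cl[of t j] Q.leibniz[of "fp_eval Q \<alpha> \<beta> s" i "fp_eval Q \<alpha> \<beta> t" j]
      by (simp add: algebra_simps)
  next
    case (add_assoc s i t u)
    then show ?case using cl[of s i] cl[of t i] cl[of u i] by (simp add: Q.vs_assoc)
  next
    case (add_comm s i t)
    then show ?case using cl[of s i] cl[of t i] by (simp add: Q.vs_comm)
  next
    case (add_zero s i)
    then show ?case using cl[of s i] by (simp add: Q.vs_zero)
  next
    case (add_neg s i)
    then show ?case using cl[of s i] by (simp add: Q.vs_neg)
  next
    case (scal_add_left s i a b)
    then show ?case using cl[of s i] by (simp add: Q.vs_l_distr)
  next
    case (scal_add_right s i t a)
    then show ?case using cl[of s i] cl[of t i] by (simp add: Q.vs_r_distr)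
  next
    case (scal_mult s i a b)
    then show ?case using cl[of s i] by (simp add: Q.vs_smult_assoc)
  next
    case (scal_one s i)
    then show ?case using cl[of s i] by (simp add: Q.vs_one)
  next
    case (brk_add_left s i s' t j)
    then show ?case using cl[of s i] cl[of s' i] cl[of t j] by (simp add: Q.brk_add_left)
  next
    case (brk_add_right s i t j t')
    then show ?case using cl[of s i] cl[of t j] cl[of t' j] by (simp add: Q.brk_add_right)
  next
    case (brk_smult_left s i t j c)
    then show ?case using cl[of s i] cl[of t j] by (simp add: Q.brk_smult_left)
  next
    case (brk_smult_right s i t j c)
    then show ?case using cl[of s i] cl[of t j] by (simp add: Q.brk_smult_right)
  next
    case (bdry_add s i t)
    then show ?case using cl[of s i] cl[of t i] by (simp add: Q.bdry_add)
  next
    case (bdry_smult s i c)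
    then show ?case using cl[of s i] by (simp add: Q.bdry_smult)
  next
    case (bdry_bdry s i)
    then show ?case using cl[of s i] by (simp add: Q.bdry_bdry)
  qed (use \<alpha> \<beta> in \<open>auto simp: dgla_hom_def\<close>)
qed

theorem free_product_universal:
  fixes Q :: "('k, 'c) dgla"
  assumes Q: "dgla Q" and \<alpha>: "dgla_hom G Q \<alpha>" and \<beta>: "dgla_hom H Q \<beta>"
  shows "\<exists>\<gamma>. dgla_hom (free_product G H) Q \<gamma> \<and>
      (\<forall>i. \<forall>x\<in>gr G i. \<gamma> i (incl_left i x) = \<alpha> i x) \<and>
      (\<forall>i. \<forall>y\<in>gr H i. \<gamma> i (incl_right i y) = \<beta> i y)"
    and "\<lbrakk>dgla_hom (free_product G H) Q \<gamma>; dgla_hom (free_product G H) Q \<gamma>';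
        \<And>i x. x \<in> gr G i \<Longrightarrow> \<gamma> i (incl_left i x) = \<gamma>' i (incl_left i x);
        \<And>i y. y \<in> gr H i \<Longrightarrow> \<gamma> i (incl_right i y) = \<gamma>' i (incl_right i y);
        z \<in> gr (free_product G H) i\<rbrakk> \<Longrightarrow> \<gamma> i z = \<gamma>' i z"
proof -
  define \<gamma> :: "int \<Rightarrow> ('k, 'a, 'b) fp_term set \<Rightarrow> 'c"
    where "\<gamma> = (\<lambda>i S. fp_eval Q \<alpha> \<beta> (SOME s. s \<in> S))"
  have ev: "\<gamma> i (fp_class G H s) = fp_eval Q \<alpha> \<beta> s" if "s \<in> fp_terms G H j" for i j s
  proof -
    have "(SOME u. u \<in> fp_class G H s) \<in> fp_class G H s"
      using fp_class_self[OF that] by (rule someI)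
    then have "fp_eq G H s (SOME u. u \<in> fp_class G H s)" by (simp add: fp_class_def)
    from fp_eval_cong[OF assms this] show ?thesis by (simp add: \<gamma>_def)
  qed
  have deg: "s \<in> fp_terms G H i \<Longrightarrow> fp_deg s = i" for s i by (simp add: fp_terms_def)
  have cl: "s \<in> fp_terms G H i \<Longrightarrow> fp_eval Q \<alpha> \<beta> s \<in> gr Q i" for s i
    using fp_eval_closed[OF assms] by (auto simp: fp_terms_def)
  have "dgla_hom (free_product G H) Q \<gamma>"
    unfolding dgla_hom_def
    by (auto simp: fp_ops cl ev[OF terms_intros(4)] ev[OF terms_intros(5)] ev[OF terms_intros(6)]
        ev[OF terms_intros(7)] ev deg)
  moreover have "\<forall>i. \<forall>x\<in>gr G i. \<gamma> i (incl_left i x) = \<alpha> i x"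
    "\<forall>i. \<forall>y\<in>gr H i. \<gamma> i (incl_right i y) = \<beta> i y"
    by (auto simp: incl_left_def incl_right_def ev[OF terms_intros(1)] ev[OF terms_intros(2)])
  ultimately show "\<exists>\<gamma>. dgla_hom (free_product G H) Q \<gamma> \<and>
      (\<forall>i. \<forall>x\<in>gr G i. \<gamma> i (incl_left i x) = \<alpha> i x) \<and>
      (\<forall>i. \<forall>y\<in>gr H i. \<gamma> i (incl_right i y) = \<beta> i y)" by blast
next
  interpret Q: dgla Q by fact
  assume h: "dgla_hom (free_product G H) Q \<gamma>" and h': "dgla_hom (free_product G H) Q \<gamma>'"
    and l: "\<And>i x. x \<in> gr G i \<Longrightarrow> \<gamma> i (incl_left i x) = \<gamma>' i (incl_left i x)"
    and r: "\<And>i y. y \<in> gr H i \<Longrightarrow> \<gamma> i (incl_right i y) = \<gamma>' i (incl_right i y)"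
    and z: "z \<in> gr (free_product G H) i"
  have zero: "\<delta> i (fp_class G H (Zero i)) = \<zero>\<^bsub>homog Q i\<^esub>"
    if "dgla_hom (free_product G H) Q \<delta>" for \<delta> i
  proof -
    interpret M: Module.module "ring_of_type_algebra :: 'k ring" "homog Q i" by (rule Q.vs)
    let ?z = "fp_class G H (Zero i)"
    have "?z = ?z \<oplus>\<^bsub>homog (free_product G H) i\<^esub> ?z"
      by (simp add: fp_ops terms_intros fp_class_eqI[OF fp_eq.add_zero])
    moreover have "?z \<in> gr (free_product G H) i" by (auto simp: fp_ops terms_intros)
    ultimately have "\<delta> i ?z = \<delta> i ?z \<oplus>\<^bsub>homog Q i\<^esub> \<delta> i ?z" "\<delta> i ?z \<in> gr Q i"
      using that unfolding dgla_hom_def by metis+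
    then show ?thesis by (metis M.add.r_cancel_one)
  qed
  have "fp_wf G H s \<Longrightarrow> \<gamma> (fp_deg s) (fp_class G H s) = \<gamma>' (fp_deg s) (fp_class G H s)" for s
  proof (induction s)
    case (InL i x)
    then show ?case using l by (simp add: incl_left_def)
  next
    case (InR i y)
    then show ?case using r by (simp add: incl_right_def)
  next
    case (Zero i)
    then show ?case by (simp add: zero[OF h] zero[OF h'])
  next
    case (Plus s t)
    then have st: "s \<in> fp_terms G H (fp_deg s)" "t \<in> fp_terms G H (fp_deg s)"
      by (auto simp: fp_terms_def)
    then have mem: "fp_class G H s \<in> gr (free_product G H) (fp_deg s)"
      "fp_class G H t \<in> gr (free_product G H) (fp_deg s)" by (auto simp: fp_ops)
    show ?case using h h' Plus mem unfolding dgla_hom_def fp_deg.simps fp_ops(3)[OF st, symmetric]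
      by auto
  next
    case (Scal c s)
    then have st: "s \<in> fp_terms G H (fp_deg s)" by (auto simp: fp_terms_def)
    then have mem: "fp_class G H s \<in> gr (free_product G H) (fp_deg s)" by (auto simp: fp_ops)
    show ?case using h h' Scal mem unfolding dgla_hom_def fp_deg.simps fp_ops(4)[OF st, symmetric]
      by auto
  next
    case (Brk s t)
    then have st: "s \<in> fp_terms G H (fp_deg s)" "t \<in> fp_terms G H (fp_deg t)"
      by (auto simp: fp_terms_def)
    then have mem: "fp_class G H s \<in> gr (free_product G H) (fp_deg s)"
      "fp_class G H t \<in> gr (free_product G H) (fp_deg t)" by (auto simp: fp_ops)
    show ?case using h h' Brk mem unfolding dgla_hom_def fp_deg.simps fp_ops(5)[OF st, symmetric]
      by auto
  next
    case (Bdry s)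
    then have st: "s \<in> fp_terms G H (fp_deg s)" by (auto simp: fp_terms_def)
    then have mem: "fp_class G H s \<in> gr (free_product G H) (fp_deg s)" by (auto simp: fp_ops)
    show ?case using h h' Bdry mem unfolding dgla_hom_def fp_deg.simps fp_ops(6)[OF st, symmetric]
      by auto
  qed
  then show "\<gamma> i z = \<gamma>' i z" using z by (auto simp: fp_ops fp_terms_def)
qed

end


section \<open>Complete non-unital commutative dg algebras\<close>

text \<open>
  Cohomologically graded; again given by homogeneous components, each with its (linearly compact)
  topology.
\<close>

record ('k, 'c) cdga =
  comp :: "int \<Rightarrow> ('k, 'c) module"
  amult :: "int \<Rightarrow> int \<Rightarrow> 'c \<Rightarrow> 'c \<Rightarrow> 'c"
  cobdry :: "int \<Rightarrow> 'c \<Rightarrow> 'c"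
  atop :: "int \<Rightarrow> 'c topology"

definition cdga_hom ::
    "('k, 'c) cdga \<Rightarrow> ('k, 'd) cdga \<Rightarrow> (int \<Rightarrow> 'c \<Rightarrow> 'd) \<Rightarrow> bool"
  where "cdga_hom A B \<phi> \<longleftrightarrow>
    (\<forall>m. \<forall>x\<in>carrier (comp A m). \<phi> m x \<in> carrier (comp B m)) \<and>
    (\<forall>m. \<forall>x\<in>carrier (comp A m). \<forall>y\<in>carrier (comp A m).
      \<phi> m (x \<oplus>\<^bsub>comp A m\<^esub> y) = \<phi> m x \<oplus>\<^bsub>comp B m\<^esub> \<phi> m y) \<and>
    (\<forall>m c. \<forall>x\<in>carrier (comp A m). \<phi> m (c \<odot>\<^bsub>comp A m\<^esub> x) = c \<odot>\<^bsub>comp B m\<^esub> \<phi> m x) \<and>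
    (\<forall>m n. \<forall>x\<in>carrier (comp A m). \<forall>y\<in>carrier (comp A n).
      \<phi> (m + n) (amult A m n x y) = amult B m n (\<phi> m x) (\<phi> n y)) \<and>
    (\<forall>m. \<forall>x\<in>carrier (comp A m). \<phi> (m + 1) (cobdry A m x) = cobdry B m (\<phi> m x)) \<and>
    (\<forall>m. continuous_map (atop A m) (atop B m) (\<phi> m))"

definition cocycles :: "('k, 'c) cdga \<Rightarrow> int \<Rightarrow> 'c set"
  where "cocycles A m = {x \<in> carrier (comp A m). cobdry A m x = \<zero>\<^bsub>comp A (m + 1)\<^esub>}"

definition coboundaries :: "('k, 'c) cdga \<Rightarrow> int \<Rightarrow> 'c set"
  where "coboundaries A m = cobdry A (m - 1) ` carrier (comp A (m - 1))"

definition cohomology :: "('k, 'c) cdga \<Rightarrow> int \<Rightarrow> 'c set monoid"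
  where "cohomology A m =
    (add_monoid (comp A m)\<lparr>carrier := cocycles A m\<rparr>) Mod (coboundaries A m)"

definition cohomology_map ::
    "('k, 'd) cdga \<Rightarrow> (int \<Rightarrow> 'c \<Rightarrow> 'd) \<Rightarrow> int \<Rightarrow> 'c set \<Rightarrow> 'd set"
  where "cohomology_map B \<phi> m C = coboundaries B m <#>\<^bsub>add_monoid (comp B m)\<^esub> (\<phi> m ` C)"

definition quasi_isomorphism ::
    "('k, 'c) cdga \<Rightarrow> ('k, 'd) cdga \<Rightarrow> (int \<Rightarrow> 'c \<Rightarrow> 'd) \<Rightarrow> bool"
  where "quasi_isomorphism A B \<phi> \<longleftrightarrow>
    cdga_hom A B \<phi> \<and> (\<forall>m. cohomology_map B \<phi> m \<in> iso (cohomology A m) (cohomology B m))"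

definition cdga_product :: "('k, 'c) cdga \<Rightarrow> ('k, 'd) cdga \<Rightarrow> ('k, 'c \<times> 'd) cdga"
  where "cdga_product A B = \<lparr>
    comp = (\<lambda>m. \<lparr>
      carrier = carrier (comp A m) \<times> carrier (comp B m),
      monoid.mult = undefined,
      monoid.one = undefined,
      ring.zero = (\<zero>\<^bsub>comp A m\<^esub>, \<zero>\<^bsub>comp B m\<^esub>),
      ring.add = (\<lambda>(a, b) (a', b'). (a \<oplus>\<^bsub>comp A m\<^esub> a', b \<oplus>\<^bsub>comp B m\<^esub> b')),
      module.smult = (\<lambda>c (a, b). (c \<odot>\<^bsub>comp A m\<^esub> a, c \<odot>\<^bsub>comp B m\<^esub> b))\<rparr>),
    amult = (\<lambda>m n (a, b) (a', b'). (amult A m n a a', amult B m n b b')),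
    cobdry = (\<lambda>m (a, b). (cobdry A m a, cobdry B m b)),
    atop = (\<lambda>m. prod_topology (atop A m) (atop B m))\<rparr>"


section \<open>The reduced Chevalley--Eilenberg algebra\<close>

text \<open>
  Let \<open>W = \<Sigma>L\<close>, so that \<open>W\<^sub>i = L\<^bsub>i-1\<^esub>\<close> and \<open>(\<Sigma>L\<^sup>*)\<^sup>i = (W\<^sub>i)\<^sup>*\<close>.  A homogeneous element \<open>x \<in> L\<^sub>i\<close>,
  viewed in \<open>W\<close>, is encoded as the pair \<open>(i, x)\<close>; its degree in \<open>W\<close> is \<open>i + 1\<close>.  As
  \<open>V\<^sup>* \<otimes> U\<^sup>* = (V \<otimes> U)\<^sup>*\<close> for the completed tensor product, the \<open>n\<close>-th completed tensor power of
  \<open>\<Sigma>L\<^sup>*\<close> is the graded dual of the \<open>n\<close>-th tensor power of \<open>W\<close>, i.e. it consists of multilinear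
  functions on words \<open>(x\<^sub>1, \<dots>, x\<^sub>n)\<close> in \<open>W\<close>; in characteristic zero its \<open>n\<close>-th completed symmetric
  power consists of the graded symmetric ones.  A function on the nonempty words of all lengths is
  the same as an element of the product over \<open>n \<ge> 1\<close>.  Cochains of degree \<open>m\<close> live on words of
  total degree \<open>m\<close> and are extended by \<open>0\<close> to all other lists.
\<close>

abbreviation sdeg :: "int \<times> 'a \<Rightarrow> int"
  where "sdeg p \<equiv> fst p + 1"

definition is_word :: "('k, 'a) dgla \<Rightarrow> (int \<times> 'a) list \<Rightarrow> bool"
  where "is_word L w \<longleftrightarrow> (\<forall>p\<in>set w. snd p \<in> gr L (fst p))"

definition cochains :: "('k::field_char_0, 'a) dgla \<Rightarrow> int \<Rightarrow> ((int \<times> 'a) list \<Rightarrow> 'k) set"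
  where "cochains L m = {f.
    (\<forall>w. f w \<noteq> 0 \<longrightarrow> w \<noteq> [] \<and> is_word L w \<and> (\<Sum>p\<leftarrow>w. sdeg p) = m) \<and>
    (\<forall>u v i. \<forall>x\<in>gr L i. \<forall>y\<in>gr L i.
      f (u @ (i, x \<oplus>\<^bsub>homog L i\<^esub> y) # v) = f (u @ (i, x) # v) + f (u @ (i, y) # v)) \<and>
    (\<forall>u v i c. \<forall>x\<in>gr L i. f (u @ (i, c \<odot>\<^bsub>homog L i\<^esub> x) # v) = c * f (u @ (i, x) # v)) \<and>
    (\<forall>u v p q. f (u @ p # q # v) = (-1) powi (sdeg p * sdeg q) * f (u @ q # p # v))}"

text \<open>
  The Koszul sign \<open>\<epsilon>\<close> with \<open>w = \<epsilon> w\<^sub>A w\<^sub>B\<close> in the symmetric algebra of \<open>W\<close>, where \<open>w\<^sub>A\<close> and \<open>w\<^sub>B\<close> are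
  the subwords on the positions in \<open>A\<close> and not in \<open>A\<close>.
\<close>

definition koszul_sign :: "nat set \<Rightarrow> (int \<times> 'a) list \<Rightarrow> 'k::field_char_0"
  where "koszul_sign A w =
    (-1) powi (\<Sum>(p, q)\<in>{(p, q). p < q \<and> q < length w \<and> p \<notin> A \<and> q \<in> A}. sdeg (w ! p) * sdeg (w ! q))"

text \<open>
  The product of the symmetric algebra of \<open>\<Sigma>L\<^sup>*\<close>, on symmetric functions: it is dual to the
  unshuffle coproduct on the symmetric algebra of \<open>W\<close>.
\<close>

definition ce_mult ::
    "((int \<times> 'a) list \<Rightarrow> 'k::field_char_0) \<Rightarrow> ((int \<times> 'a) list \<Rightarrow> 'k) \<Rightarrow> (int \<times> 'a) list \<Rightarrow> 'k"
  where "ce_mult f g w =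
    (\<Sum>A\<in>Pow {..<length w}. koszul_sign A w * f (nths w A) * g (nths w (- A)))"

text \<open>
  The differential \<open>d = d\<^sub>I + d\<^sub>I\<^sub>I\<close> is precomposition with the coderivation of the symmetric coalgebra
  of \<open>W\<close> with components \<open>sx \<mapsto> - s(dx)\<close> and \<open>sx sy \<mapsto> (-1)\<^bsup>|sx|\<^esup> s[x, y]\<close>; hence it is the
  continuous derivation determined by \<open>(d\<^sub>I f)(sx) = - f(s(dx))\<close> and
  \<open>(d\<^sub>I\<^sub>I f)(sx, sy) = (-1)\<^bsup>|sx|\<^esup> f(s[x, y])\<close> for linear \<open>f\<close>.
\<close>

definition ce_dI ::
    "('k::field_char_0, 'a) dgla \<Rightarrow> ((int \<times> 'a) list \<Rightarrow> 'k) \<Rightarrow> (int \<times> 'a) list \<Rightarrow> 'k"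
  where "ce_dI L f w =
    (if is_word L w then
      (\<Sum>r<length w. - ((-1) powi (\<Sum>q<r. sdeg (w ! q))) *
        f (w[r := (fst (w ! r) - 1, bdry L (fst (w ! r)) (snd (w ! r)))]))
     else 0)"

definition ce_dII ::
    "('k::field_char_0, 'a) dgla \<Rightarrow> ((int \<times> 'a) list \<Rightarrow> 'k) \<Rightarrow> (int \<times> 'a) list \<Rightarrow> 'k"
  where "ce_dII L f w =
    (if is_word L w then
      (\<Sum>(p, q)\<in>{(p, q). p < q \<and> q < length w}.
        (-1) powi (sdeg (w ! p)) * koszul_sign {p, q} w *
        f ((fst (w ! p) + fst (w ! q), brk L (fst (w ! p)) (fst (w ! q)) (snd (w ! p)) (snd (w ! q)))
           # nths w (- {p, q})))
     else 0)"

text \<open>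
  The topology on each component is that of the dual of a discrete space: pointwise convergence,
  with discrete field.
\<close>

definition chevalley_eilenberg ::
    "('k::field_char_0, 'a) dgla \<Rightarrow> ('k, (int \<times> 'a) list \<Rightarrow> 'k) cdga"
  where "chevalley_eilenberg L = \<lparr>
    comp = (\<lambda>m. \<lparr>
      carrier = cochains L m,
      monoid.mult = undefined,
      monoid.one = undefined,
      ring.zero = (\<lambda>w. 0),
      ring.add = (\<lambda>f g w. f w + g w),
      module.smult = (\<lambda>c f w. c * f w)\<rparr>),
    amult = (\<lambda>m n. ce_mult),
    cobdry = (\<lambda>m f w. ce_dI L f w + ce_dII L f w),
    atop = (\<lambda>m. subtopology (product_topology (\<lambda>w. discrete_topology UNIV) UNIV) (cochains L m))\<rparr>"

end

theory Submission
  imports Defs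
begin

text \<open>
  Let \<open>C L = L \<oplus> \<epsilon>L\<close> be the cone of a dgla \<open>L\<close>, with \<open>d (\<epsilon>x) = - x - \<epsilon> dx\<close> and \<open>[\<epsilon>x, \<epsilon>y] = 0\<close>, and let
  \<open>\<Omega>\<close> be the complex of functionals on the enveloping algebra of \<open>C L\<close>.  By the PBW theorem the
  restriction to words in \<open>\<epsilon>L\<close> identifies the functionals killed by right multiplication with \<open>L\<close>
  with the cochains of \<open>L\<close>.  For \<open>L = G * H\<close> call \<open>\<Omega>\<^sub>G\<close>, \<open>\<Omega>\<^sub>H\<close> and \<open>\<Omega>\<^sub>G \<inter> \<Omega>\<^sub>H = \<Omega>\<^sub>L\<close> the functionals killed
  by right multiplication with \<open>G\<close>, with \<open>H\<close> and with \<open>L\<close>.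

  Symmetrization makes \<open>\<Omega>\<close> contractible modulo constants.  Convolving that contraction with the
  pullback along the retraction \<open>r\<close> of \<open>L\<close> onto \<open>G\<close> gives a homotopy on \<open>\<Omega>\<^sub>G\<close> between the identity
  and \<open>r\<^sup>*\<close>, so that a cocycle in \<open>\<Omega>\<^sub>G\<close> which vanishes on \<open>G\<close> is the differential of some
  \<open>\<eta>\<^sub>1 \<in> \<Omega>\<^sub>G\<close>; likewise \<open>\<eta>\<^sub>2 \<in> \<Omega>\<^sub>H\<close>.  Derivations out of a free product are determined freely by
  their restrictions to the factors, whence \<open>\<Omega> = \<Omega>\<^sub>G + \<Omega>\<^sub>H\<close>.  Splitting a primitive of \<open>\<eta>\<^sub>1 - \<eta>\<^sub>2\<close>
  accordingly, one corrects \<open>\<eta>\<^sub>1\<close> and \<open>\<eta>\<^sub>2\<close> to a common primitive in \<open>\<Omega>\<^sub>L\<close>.  So the restriction of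
  cochains to \<open>G\<close> and \<open>H\<close> is injective on cohomology, and it is surjective because of the two
  retractions.
\<close>

section \<open>Words in graded letters\<close>

text \<open>The cone is contractible, so its enveloping algebra resolves the ground field, and it is
  free over U(L) as a graded module; this is why L-invariant functionals on it are the cochains.
  \<open>\<Omega>\<^sub>G\<close> and \<open>\<Omega>\<^sub>H\<close> live on the same words as
  \<Omega>, so primitives relative to G and to H can be subtracted: the argument is the
  Mayer-Vietoris sequence of \<open>\<Omega>\<^sub>L\<close>, \<open>\<Omega>\<^sub>G\<close>,
  \<open>\<Omega>\<^sub>H\<close> and \<Omega>. The obstacle is that the free product is given by
  terms and relations, without a basis or a normal form. Hence no algebra is formed as a quotient: a
  functional is a function on words that respects the relations. PBW is proved in this dual form by
  extending functionals from shorter to longer words, dividing by the number of letters; here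
  characteristic zero enters. The splitting of \<Omega> rests on functionals on the augmentation
  ideal of U(L) being the derivations of L into the dual of U(L). Symmetrized contraction alone does
  not preserve invariance under G; convolving with the antipode after the retraction restores
  it.\<close>

definition sg :: "bool \<Rightarrow> 'k::comm_ring_1"
  where "sg b = (if b then - 1 else 1)"

lemma sg_simps [simp]: "sg True = - 1" "sg False = 1"
  by (simp_all add: sg_def)

lemma sg_sq: "sg b * sg b = 1" "sg b * (sg b * x) = x"
  by (auto simp: sg_def)

lemma sg_not [simp]: "sg (\<not> b) = - sg b"
  by (simp add: sg_def)

lemma sg_eq: "sg (a = b) = - (sg a * sg b)"
  by (simp add: sg_def)

lemma neq_assoc: "((a \<noteq> b) \<noteq> c) = (a \<noteq> (b \<noteq> (c :: bool)))"
  by auto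

text \<open>
  A graded vector space is encoded by its homogeneous elements (the letters) together with a set of
  relations: \<open>[(c\<^sub>1, l\<^sub>1), \<dots>, (c\<^sub>n, l\<^sub>n)]\<close> stands for \<open>c\<^sub>1 l\<^sub>1 + \<dots> + c\<^sub>n l\<^sub>n = 0\<close>.  Only parities enter the signs.
\<close>

locale graded_letters =
  fixes par :: "'l \<Rightarrow> bool"
    and Rel :: "('k::field_char_0 \<times> 'l) list set"
  assumes Rel_par: "r \<in> Rel \<Longrightarrow> \<exists>e. \<forall>p\<in>set r. par (snd p) = e"
begin

definition lin :: "('l \<Rightarrow> 'k) \<Rightarrow> bool"
  where "lin \<phi> \<longleftrightarrow> (\<forall>r\<in>Rel. (\<Sum>p\<leftarrow>r. fst p * \<phi> (snd p)) = 0)"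

lemma lin_0 [simp]: "lin (\<lambda>l. 0)"
  by (simp add: lin_def)

lemma lin_add: "lin \<phi> \<Longrightarrow> lin \<psi> \<Longrightarrow> lin (\<lambda>l. \<phi> l + \<psi> l)"
  by (simp add: lin_def distrib_left sum_list_addf)

lemma lin_mult: "lin \<phi> \<Longrightarrow> lin (\<lambda>l. k * \<phi> l)"
  by (simp add: lin_def sum_list_const_mult mult.left_commute)

lemma lin_minus: "lin \<phi> \<Longrightarrow> lin (\<lambda>l. - \<phi> l)"
  using lin_mult[of \<phi> "-1"] by simp

lemma lin_diff: "lin \<phi> \<Longrightarrow> lin \<psi> \<Longrightarrow> lin (\<lambda>l. \<phi> l - \<psi> l)"
  using lin_add[of \<phi> "\<lambda>l. - \<psi> l"] lin_minus[of \<psi>] by simp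

text \<open>A relation has letters of one parity only, so a weight depending on the parity is
  constant along it. This lets Koszul signs pass through linearity arguments.\<close>

lemma lin_par:
  assumes "lin \<phi>"
  shows "lin (\<lambda>l. g (par l) * \<phi> l)"
  unfolding lin_def
proof
  fix r assume r: "r \<in> Rel"
  then obtain e where e: "\<And>p. p \<in> set r \<Longrightarrow> par (snd p) = e"
    using Rel_par[OF r] by auto
  have "(\<Sum>p\<leftarrow>r. fst p * (g (par (snd p)) * \<phi> (snd p))) = (\<Sum>p\<leftarrow>r. g e * (fst p * \<phi> (snd p)))"
    using e by (intro arg_cong[where f = sum_list] map_cong) (auto simp: mult.left_commute)
  also have "\<dots> = g e * (\<Sum>p\<leftarrow>r. fst p * \<phi> (snd p))"
    by (simp add: sum_list_const_mult)
  finally show "(\<Sum>p\<leftarrow>r. fst p * (g (par (snd p)) * \<phi> (snd p))) = 0"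
    using assms r by (simp add: lin_def)
qed

abbreviation s :: "'l \<Rightarrow> 'l \<Rightarrow> 'k" where "s a b \<equiv> sg (par a \<and> par b)"

lemma lin_s: "lin \<phi> \<Longrightarrow> lin (\<lambda>l. s l a * \<phi> l)" "lin \<phi> \<Longrightarrow> lin (\<lambda>l. s a l * \<phi> l)"
  using lin_par[of \<phi> "\<lambda>b. sg (b \<and> par a)"] lin_par[of \<phi> "\<lambda>b. sg (par a \<and> b)"] by auto

definition mlin :: "('l list \<Rightarrow> 'k) \<Rightarrow> bool"
  where "mlin F \<longleftrightarrow> (\<forall>u v. lin (\<lambda>l. F (u @ l # v)))"

lemma mlinD: "mlin F \<Longrightarrow> lin (\<lambda>l. F (u @ l # v))"
  unfolding mlin_def by blast

lemma mlinD_Cons: "mlin F \<Longrightarrow> lin (\<lambda>l. F (l # v))"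
  using mlinD[of F "[]" v] by simp

lemma mlin_append: "mlin F \<Longrightarrow> mlin (\<lambda>w. F (u @ w @ v))"
  unfolding mlin_def
proof (intro allI)
  fix u' v'
  assume "\<forall>u v. lin (\<lambda>l. F (u @ l # v))"
  then have "lin (\<lambda>l. F ((u @ u') @ l # (v' @ v)))" by blast
  then show "lin (\<lambda>l. F (u @ (u' @ l # v') @ v))" by simp
qed

lemma mlin_Cons: "mlin F \<Longrightarrow> mlin (\<lambda>w. F (l # w))"
  using mlin_append[of F "[l]" "[]"] by simp

lemma mlin_linear:
  shows mlin_0: "mlin (\<lambda>w. 0)"
    and mlin_add: "mlin F \<Longrightarrow> mlin G \<Longrightarrow> mlin (\<lambda>w. F w + G w)"
    and mlin_mult: "mlin F \<Longrightarrow> mlin (\<lambda>w. k * F w)"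
    and mlin_diff: "mlin F \<Longrightarrow> mlin G \<Longrightarrow> mlin (\<lambda>w. F w - G w)"
  unfolding mlin_def by (simp_all add: lin_add lin_mult lin_minus lin_diff)

lemma mlin_cong_length:
  assumes "\<And>n. mlin (F n)"
  shows "mlin (\<lambda>w. F (length w) w)"
  using assms unfolding mlin_def by simp

primrec wpar :: "'l list \<Rightarrow> bool" where
  "wpar [] = False"
| "wpar (l # w) = (par l \<noteq> wpar w)"

lemma wpar_append [simp]: "wpar (u @ v) = (wpar u \<noteq> wpar v)"
  by (induction u) auto

text \<open>
  Precomposition with the derivation of parity \<open>e\<close> of the tensor algebra that extends \<open>\<delta>\<close>.
\<close>

primrec hat :: "bool \<Rightarrow> ('l \<Rightarrow> 'l) \<Rightarrow> ('l list \<Rightarrow> 'k) \<Rightarrow> 'l list \<Rightarrow> 'k" where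
  "hat e \<delta> F [] = 0"
| "hat e \<delta> F (l # w) = F (\<delta> l # w) + sg (e \<and> par l) * hat e \<delta> (\<lambda>v. F (l # v)) w"

lemma hat_linear:
  "hat e \<delta> (\<lambda>w. 0) w = 0"
  "hat e \<delta> (\<lambda>w. F w + G w) w = hat e \<delta> F w + hat e \<delta> G w"
  "hat e \<delta> (\<lambda>w. k * F w) w = k * hat e \<delta> F w"
  "hat e \<delta> (\<lambda>w. - F w) w = - hat e \<delta> F w"
  "hat e \<delta> (\<lambda>w. F w - G w) w = hat e \<delta> F w - hat e \<delta> G w"
  by (induction w arbitrary: F G) (simp_all add: distrib_left right_diff_distrib mult.left_commute)

lemma hat_append:
  "hat e \<delta> F (u @ v) =
    hat e \<delta> (\<lambda>u. F (u @ v)) u + sg (e \<and> wpar u) * hat e \<delta> (\<lambda>v. F (u @ v)) v"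
  by (induction u arbitrary: F) (auto simp: sg_def)

lemma lin_hat:
  assumes "\<And>w. lin (\<lambda>l. F l w)"
  shows "lin (\<lambda>l. hat e \<delta> (F l) w)"
  using assms by (induction w arbitrary: F) (auto simp: lin_add lin_mult)

lemma hat_mlin:
  assumes "mlin F" and \<delta>: "\<And>\<phi>. lin \<phi> \<Longrightarrow> lin (\<lambda>l. \<phi> (\<delta> l))"
  shows "mlin (hat e \<delta> F)"
  unfolding mlin_def
proof (intro allI)
  fix u v
  show "lin (\<lambda>l. hat e \<delta> F (u @ l # v))"
    using assms(1)
  proof (induction u arbitrary: F)
    case Nil
    then show ?case
      using lin_par[OF lin_hat[of "\<lambda>l w. F (l # w)"], of "\<lambda>b. sg (e \<and> b)"]
      by (auto intro!: lin_add \<delta> mlinD_Cons)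
  next
    case (Cons a u)
    then show ?case
      using Cons.IH[OF mlin_Cons[OF Cons.prems]] mlinD[of F "\<delta> a # u" v] by (auto intro!: lin_add lin_mult)
  qed
qed

lemma hat_cong:
  "(\<And>v. length v = length w \<Longrightarrow> F v = G v) \<Longrightarrow> hat e \<delta> F w = hat e \<delta> G w"
proof (induction w arbitrary: F G)
  case (Cons l w)
  have "hat e \<delta> (\<lambda>v. F (l # v)) w = hat e \<delta> (\<lambda>v. G (l # v)) w"
    by (rule Cons.IH) (simp add: Cons.prems)
  then show ?case by (simp add: Cons.prems)
qed simp

text \<open>Terms in which the two derivations act on different letters cancel, and precomposition
  reverses the order on a single letter. The scalar is 0 for squares and anticommuting pairs, 1 with
  a bracket for adjoint actions, and it multiplies the identity for contractions.\<close>

lemma hat_commutator: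
  assumes "\<And>l. par (\<delta>\<^sub>1 l) = (par l \<noteq> e\<^sub>1)" and "\<And>l. par (\<delta>\<^sub>2 l) = (par l \<noteq> e\<^sub>2)"
    and \<delta>: "\<And>\<phi> l. lin \<phi> \<Longrightarrow>
      \<phi> (\<delta>\<^sub>2 (\<delta>\<^sub>1 l)) - sg (e\<^sub>1 \<and> e\<^sub>2) * \<phi> (\<delta>\<^sub>1 (\<delta>\<^sub>2 l)) = k * \<phi> (\<delta>\<^sub>3 l)"
    and "mlin F"
  shows "hat e\<^sub>1 \<delta>\<^sub>1 (hat e\<^sub>2 \<delta>\<^sub>2 F) w - sg (e\<^sub>1 \<and> e\<^sub>2) * hat e\<^sub>2 \<delta>\<^sub>2 (hat e\<^sub>1 \<delta>\<^sub>1 F) w =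
    k * hat (e\<^sub>1 \<noteq> e\<^sub>2) \<delta>\<^sub>3 F w"
  using assms(4)
proof (induction w arbitrary: F)
  case (Cons l w)
  have 1: "F (\<delta>\<^sub>2 (\<delta>\<^sub>1 l) # w) - sg (e\<^sub>1 \<and> e\<^sub>2) * F (\<delta>\<^sub>1 (\<delta>\<^sub>2 l) # w) = k * F (\<delta>\<^sub>3 l # w)"
    by (rule \<delta>[OF mlinD_Cons[OF Cons.prems]])
  show ?case
    using 1 Cons.IH[OF mlin_Cons[OF Cons.prems, of l]]
    by (cases e\<^sub>1; cases e\<^sub>2; cases "par l") (simp_all add: assms(1,2) hat_linear algebra_simps)
qed simp

text \<open>This is the Euler derivation; the length that it produces is cancelled by the division
  in \<open>contr\<close>.\<close>

lemma hat_id: "hat False (\<lambda>l. l) F w = of_nat (length w) * F w"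
  by (induction w arbitrary: F) (simp_all add: algebra_simps)

section \<open>Graded symmetric functionals and symmetrization\<close>

definition gsym :: "('l list \<Rightarrow> 'k) \<Rightarrow> bool"
  where "gsym F \<longleftrightarrow> (\<forall>u a b v. F (u @ a # b # v) = s a b * F (u @ b # a # v))"

lemma symD_append: "gsym F \<Longrightarrow> F (u @ a # b # v) = s a b * F (u @ b # a # v)"
  unfolding gsym_def by blast

lemma symD: "gsym F \<Longrightarrow> F (a # b # v) = s a b * F (b # a # v)"
  using symD_append[of F "[]" a b v] by simp

lemma symI: "(\<And>u a b v. F (u @ a # b # v) = s a b * F (u @ b # a # v)) \<Longrightarrow> gsym F"
  unfolding gsym_def by blast

lemma sym_append:
  assumes "gsym F"
  shows "gsym (\<lambda>w. F (u @ w))"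
proof (rule symI)
  fix u' a b v
  show "F (u @ u' @ a # b # v) = s a b * F (u @ u' @ b # a # v)"
    using symD_append[OF assms, of "u @ u'" a b v] by simp
qed

lemma sym_Cons: "gsym F \<Longrightarrow> gsym (\<lambda>w. F (l # w))"
  using sym_append[of F "[l]"] by simp

lemma sym_add:
  assumes "gsym F" "gsym G"
  shows "gsym (\<lambda>w. F w + G w)"
proof (rule symI)
  fix u a b v
  show "F (u @ a # b # v) + G (u @ a # b # v) = s a b * (F (u @ b # a # v) + G (u @ b # a # v))"
    using symD_append[OF assms(1), of u a b v] symD_append[OF assms(2), of u a b v]
    by (simp add: distrib_left)
qed

lemma sym_mult:
  assumes "gsym F"
  shows "gsym (\<lambda>w. k * F w)"
proof (rule symI)
  fix u a b v
  show "k * F (u @ a # b # v) = s a b * (k * F (u @ b # a # v))"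
    using symD_append[OF assms, of u a b v] by simp
qed

lemma hat_sym:
  assumes "gsym F" and par: "\<And>l. par (\<delta> l) = (par l \<noteq> e)"
  shows "gsym (hat e \<delta> F)"
  unfolding gsym_def
proof (intro allI)
  fix u a b v
  show "hat e \<delta> F (u @ a # b # v) = s a b * hat e \<delta> F (u @ b # a # v)"
    using assms(1)
  proof (induction u arbitrary: F)
    case Nil
    have "F (a # b # w) = s a b * F (b # a # w)" for w by (rule symD[OF Nil])
    then have "(\<lambda>v. F (a # b # v)) = (\<lambda>v. s a b * F (b # a # v))" by (rule ext)
    then show ?case
      using symD[OF Nil, of "\<delta> a" b v] symD[OF Nil, of a "\<delta> b" v]
      by (cases e; cases "par a"; cases "par b") (simp_all add: par hat_linear algebra_simps)
  next
    case (Cons l u)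
    have "F (\<delta> l # u @ a # b # v) = s a b * F (\<delta> l # u @ b # a # v)"
      using Cons.prems unfolding gsym_def by (metis append_Cons)
    then show ?case using Cons.IH[OF sym_Cons[OF Cons.prems, of l]]
      by (simp add: algebra_simps)
  qed
qed

text \<open>
  The sum of \<open>\<plusminus> \<Phi> x v\<close> over the ways of moving one letter \<open>x\<close> of \<open>w\<close> to the front, leaving \<open>v\<close>.
  Iterating it averages over all permutations of \<open>w\<close>.
\<close>

primrec pull :: "('l \<Rightarrow> 'l list \<Rightarrow> 'k) \<Rightarrow> 'l list \<Rightarrow> 'k" where
  "pull \<Phi> [] = 0"
| "pull \<Phi> (l # w) = \<Phi> l w + pull (\<lambda>x v. s x l * \<Phi> x (l # v)) w"

lemma pull_linear:
  "pull (\<lambda>x v. 0) w = 0"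
  "pull (\<lambda>x v. \<Phi> x v + \<Psi> x v) w = pull \<Phi> w + pull \<Psi> w"
  "pull (\<lambda>x v. k * \<Phi> x v) w = k * pull \<Phi> w"
  "pull (\<lambda>x v. - \<Phi> x v) w = - pull \<Phi> w"
  "pull (\<lambda>x v. \<Phi> x v - \<Psi> x v) w = pull \<Phi> w - pull \<Psi> w"
  by (induction w arbitrary: \<Phi> \<Psi>) (simp_all add: distrib_left right_diff_distrib mult.left_commute)

lemma pull_cong:
  "(\<And>x v. Suc (length v) = length w \<Longrightarrow> \<Phi> x v = \<Psi> x v) \<Longrightarrow> pull \<Phi> w = pull \<Psi> w"
proof (induction w arbitrary: \<Phi> \<Psi>)
  case (Cons l w)
  show ?case using Cons.prems by (auto intro!: Cons.IH)
qed simp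

lemma lin_pull: "(\<And>x v. lin (\<lambda>l. \<Phi> l x v)) \<Longrightarrow> lin (\<lambda>l. pull (\<Phi> l) w)"
  by (induction w arbitrary: \<Phi>) (simp_all add: lin_add lin_mult)

lemma pull_mlin:
  assumes "\<And>v. lin (\<lambda>x. \<Phi> x v)" and "\<And>x. mlin (\<Phi> x)"
  shows "mlin (pull \<Phi>)"
  unfolding mlin_def
proof (intro allI)
  fix u v
  show "lin (\<lambda>l. pull \<Phi> (u @ l # v))"
    using assms
  proof (induction u arbitrary: \<Phi>)
    case Nil
    then show ?case by (auto intro!: lin_add lin_pull lin_s mlinD_Cons)
  next
    case (Cons a u)
    then show ?case by (auto intro!: lin_add lin_s Cons.IH mlin_mult mlin_Cons dest: mlinD)
  qed
qed

lemma pull_sym: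
  assumes "\<And>x. gsym (\<Phi> x)"
  shows "gsym (pull \<Phi>)"
  unfolding gsym_def
proof (intro allI)
  fix u a b v
  show "pull \<Phi> (u @ a # b # v) = s a b * pull \<Phi> (u @ b # a # v)"
    using assms
  proof (induction u arbitrary: \<Phi>)
    case Nil
    have "\<Phi> x (a # b # v) = s a b * \<Phi> x (b # a # v)" for x v by (rule symD[OF Nil])
    then show ?case
      by (cases "par a"; cases "par b") (simp_all add: pull_linear sg_sq mult.left_commute)
  next
    case (Cons l u)
    have "\<Phi> l (u @ a # b # v) = s a b * \<Phi> l (u @ b # a # v)"
      using Cons.prems unfolding gsym_def by blast
    moreover have "pull (\<lambda>x v. s x l * \<Phi> x (l # v)) (u @ a # b # v) =
        s a b * pull (\<lambda>x v. s x l * \<Phi> x (l # v)) (u @ b # a # v)"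
      by (rule Cons.IH) (intro sym_mult sym_Cons Cons.prems)
    ultimately show ?case by (simp add: distrib_left)
  qed
qed

text \<open>Moving a letter to the front with its sign does not change a graded symmetric value, and
  there are as many choices as letters.\<close>

lemma pull_self: "gsym c \<Longrightarrow> pull (\<lambda>x v. c (x # v)) w = of_nat (length w) * c w"
proof (induction w arbitrary: c)
  case (Cons l w)
  have "s x l * c (x # l # v) = c (l # x # v)" for x v
    using symD[OF Cons.prems, of x l v] by (simp add: sg_sq)
  then show ?case using Cons.IH[OF sym_Cons[OF Cons.prems, of l]] by (simp add: algebra_simps)
qed simp

text \<open>The derivation hits either the extracted letter or one left behind; the parity change of
  the letter hit is absorbed by the Koszul sign of the extraction.\<close>

lemma hat_pull:
  assumes par: "\<And>l. par (\<delta> l) = (par l \<noteq> e)"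
  shows "hat e \<delta> (pull \<Phi>) w =
    pull (\<lambda>x v. \<Phi> (\<delta> x) v + sg (e \<and> par x) * hat e \<delta> (\<Phi> x) v) w"
proof (induction w arbitrary: \<Phi>)
  case (Cons l w)
  have "sg (e \<and> par l) * (s (\<delta> x) l * \<Phi> (\<delta> x) (l # v) +
      sg (e \<and> par x) * hat e \<delta> (\<lambda>v. s x l * \<Phi> x (l # v)) v) + s x (\<delta> l) * \<Phi> x (\<delta> l # v) =
    s x l * (\<Phi> (\<delta> x) (l # v) + sg (e \<and> par x) * hat e \<delta> (\<Phi> x) (l # v))" for x v
    by (cases e; cases "par l"; cases "par x") (simp_all add: par hat_linear)
  then have "sg (e \<and> par l) * pull (\<lambda>x v. s (\<delta> x) l * \<Phi> (\<delta> x) (l # v) +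
      sg (e \<and> par x) * hat e \<delta> (\<lambda>v. s x l * \<Phi> x (l # v)) v) w +
      pull (\<lambda>x v. s x (\<delta> l) * \<Phi> x (\<delta> l # v)) w =
    pull (\<lambda>x v. s x l * (\<Phi> (\<delta> x) (l # v) + sg (e \<and> par x) * hat e \<delta> (\<Phi> x) (l # v))) w"
    unfolding pull_linear(2,3)[symmetric] by simp
  then show ?case using Cons.IH[of "\<lambda>x v. s x l * \<Phi> x (l # v)"]
    by (simp add: hat_linear algebra_simps)
qed simp

text \<open>The length is an argument of its own, so that the recursion is structural and each
  \<open>symmN n F\<close> is one function on all words, zero off length \<open>n\<close>. The
  successive factors multiply to 1 / n!.\<close>

primrec symmN :: "nat \<Rightarrow> ('l list \<Rightarrow> 'k) \<Rightarrow> 'l list \<Rightarrow> 'k" where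
  "symmN 0 F w = (if w = [] then F [] else 0)"
| "symmN (Suc n) F w = inverse (of_nat (Suc n)) * pull (\<lambda>x v. symmN n (\<lambda>u. F (x # u)) v) w"

definition symm :: "('l list \<Rightarrow> 'k) \<Rightarrow> 'l list \<Rightarrow> 'k"
  where "symm F w = symmN (length w) F w"

lemma symm_Nil [simp]: "symm F [] = F []"
  by (simp add: symm_def)

lemma symmN_cong:
  "(\<And>v. length v = n \<Longrightarrow> F v = G v) \<Longrightarrow> symmN n F w = symmN n G w"
proof (induction n arbitrary: F G w)
  case (Suc n)
  have "symmN n (\<lambda>u. F (x # u)) = symmN n (\<lambda>u. G (x # u))" for x
    using Suc.prems by (auto intro!: ext Suc.IH)
  then show ?case by simp
qed simp

lemma symmN_linear:
  "symmN n (\<lambda>w. 0) w = 0"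
  "symmN n (\<lambda>w. F w + G w) w = symmN n F w + symmN n G w"
  "symmN n (\<lambda>w. k * F w) w = k * symmN n F w"
  "symmN n (\<lambda>w. - F w) w = - symmN n F w"
  "symmN n (\<lambda>w. F w - G w) w = symmN n F w - symmN n G w"
  by (induction n arbitrary: F G w)
    (simp_all add: pull_linear distrib_left right_diff_distrib mult.left_commute del: of_nat_Suc)

lemma lin_symmN: "(\<And>w. lin (\<lambda>l. F l w)) \<Longrightarrow> lin (\<lambda>l. symmN n (F l) w)"
proof (induction n arbitrary: F w)
  case 0
  then show ?case by (cases "w = []") simp_all
next
  case (Suc n)
  then show ?case by (simp add: lin_pull lin_mult del: of_nat_Suc)
qed

lemma symmN_mlin: "mlin F \<Longrightarrow> mlin (symmN n F)"
proof (induction n arbitrary: F)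
  case 0
  then show ?case by (simp add: mlin_def)
next
  case (Suc n)
  then show ?case
    by (auto simp: mlin_Cons intro!: mlin_mult pull_mlin lin_symmN mlinD_Cons)
qed

lemma symmN_sym: "gsym (symmN n F)"
proof (induction n arbitrary: F)
  case 0
  show ?case by (simp add: gsym_def)
next
  case (Suc n)
  have "gsym (\<lambda>w. inverse (of_nat (Suc n)) * pull (\<lambda>x v. symmN n (\<lambda>u. F (x # u)) v) w)"
    by (intro sym_mult pull_sym Suc)
  then show ?case by simp
qed

lemma symm_linear:
  "symm (\<lambda>w. 0) w = 0"
  "symm (\<lambda>w. F w + G w) w = symm F w + symm G w"
  "symm (\<lambda>w. k * F w) w = k * symm F w"
  "symm (\<lambda>w. - F w) w = - symm F w"
  "symm (\<lambda>w. F w - G w) w = symm F w - symm G w"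
  by (simp_all add: symm_def symmN_linear)

lemma symm_mlin: "mlin F \<Longrightarrow> mlin (symm F)"
  using mlin_cong_length[of "\<lambda>n. symmN n F"] symmN_mlin by (simp add: symm_def[abs_def])

lemma symm_sym: "gsym (symm F)"
proof (rule symI)
  fix u a b v
  show "symm F (u @ a # b # v) = s a b * symm F (u @ b # a # v)"
    using symD_append[OF symmN_sym[of "length (u @ a # b # v)" F], of u a b v] by (simp add: symm_def)
qed

lemma symm_of_sym: "gsym c \<Longrightarrow> symm c w = c w"
proof -
  have "gsym c \<Longrightarrow> length w = n \<Longrightarrow> symmN n c w = c w" for n
  proof (induction n arbitrary: c w)
    case (Suc n)
    have "pull (\<lambda>x v. symmN n (\<lambda>u. c (x # u)) v) w = pull (\<lambda>x v. c (x # v)) w"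
    proof (rule pull_cong)
      fix x and v :: "'l list"
      assume "Suc (length v) = length w"
      then show "symmN n (\<lambda>u. c (x # u)) v = c (x # v)"
        using Suc.IH[OF sym_Cons[OF Suc.prems(1)], of v x] Suc.prems(2) by simp
    qed
    also have "\<dots> = of_nat (Suc n) * c w" using Suc by (simp only: pull_self)
    finally show ?case by (simp del: of_nat_Suc)
  qed simp
  then show "gsym c \<Longrightarrow> symm c w = c w" by (simp add: symm_def)
qed

lemma hat_symm:
  assumes par: "\<And>l. par (\<delta> l) = (par l \<noteq> e)"
  shows "hat e \<delta> (symm F) w = symm (hat e \<delta> F) w"
proof -
  have "length w = n \<Longrightarrow> hat e \<delta> (symmN n F) w = symmN n (hat e \<delta> F) w" for n
  proof (induction n arbitrary: F w)
    case (Suc n)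
    have "pull (\<lambda>x v. symmN n (\<lambda>u. F (\<delta> x # u)) v + sg (e \<and> par x) * hat e \<delta> (symmN n (\<lambda>u. F (x # u))) v) w
        = pull (\<lambda>x v. symmN n (\<lambda>u. hat e \<delta> F (x # u)) v) w"
      using Suc by (intro pull_cong) (simp add: symmN_linear)
    then show ?case by (simp add: hat_linear hat_pull[OF par])
  qed simp
  moreover have "hat e \<delta> (symm F) w = hat e \<delta> (symmN (length w) F) w"
    by (rule hat_cong) (simp add: symm_def)
  ultimately show ?thesis by (simp add: symm_def)
qed

end

section \<open>Functionals on the enveloping algebra\<close>

text \<open>Letters carry no addition, only relations, so the axioms are imposed after applying an
  arbitrary linear functional.\<close>

locale glie = graded_letters par Rel
  for par :: "'l \<Rightarrow> bool" and Rel :: "('k::field_char_0 \<times> 'l) list set" +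
  fixes br :: "'l \<Rightarrow> 'l \<Rightarrow> 'l"
  assumes par_br [simp]: "par (br a b) = (par a \<noteq> par b)"
    and lin_br_left: "lin \<phi> \<Longrightarrow> lin (\<lambda>a. \<phi> (br a b))"
    and lin_br_right: "lin \<phi> \<Longrightarrow> lin (\<lambda>b. \<phi> (br a b))"
    and br_antisym: "lin \<phi> \<Longrightarrow> \<phi> (br b a) = - s a b * \<phi> (br a b)"
    and br_jacobi: "lin \<phi> \<Longrightarrow> \<phi> (br (br a b) c) = \<phi> (br a (br b c)) - s a b * \<phi> (br b (br a c))"
begin

text \<open>
  Functionals on the enveloping algebra are multilinear functions \<open>F\<close> on words compatible with
  \<open>a b = \<plusminus> b a + [a, b]\<close>; \<open>rel n\<close> imposes this for words of length at most \<open>n\<close>.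
\<close>

definition rel :: "nat \<Rightarrow> ('l list \<Rightarrow> 'k) \<Rightarrow> bool"
  where "rel n F \<longleftrightarrow> (\<forall>u a b v. length u + length v + 2 \<le> n \<longrightarrow>
    F (u @ a # b # v) = s a b * F (u @ b # a # v) + F (u @ br a b # v))"

definition env :: "('l list \<Rightarrow> 'k) \<Rightarrow> bool"
  where "env F \<longleftrightarrow> mlin F \<and>
    (\<forall>u a b v. F (u @ a # b # v) = s a b * F (u @ b # a # v) + F (u @ br a b # v))"

lemma relD:
  "rel n F \<Longrightarrow> length u + length v + 2 \<le> n \<Longrightarrow>
    F (u @ a # b # v) = s a b * F (u @ b # a # v) + F (u @ br a b # v)"
  unfolding rel_def by blast

lemma relD_Cons:
  "rel n F \<Longrightarrow> length v + 2 \<le> n \<Longrightarrow>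
    F (a # b # v) = s a b * F (b # a # v) + F (br a b # v)"
  using relD[of n F "[]" v a b] by simp

lemma rel_Cons:
  assumes "rel (Suc n) F"
  shows "rel n (\<lambda>w. F (l # w))"
  unfolding rel_def
proof (intro allI impI)
  fix u v :: "'l list" and a b
  assume "length u + length v + 2 \<le> n"
  then show "F (l # u @ a # b # v) = s a b * F (l # u @ b # a # v) + F (l # u @ br a b # v)"
    using relD[OF assms, of "l # u" v a b] by simp
qed

text \<open>
  In the enveloping algebra a letter is moved to the front of a word at the cost of shorter words
  containing a bracket.  \<open>\<Psi> x v\<close> is the value on the word \<open>x # v\<close> of full length, and \<open>\<Phi>\<close> is used for
  the shorter ones.
\<close>

primrec pull_br :: "('l list \<Rightarrow> 'k) \<Rightarrow> ('l \<Rightarrow> 'l list \<Rightarrow> 'k) \<Rightarrow> 'l list \<Rightarrow> 'k" where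
  "pull_br \<Phi> \<Psi> [] = 0"
| "pull_br \<Phi> \<Psi> (l # w) = \<Psi> l w +
    pull_br (\<lambda>v. \<Phi> (l # v)) (\<lambda>x v. s x l * \<Psi> x (l # v) + \<Phi> (br l x # v)) w"

lemma pull_br_linear:
  "pull_br (\<lambda>v. \<Phi> v - k * \<Phi>' v) (\<lambda>x v. \<Psi> x v - k * \<Psi>' x v) w = pull_br \<Phi> \<Psi> w - k * pull_br \<Phi>' \<Psi>' w"
proof (induction w arbitrary: \<Phi> \<Psi> \<Phi>' \<Psi>')
  case (Cons l w)
  have "(\<lambda>x v. s x l * (\<Psi> x (l # v) - k * \<Psi>' x (l # v)) + (\<Phi> (br l x # v) - k * \<Phi>' (br l x # v))) =
     (\<lambda>x v. (s x l * \<Psi> x (l # v) + \<Phi> (br l x # v)) - k * (s x l * \<Psi>' x (l # v) + \<Phi>' (br l x # v)))"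
    by (simp add: algebra_simps)
  then show ?case by (simp only: pull_br.simps Cons.IH) (simp add: algebra_simps)
qed simp

lemma pull_br_cong:
  assumes "\<And>v. Suc (length v) = length w \<Longrightarrow> \<Phi> v = \<Phi>' v"
    and "\<And>x v. Suc (length v) = length w \<Longrightarrow> \<Psi> x v = \<Psi>' x v"
  shows "pull_br \<Phi> \<Psi> w = pull_br \<Phi>' \<Psi>' w"
  using assms
proof (induction w arbitrary: \<Phi> \<Psi> \<Phi>' \<Psi>')
  case (Cons l w)
  have "pull_br (\<lambda>v. \<Phi> (l # v)) (\<lambda>x v. s x l * \<Psi> x (l # v) + \<Phi> (br l x # v)) w =
     pull_br (\<lambda>v. \<Phi>' (l # v)) (\<lambda>x v. s x l * \<Psi>' x (l # v) + \<Phi>' (br l x # v)) w"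
    by (rule Cons.IH) (simp_all add: Cons.prems)
  then show ?case by (simp add: Cons.prems)
qed simp

text \<open>Once the bracket corrections are included, moving a letter to the front leaves the value
  of a functional unchanged, so every letter contributes the same summand.\<close>

lemma pull_br_self:
  assumes "rel (length w) \<Phi>"
  shows "pull_br \<Phi> (\<lambda>x v. \<Phi> (x # v)) w = of_nat (length w) * \<Phi> w"
  using assms
proof (induction w arbitrary: \<Phi>)
  case (Cons l w)
  have "pull_br (\<lambda>v. \<Phi> (l # v)) (\<lambda>x v. s x l * \<Phi> (x # l # v) + \<Phi> (br l x # v)) w =
    pull_br (\<lambda>v. \<Phi> (l # v)) (\<lambda>x v. \<Phi> (l # x # v)) w"
  proof (rule pull_br_cong)
    fix x and v :: "'l list"
    assume "Suc (length v) = length w"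
    then show "s x l * \<Phi> (x # l # v) + \<Phi> (br l x # v) = \<Phi> (l # x # v)"
      using relD_Cons[OF Cons.prems, of v l x] by (simp add: conj_commute)
  qed simp
  then show ?case
    using Cons.IH[OF rel_Cons, of \<Phi> l] Cons.prems by (simp add: algebra_simps)
qed simp

lemma lin_pull_br:
  assumes "\<And>v. lin (\<lambda>l. \<Phi> l v)" and "\<And>x v. lin (\<lambda>l. \<Psi> l x v)"
  shows "lin (\<lambda>l. pull_br (\<Phi> l) (\<Psi> l) w)"
  using assms by (induction w arbitrary: \<Phi> \<Psi>) (simp_all add: lin_add lin_mult)

lemma pull_br_mlin:
  assumes "mlin \<Phi>" and "\<And>v. lin (\<lambda>x. \<Psi> x v)" and "\<And>x. mlin (\<Psi> x)"
  shows "mlin (pull_br \<Phi> \<Psi>)"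
  unfolding mlin_def
proof (intro allI)
  fix u v
  show "lin (\<lambda>l. pull_br \<Phi> \<Psi> (u @ l # v))"
    using assms
  proof (induction u arbitrary: \<Phi> \<Psi>)
    case Nil
    have "lin (\<lambda>l. s x l * \<Psi> x (l # w) + \<Phi> (br l x # w))" for x w
      by (intro lin_add lin_s mlinD_Cons Nil lin_br_left[of "\<lambda>l. \<Phi> (l # w)"])
    then have "lin (\<lambda>l. pull_br (\<lambda>v. \<Phi> (l # v)) (\<lambda>x v. s x l * \<Psi> x (l # v) + \<Phi> (br l x # v)) v)"
      by (intro lin_pull_br mlinD_Cons Nil)
    then show ?case by (simp add: lin_add Nil)
  next
    case (Cons a u)
    have 1: "lin (\<lambda>x. s x a * \<Psi> x (a # w) + \<Phi> (br a x # w))" for w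
      by (intro lin_add lin_s mlinD_Cons Cons.prems lin_br_right[of "\<lambda>l. \<Phi> (l # w)"])
    have 2: "mlin (\<lambda>v. s x a * \<Psi> x (a # v) + \<Phi> (br a x # v))" for x
      by (intro mlin_add mlin_mult mlin_Cons Cons.prems)
    show ?case
      using Cons.IH[OF mlin_Cons[OF Cons.prems(1)] 1 2] mlinD[OF Cons.prems(3)]
      by (simp add: lin_add)
  qed
qed

text \<open>Each of the n + 1 choices of the front letter contributes one copy of the bracket term.
  For letters other than \<open>a\<close> and \<open>b\<close> this comes from the assumption on
  \<open>\<Psi>\<close>, with the Jacobi identity for letters that pass both; \<open>a\<close> and
  \<open>b\<close> together give two copies by antisymmetry.\<close>

lemma pull_br_rel:
  assumes "mlin \<Phi>" and "rel n \<Phi>" and "length u + length v + 1 = n"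
    and "\<And>x u v. length u + length v + 2 = n \<Longrightarrow>
      \<Psi> x (u @ a # b # v) - s a b * \<Psi> x (u @ b # a # v) = \<Phi> (x # u @ br a b # v)"
  shows "pull_br \<Phi> \<Psi> (u @ a # b # v) - s a b * pull_br \<Phi> \<Psi> (u @ b # a # v) =
    of_nat (Suc n) * \<Phi> (u @ br a b # v)"
  using assms
proof (induction u arbitrary: \<Phi> \<Psi> n)
  case Nil
  \<comment> \<open>The value when a letter \<open>x\<close> of the tail is pulled first past
    \<open>b\<close> and then past \<open>a\<close>.\<close>
  define P where "P = (\<lambda>a b x w. s x b * (s x a * \<Psi> x (a # b # w) + \<Phi> (br a x # b # w)) + \<Phi> (a # br b x # w))"
  have P: "P a b x w - s a b * P b a x w = \<Phi> (br a b # x # w)" if "Suc (length w) = length v" for x w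
  proof -
    have n: "length w + 2 \<le> n" and n': "length w + 2 = n" using that Nil by auto
    have lin: "lin (\<lambda>l. \<Phi> (l # w))" by (rule mlinD_Cons[OF Nil(1)])
    note * = relD_Cons[OF Nil(2) n, of "br a x" b] relD_Cons[OF Nil(2) n, of a "br b x"]
      relD_Cons[OF Nil(2) n, of "br a b" x]
      br_antisym[OF lin, of b "br a x"] br_jacobi[OF lin, of a b x]
    have 1: "\<Psi> x (a # b # w) = s a b * \<Psi> x (b # a # w) + \<Phi> (x # br a b # w)"
      using Nil(4)[of "[]" w x] n' by (simp add: algebra_simps)
    show ?thesis
      unfolding P_def 1 *
      by (cases "par a"; cases "par b"; cases "par x") (simp_all add: algebra_simps)
  qed
  have 2: "pull_br (\<lambda>w. \<Phi> (a # b # w)) (P a b) v - s a b * pull_br (\<lambda>w. \<Phi> (b # a # w)) (P b a) v =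
      of_nat (length v) * \<Phi> (br a b # v)"
  proof -
    have "pull_br (\<lambda>w. \<Phi> (a # b # w)) (P a b) v - s a b * pull_br (\<lambda>w. \<Phi> (b # a # w)) (P b a) v =
      pull_br (\<lambda>w. \<Phi> (br a b # w)) (\<lambda>x w. \<Phi> (br a b # x # w)) v"
      unfolding pull_br_linear[symmetric]
    proof (rule pull_br_cong)
      fix w :: "'l list"
      assume "Suc (length w) = length v"
      then show "\<Phi> (a # b # w) - s a b * \<Phi> (b # a # w) = \<Phi> (br a b # w)"
        using relD_Cons[OF Nil(2), of w a b] Nil(3) by simp
    qed (rule P)
    also have "\<dots> = of_nat (length v) * \<Phi> (br a b # v)"
      using Nil(2,3) by (intro pull_br_self rel_Cons) simp
    finally show ?thesis .
  qed
  \<comment> \<open>With this the summands with \<open>a\<close> or \<open>b\<close> in front leave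
    two more copies, which completes the count \<open>length v + 2 = Suc n\<close>.\<close>
  have 3: "\<Phi> (br b a # v) = - s a b * \<Phi> (br a b # v)"
    by (rule br_antisym[OF mlinD_Cons[OF Nil(1)]])
  have "n = length v + 1" using Nil by simp
  with 2 3 show ?case unfolding P_def
    by (cases "par a"; cases "par b") (simp_all add: algebra_simps)
next
  case (Cons l u)
  then obtain m where m: "n = Suc m" by (cases n) auto
  let ?P = "\<lambda>x v. s x l * \<Psi> x (l # v) + \<Phi> (br l x # v)"
  have "pull_br (\<lambda>v. \<Phi> (l # v)) ?P (u @ a # b # v) - s a b * pull_br (\<lambda>v. \<Phi> (l # v)) ?P (u @ b # a # v) =
    of_nat (Suc m) * \<Phi> (l # u @ br a b # v)"
  proof (rule Cons.IH)
    show "mlin (\<lambda>v. \<Phi> (l # v))" by (rule mlin_Cons[OF Cons.prems(1)])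
    show "rel m (\<lambda>v. \<Phi> (l # v))" using Cons.prems(2) m by (simp add: rel_Cons)
    show "length u + length v + 1 = m" using Cons.prems(3) m by simp
    fix x and u v :: "'l list"
    assume "length u + length v + 2 = m"
    then show "?P x (u @ a # b # v) - s a b * ?P x (u @ b # a # v) = \<Phi> (l # x # u @ br a b # v)"
      using Cons.prems(4)[of "l # u" v x] relD[OF Cons.prems(2), of "br l x # u" v a b]
        relD_Cons[OF Cons.prems(2), of "u @ br a b # v" l x] m
      by (cases "par x"; cases "par l"; cases "par a"; cases "par b") (simp_all add: algebra_simps)
  qed
  moreover have "\<Psi> l (u @ a # b # v) - s a b * \<Psi> l (u @ b # a # v) = \<Phi> (l # u @ br a b # v)"
    using Cons.prems(3) by (intro Cons.prems(4)) simp
  ultimately show ?case by (simp add: m algebra_simps)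
qed

text \<open>
  If \<open>\<Phi>\<close> is a functional on words of length at most \<open>n\<close>, this is a value for words of length \<open>n + 1\<close>
  for which the commutation relation holds, obtained by averaging over the letter in front.
\<close>

primrec ext_step :: "nat \<Rightarrow> ('l list \<Rightarrow> 'k) \<Rightarrow> 'l list \<Rightarrow> 'k" where
  "ext_step 0 \<Phi> w = 0"
| "ext_step (Suc n) \<Phi> w = inverse (of_nat (Suc n)) * pull_br \<Phi> (\<lambda>x v. ext_step n (\<lambda>u. \<Phi> (x # u)) v) w"

lemma lin_ext_step: "(\<And>w. lin (\<lambda>l. F l w)) \<Longrightarrow> lin (\<lambda>l. ext_step n (F l) w)"
  by (induction n arbitrary: F w) (simp_all add: lin_pull_br lin_mult del: of_nat_Suc)

lemma ext_step_mlin: "mlin F \<Longrightarrow> mlin (ext_step n F)"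
proof (induction n arbitrary: F)
  case 0
  then show ?case by (simp add: mlin_def)
next
  case (Suc n)
  have "mlin (\<lambda>w. inverse (of_nat (Suc n)) * pull_br F (\<lambda>x v. ext_step n (\<lambda>u. F (x # u)) v) w)"
    by (intro mlin_mult pull_br_mlin Suc mlin_Cons lin_ext_step mlinD_Cons)
  then show ?case by simp
qed

text \<open>By induction the recursive call with \<open>\<lambda>u. \<Phi> (x # u)\<close> meets the
  hypothesis of \<open>pull_br_rel\<close> on words one letter shorter; the number of letters
  obtained there is what the definition divides by.\<close>

lemma ext_step_rel:
  assumes "mlin \<Phi>" and "rel n \<Phi>" and "length u + length v + 1 = n"
  shows "ext_step (Suc n) \<Phi> (u @ a # b # v) - s a b * ext_step (Suc n) \<Phi> (u @ b # a # v) = \<Phi> (u @ br a b # v)"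
  using assms
proof (induction n arbitrary: \<Phi> u v)
  case (Suc n)
  let ?P = "\<lambda>x v. ext_step (Suc n) (\<lambda>u. \<Phi> (x # u)) v"
  have "pull_br \<Phi> ?P (u @ a # b # v) - s a b * pull_br \<Phi> ?P (u @ b # a # v) =
    of_nat (Suc (Suc n)) * \<Phi> (u @ br a b # v)"
  proof (rule pull_br_rel[OF Suc.prems])
    fix x and u v :: "'l list"
    assume "length u + length v + 2 = Suc n"
    then show "?P x (u @ a # b # v) - s a b * ?P x (u @ b # a # v) = \<Phi> (x # u @ br a b # v)"
      by (intro Suc.IH mlin_Cons rel_Cons Suc.prems) simp
  qed
  then have "inverse (of_nat (Suc (Suc n))) * (pull_br \<Phi> ?P (u @ a # b # v) - s a b * pull_br \<Phi> ?P (u @ b # a # v)) =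
    \<Phi> (u @ br a b # v)" by (simp del: of_nat_Suc)
  then show ?case unfolding ext_step.simps(2)[of "Suc n"] by (simp only: right_diff_distrib mult.left_commute)
qed simp

text \<open>
  The functional whose symmetrization is \<open>c\<close>, built by recursion on the length of words.  A
  graded symmetric term may be added to \<open>ext_step\<close> without affecting the relation.
\<close>

primrec pbw :: "('l list \<Rightarrow> 'k) \<Rightarrow> nat \<Rightarrow> 'l list \<Rightarrow> 'k" where
  "pbw c 0 = (\<lambda>w. if w = [] then c [] else 0)"
| "pbw c (Suc n) = (\<lambda>w. if length w = Suc n
    then c w - symmN (Suc n) (ext_step (Suc n) (pbw c n)) w + ext_step (Suc n) (pbw c n) w
    else pbw c n w)"

lemma mlin_if_length:
  assumes "mlin F" and "mlin G"
  shows "mlin (\<lambda>w. if length w = k then F w else G w)"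
  unfolding mlin_def
proof (intro allI)
  fix u v
  show "lin (\<lambda>l. if length (u @ l # v) = k then F (u @ l # v) else G (u @ l # v))"
    using mlinD[OF assms(1), of u v] mlinD[OF assms(2), of u v]
    by (cases "length u + Suc (length v) = k") simp_all
qed

lemma pbw_mlin:
  assumes "mlin c"
  shows "mlin (pbw c n)"
proof (induction n)
  case 0
  show ?case by (simp add: mlin_def)
next
  case (Suc n)
  show ?case unfolding pbw.simps
    by (intro mlin_if_length mlin_add mlin_diff symmN_mlin ext_step_mlin assms Suc)
qed

lemma pbw_rel:
  assumes "gsym c" and "mlin c"
  shows "rel n (pbw c n)"
proof (induction n)
  case 0
  show ?case by (simp add: rel_def)
next
  case (Suc n)
  show ?case
    unfolding rel_def
  proof (intro allI impI)
    fix u v :: "'l list" and a b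
    assume le: "length u + length v + 2 \<le> Suc n"
    let ?E = "ext_step (Suc n) (pbw c n)"
    show "pbw c (Suc n) (u @ a # b # v) = s a b * pbw c (Suc n) (u @ b # a # v) + pbw c (Suc n) (u @ br a b # v)"
    proof (cases "length u + length v + 2 = Suc n")
      case True
      then have "length u + length v + 1 = n" by simp
      from ext_step_rel[OF pbw_mlin[OF assms(2)] Suc this, of a b]
        symD_append[OF assms(1), of u a b v] symD_append[OF symmN_sym[of "Suc n" ?E], of u a b v] True
      show ?thesis by (simp del: ext_step.simps symmN.simps add: algebra_simps)
    next
      case False
      then show ?thesis using relD[OF Suc, of u v a b] le by simp
    qed
  qed
qed

lemma pbw_length: "length w \<le> n \<Longrightarrow> pbw c n w = pbw c (length w) w"
  by (induction n) (auto simp: le_Suc_eq simp del: ext_step.simps symmN.simps)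

lemma envD: "env F \<Longrightarrow> F (u @ a # b # v) = s a b * F (u @ b # a # v) + F (u @ br a b # v)"
  unfolding env_def by blast

lemma envD_Cons: "env F \<Longrightarrow> F (a # b # v) = s a b * F (b # a # v) + F (br a b # v)"
  using envD[of F "[]" a b v] by simp

lemma env_mlin: "env F \<Longrightarrow> mlin F"
  unfolding env_def by blast

lemma envI:
  "mlin F \<Longrightarrow> (\<And>u a b v. F (u @ a # b # v) = s a b * F (u @ b # a # v) + F (u @ br a b # v)) \<Longrightarrow> env F"
  unfolding env_def by blast

lemma env_append:
  assumes "env F"
  shows "env (\<lambda>w. F (x @ w @ y))"
proof (rule envI)
  show "mlin (\<lambda>w. F (x @ w @ y))" by (rule mlin_append[OF env_mlin[OF assms]])
  fix u a b v
  show "F (x @ (u @ a # b # v) @ y) = s a b * F (x @ (u @ b # a # v) @ y) + F (x @ (u @ br a b # v) @ y)"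
    using envD[OF assms, of "x @ u" a b "v @ y"] by simp
qed

lemma env_Cons: "env F \<Longrightarrow> env (\<lambda>w. F (l # w))"
  using env_append[of F "[l]" "[]"] by simp

lemma env_suffix: "env F \<Longrightarrow> env (\<lambda>w. F (w @ y))"
  using env_append[of F "[]" y] by simp

lemma env_0: "env (\<lambda>w. 0)"
  by (simp add: env_def mlin_0)

lemma env_add:
  assumes "env F" "env G"
  shows "env (\<lambda>w. F w + G w)"
proof (rule envI)
  show "mlin (\<lambda>w. F w + G w)" by (intro mlin_add env_mlin assms)
  fix u a b v
  show "F (u @ a # b # v) + G (u @ a # b # v) = s a b * (F (u @ b # a # v) + G (u @ b # a # v)) +
      (F (u @ br a b # v) + G (u @ br a b # v))"
    using envD[OF assms(1), of u a b v] envD[OF assms(2), of u a b v] by (simp add: algebra_simps)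
qed

lemma env_mult:
  assumes "env F"
  shows "env (\<lambda>w. k * F w)"
proof (rule envI)
  show "mlin (\<lambda>w. k * F w)" by (intro mlin_mult env_mlin assms)
  fix u a b v
  show "k * F (u @ a # b # v) = s a b * (k * F (u @ b # a # v)) + k * F (u @ br a b # v)"
    using envD[OF assms, of u a b v] by (simp add: algebra_simps)
qed

lemma env_diff: "env F \<Longrightarrow> env G \<Longrightarrow> env (\<lambda>w. F w - G w)"
  using env_add[of F "\<lambda>w. - 1 * G w"] env_mult[of G "- 1"] by simp

lemma env_minus: "env F \<Longrightarrow> env (\<lambda>w. - F w)"
  using env_mult[of F "- 1"] by simp

lemma env_sg:
  assumes "env F"
  shows "env (\<lambda>w. sg (wpar w) * F w)"
proof (rule envI)
  have "lin (\<lambda>l. sg (wpar (u @ l # v)) * F (u @ l # v))" for u v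
    using lin_par[OF mlinD[OF env_mlin[OF assms]], of "\<lambda>b. sg (wpar u \<noteq> (b \<noteq> wpar v))" u v] by simp
  then show "mlin (\<lambda>w. sg (wpar w) * F w)" unfolding mlin_def by blast
  fix u a b v
  show "sg (wpar (u @ a # b # v)) * F (u @ a # b # v) =
      s a b * (sg (wpar (u @ b # a # v)) * F (u @ b # a # v)) + sg (wpar (u @ br a b # v)) * F (u @ br a b # v)"
    using envD[OF assms, of u a b v]
    by (cases "par a"; cases "par b"; cases "wpar u"; cases "wpar v") simp_all
qed

text \<open>The surjective half of the dual PBW theorem. In each length the extension minus its own
  symmetrization is added to \<open>c\<close>; symmetrization fixes symmetric functions, so exactly
  \<open>c\<close> is left.\<close>

lemma env_extension:
  assumes "gsym c" and "mlin c"
  shows "\<exists>F. env F \<and> symm F = c"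
proof (intro exI conjI ext)
  let ?F = "\<lambda>w. pbw c (length w) w"
  have F: "?F w = pbw c n w" if "length w \<le> n" for n w using pbw_length[OF that] by simp
  show "env ?F"
  proof (rule envI)
    show "mlin ?F" by (rule mlin_cong_length[OF pbw_mlin[OF assms(2)]])
    fix u a b v
    show "?F (u @ a # b # v) = s a b * ?F (u @ b # a # v) + ?F (u @ br a b # v)"
      using relD[OF pbw_rel[OF assms, of "length u + length v + 2"], of u v a b]
        F[of "u @ a # b # v" "length u + length v + 2"] F[of "u @ b # a # v" "length u + length v + 2"]
        F[of "u @ br a b # v" "length u + length v + 2"]
      by (simp del: pbw.simps)
  qed
  fix w
  have "symm ?F w = symmN (length w) (pbw c (length w)) w"
    unfolding symm_def by (rule symmN_cong) simp
  also have "\<dots> = c w"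
  proof (cases "length w")
    case (Suc m)
    let ?E = "ext_step (Suc m) (pbw c m)"
    have "symmN (Suc m) (pbw c (Suc m)) w = symmN (Suc m) (\<lambda>w. c w - symmN (Suc m) ?E w + ?E w) w"
      by (rule symmN_cong) simp
    also have "\<dots> = symm c w - symm (symmN (Suc m) ?E) w + symmN (Suc m) ?E w"
      by (simp only: symmN_linear symm_def Suc)
    also have "\<dots> = c w"
      by (simp only: symm_of_sym[OF assms(1)] symm_of_sym[OF symmN_sym] diff_add_cancel)
    finally show ?thesis by (simp only: Suc)
  qed simp
  finally show "symm ?F w = c w" .
qed

text \<open>The injective half of the dual PBW theorem. By induction the bracket terms, being values
  on shorter words, vanish; so on words of the present length \<open>F\<close> is already symmetric
  and equals its symmetrization.\<close>

lemma env_eq_0: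
  assumes "env F" and "symm F = (\<lambda>w. 0)"
  shows "F w = 0"
proof (induction w rule: length_induct)
  case (1 w)
  let ?G = "\<lambda>v. if length v = length w then F v else 0"
  have "gsym ?G"
  proof (rule symI)
    fix u a b v
    have "F (u @ br a b # v) = 0" if "length (u @ a # b # v) = length w"
      using 1 that by simp
    then show "?G (u @ a # b # v) = s a b * ?G (u @ b # a # v)"
      using envD[OF assms(1), of u a b v] by auto
  qed
  then have "symm ?G w = ?G w" by (rule symm_of_sym)
  moreover have "symm ?G w = symm F w" unfolding symm_def by (rule symmN_cong) simp
  ultimately show ?case by (simp add: assms(2))
qed

lemma env_eqI:
  assumes "env F" "env G" and "\<And>w. symm F w = symm G w"
  shows "F = G"
proof
  fix w
  have "F w - G w = 0"
    by (rule env_eq_0[OF env_diff[OF assms(1,2)]]) (intro ext, simp add: symm_linear assms(3))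
  then show "F w = G w" by simp
qed

lemma hat_env:
  assumes F: "env F" and par: "\<And>l. par (\<delta> l) = (par l \<noteq> e)"
    and lin: "\<And>\<phi>. lin \<phi> \<Longrightarrow> lin (\<lambda>l. \<phi> (\<delta> l))"
    and der: "\<And>\<phi> a b. lin \<phi> \<Longrightarrow> \<phi> (\<delta> (br a b)) = \<phi> (br (\<delta> a) b) + sg (e \<and> par a) * \<phi> (br a (\<delta> b))"
  shows "env (hat e \<delta> F)"
proof (rule envI)
  show "mlin (hat e \<delta> F)" by (rule hat_mlin[OF env_mlin[OF F] lin])
  fix u a b v
  show "hat e \<delta> F (u @ a # b # v) = s a b * hat e \<delta> F (u @ b # a # v) + hat e \<delta> F (u @ br a b # v)"
    using F
  proof (induction u arbitrary: F)
    case Nil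
    have *: "(\<lambda>v. F (a # b # v)) = (\<lambda>v. s a b * F (b # a # v) + F (br a b # v))"
      by (rule ext) (rule envD_Cons[OF Nil])
    note ** = envD_Cons[OF Nil, of "\<delta> a" b v] envD_Cons[OF Nil, of a "\<delta> b" v]
      der[OF mlinD_Cons[OF env_mlin[OF Nil]], of a b v]
    show ?case
      unfolding append_Nil hat.simps * **
      by (cases e; cases "par a"; cases "par b") (simp_all add: par hat_linear algebra_simps)
  next
    case (Cons l u)
    show ?case
      using Cons.IH[OF env_Cons[OF Cons.prems, of l]] envD[OF Cons.prems, of "\<delta> l # u" a b v]
      by (simp add: algebra_simps)
  qed
qed

section \<open>The contracting homotopy obtained through symmetrization\<close>

definition eps :: "'l list \<Rightarrow> 'k"
  where "eps w = (if w = [] then 1 else 0)"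

lemma eps_simps [simp]: "eps [] = 1" "eps (l # w) = 0" "eps (u @ l # v) = 0"
  by (simp_all add: eps_def)

lemma env_eps: "env eps"
  by (rule envI) (simp_all add: mlin_def)

text \<open>
  Under symmetrization this is the usual contraction of a symmetric algebra by the derivation \<open>\<sigma>\<close>,
  divided by the length of words.
\<close>

definition contr :: "('l \<Rightarrow> 'l) \<Rightarrow> ('l list \<Rightarrow> 'k) \<Rightarrow> 'l list \<Rightarrow> 'k"
  where "contr \<sigma> F = (THE F'. env F' \<and>
    symm F' = (\<lambda>w. inverse (of_nat (length w)) * hat True \<sigma> (symm F) w))"

lemma mlin_length: "mlin F \<Longrightarrow> mlin (\<lambda>w. g (length w) * F w)"
  unfolding mlin_def by (simp add: lin_mult)

lemma sym_length:
  assumes "gsym F"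
  shows "gsym (\<lambda>w. g (length w) * F w)"
proof (rule symI)
  fix u a b v
  show "g (length (u @ a # b # v)) * F (u @ a # b # v) =
      s a b * (g (length (u @ b # a # v)) * F (u @ b # a # v))"
    using symD_append[OF assms, of u a b v] by simp
qed

text \<open>Existence for the definite description is \<open>env_extension\<close>, uniqueness is
  \<open>env_eqI\<close>. For the empty word the factor is inverse 0, that is 0.\<close>

lemma contr:
  assumes F: "env F" and par: "\<And>l. par (\<sigma> l) = (\<not> par l)"
    and lin: "\<And>\<phi>. lin \<phi> \<Longrightarrow> lin (\<lambda>l. \<phi> (\<sigma> l))"
  shows env_contr: "env (contr \<sigma> F)"
    and symm_contr: "symm (contr \<sigma> F) w = inverse (of_nat (length w)) * hat True \<sigma> (symm F) w"
proof -
  let ?c = "\<lambda>w. inverse (of_nat (length w)) * hat True \<sigma> (symm F) w"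
  have "gsym ?c" by (intro sym_length[of _ "\<lambda>n. inverse (of_nat n)"] hat_sym symm_sym) (simp add: par)
  moreover have "mlin ?c"
    by (intro mlin_length[of _ "\<lambda>n. inverse (of_nat n)"] hat_mlin symm_mlin env_mlin F lin)
  ultimately obtain F' where F': "env F' \<and> symm F' = ?c" using env_extension by blast
  have "env (contr \<sigma> F) \<and> symm (contr \<sigma> F) = ?c"
    unfolding contr_def
  proof (rule theI[where P = "\<lambda>G. env G \<and> symm G = ?c"])
    show "env F' \<and> symm F' = ?c" by (rule F')
    fix G assume "env G \<and> symm G = ?c"
    with F' show "G = F'" by (intro env_eqI) auto
  qed
  then show "env (contr \<sigma> F)" and "symm (contr \<sigma> F) w = ?c w" by auto
qed

lemma pull_sg: "pull (\<lambda>x v. sg ((e \<noteq> par x) \<noteq> wpar v) * \<Phi> x v) w = sg (e \<noteq> wpar w) * pull \<Phi> w"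
proof (induction w arbitrary: e \<Phi>)
  case (Cons l w)
  have "(\<lambda>x v. s x l * (sg ((e \<noteq> par x) \<noteq> wpar (l # v)) * \<Phi> x (l # v))) =
    (\<lambda>x v. sg (((e \<noteq> par l) \<noteq> par x) \<noteq> wpar v) * (s x l * \<Phi> x (l # v)))"
    by (intro ext) (cases e; cases "par l"; cases "wpar v"; auto simp: sg_def)
  then show ?case
    using Cons.IH[of "e \<noteq> par l" "\<lambda>x v. s x l * \<Phi> x (l # v)"]
    by (simp only: pull.simps wpar.simps neq_assoc distrib_left)
qed simp

lemma symm_sg: "symm (\<lambda>w. sg (wpar w) * F w) w = sg (wpar w) * symm F w"
proof -
  have "symmN n (\<lambda>u. sg (e \<noteq> wpar u) * F u) w = sg (e \<noteq> wpar w) * symmN n F w" for n e F w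
  proof (induction n arbitrary: F w e)
    case (Suc n)
    have "(\<lambda>u. sg (e \<noteq> wpar (x # u)) * F (x # u)) = (\<lambda>u. sg ((e \<noteq> par x) \<noteq> wpar u) * F (x # u))" for x
      by (simp only: wpar.simps neq_assoc)
    then have "pull (\<lambda>x v. symmN n (\<lambda>u. sg (e \<noteq> wpar (x # u)) * F (x # u)) v) w =
      sg (e \<noteq> wpar w) * pull (\<lambda>x v. symmN n (\<lambda>u. F (x # u)) v) w"
      by (simp only: Suc pull_sg)
    then show ?case
      by (simp only: symmN.simps mult.left_commute)
  qed simp
  from this[of "length w" False F w] show ?thesis by (simp add: symm_def)
qed

lemma hat_sg:
  assumes "\<And>l. par (\<delta> l) = (par l \<noteq> e)"
  shows "hat e \<delta> (\<lambda>w. sg (wpar w) * F w) w = sg (wpar w \<noteq> e) * hat e \<delta> F w"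
proof -
  have "hat e \<delta> (\<lambda>w. sg (p \<noteq> wpar w) * F w) w = sg (p \<noteq> (wpar w \<noteq> e)) * hat e \<delta> F w" for p F
  proof (induction w arbitrary: p F)
    case (Cons l w)
    have "(\<lambda>v. sg (p \<noteq> wpar (l # v)) * F (l # v)) = (\<lambda>v. sg ((p \<noteq> par l) \<noteq> wpar v) * F (l # v))"
      by (intro ext) (cases p; cases "par l"; simp)
    then show ?case
      by (simp only: hat.simps Cons.IH wpar.simps assms)
        (cases p; cases "par l"; cases e; cases "wpar w"; simp)
  qed simp
  from this[of False F] show ?thesis by simp
qed

context
  fixes \<sigma> :: "'l \<Rightarrow> 'l"
  assumes par_\<sigma>: "\<And>l. par (\<sigma> l) = (\<not> par l)"
    and lin_\<sigma>: "\<And>\<phi>. lin \<phi> \<Longrightarrow> lin (\<lambda>l. \<phi> (\<sigma> l))"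
begin

lemma contr_diff:
  assumes "env F" "env G"
  shows "contr \<sigma> (\<lambda>w. F w - k * G w) = (\<lambda>w. contr \<sigma> F w - k * contr \<sigma> G w)"
  by (intro env_eqI env_contr env_diff env_mult assms par_\<sigma> lin_\<sigma>)
    (simp_all add: symm_contr[OF _ par_\<sigma> lin_\<sigma>] env_diff env_mult assms hat_linear
      symm_linear symm_linear[abs_def] right_diff_distrib)

lemma contr_sg:
  assumes "env F"
  shows "contr \<sigma> (\<lambda>w. sg (wpar w) * F w) = (\<lambda>w. - (sg (wpar w) * contr \<sigma> F w))"
proof (intro env_eqI env_contr env_sg env_minus assms par_\<sigma> lin_\<sigma>)
  fix w
  have "symm (\<lambda>w. sg (wpar w) * F w) = (\<lambda>w. sg (wpar w) * symm F w)" by (rule ext) (rule symm_sg)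
  then have "symm (contr \<sigma> (\<lambda>w. sg (wpar w) * F w)) w =
      inverse (of_nat (length w)) * (sg (wpar w \<noteq> True) * hat True \<sigma> (symm F) w)"
    by (simp only: symm_contr[OF env_sg[OF assms] par_\<sigma> lin_\<sigma>]) (simp add: hat_sg[of \<sigma> True] par_\<sigma>)
  also have "\<dots> = - (sg (wpar w) * symm (contr \<sigma> F) w)"
    by (simp add: symm_contr[OF assms par_\<sigma> lin_\<sigma>] sg_def)
  finally show "symm (contr \<sigma> (\<lambda>w. sg (wpar w) * F w)) w = symm (\<lambda>w. - (sg (wpar w) * contr \<sigma> F w)) w"
    by (simp add: symm_linear symm_sg)
qed

text \<open>Symmetrization commutes with \<open>\<delta>\<close>, so the identity may be tested on
  symmetric functions, where the graded commutator of the two derivations is \<open>k\<close> times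
  the Euler derivation. Dividing by the length leaves \<open>k\<close> except on the empty word,
  whence the \<open>eps\<close> term. The detour through symmetric functions is made because
  \<open>\<sigma>\<close> is in general no derivation of the bracket.\<close>

lemma hat_contr:
  assumes F: "env F" and par: "\<And>l. par (\<delta> l) = (\<not> par l)"
    and lin: "\<And>\<phi>. lin \<phi> \<Longrightarrow> lin (\<lambda>l. \<phi> (\<delta> l))"
    and der: "\<And>\<phi> a b. lin \<phi> \<Longrightarrow> \<phi> (\<delta> (br a b)) = \<phi> (br (\<delta> a) b) + sg (par a) * \<phi> (br a (\<delta> b))"
    and comm: "\<And>\<phi> l. lin \<phi> \<Longrightarrow> \<phi> (\<delta> (\<sigma> l)) + \<phi> (\<sigma> (\<delta> l)) = k * \<phi> l"
  shows "hat True \<delta> (contr \<sigma> F) w + contr \<sigma> (hat True \<delta> F) w = k * (F w - F [] * eps w)"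
proof -
  note c = symm_contr[OF _ par_\<sigma> lin_\<sigma>]
  have dF: "env (hat True \<delta> F)" by (rule hat_env[OF F]) (simp_all add: par lin der)
  have env: "env (\<lambda>w. hat True \<delta> (contr \<sigma> F) w + contr \<sigma> (hat True \<delta> F) w)"
    by (intro env_add hat_env env_contr dF F par_\<sigma> lin_\<sigma>) (simp_all add: par lin der)
  have 1: "symm (hat True \<delta> G) w = hat True \<delta> (symm G) w" for G w
    using hat_symm[of \<delta> True G w] par by simp
  have "(\<lambda>w. hat True \<delta> (contr \<sigma> F) w + contr \<sigma> (hat True \<delta> F) w) = (\<lambda>w. k * (F w - F [] * eps w))"
  proof (rule env_eqI[OF env])
    show "env (\<lambda>w. k * (F w - F [] * eps w))" by (intro env_mult env_diff F env_eps)
    fix w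
    have "symm (contr \<sigma> F) = (\<lambda>w. inverse (of_nat (length w)) * hat True \<sigma> (symm F) w)"
      using c[OF F] by blast
    then have "symm (hat True \<delta> (contr \<sigma> F)) w =
        hat True \<delta> (\<lambda>w. inverse (of_nat (length w)) * hat True \<sigma> (symm F) w) w"
      by (simp add: 1)
    \<comment> \<open>\<open>hat\<close> keeps the length, so the weight is a constant that can be
      taken out.\<close>
    also have "\<dots> = hat True \<delta> (\<lambda>v. inverse (of_nat (length w)) * hat True \<sigma> (symm F) v) w"
      by (rule hat_cong) simp
    finally have 2: "symm (hat True \<delta> (contr \<sigma> F)) w =
      inverse (of_nat (length w)) * hat True \<delta> (hat True \<sigma> (symm F)) w" by (simp add: hat_linear)
    have 3: "symm (contr \<sigma> (hat True \<delta> F)) w =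
      inverse (of_nat (length w)) * hat True \<sigma> (hat True \<delta> (symm F)) w"
      by (simp add: c[OF dF] 1[abs_def])
    have 4: "hat True \<delta> (hat True \<sigma> (symm F)) w + hat True \<sigma> (hat True \<delta> (symm F)) w =
      k * (of_nat (length w) * symm F w)"
      using hat_commutator[of \<delta> True \<sigma> True k "\<lambda>l. l" "symm F" w] comm
      by (simp add: par par_\<sigma> hat_id symm_mlin[OF env_mlin[OF F]] add.commute)
    have "inverse (of_nat (length w)) * (k * (of_nat (length w) * symm F w)) = k * (symm F w - F [] * eps w)"
      by (cases w) (simp_all del: of_nat_Suc)
    moreover have "symm eps w = eps w"
      by (rule symm_of_sym) (simp add: gsym_def)
    ultimately show "symm (\<lambda>w. hat True \<delta> (contr \<sigma> F) w + contr \<sigma> (hat True \<delta> F) w) w =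
        symm (\<lambda>w. k * (F w - F [] * eps w)) w"
      by (simp add: symm_linear 2 3 4 distrib_left[symmetric])
  qed
  from fun_cong[OF this, of w] show ?thesis .
qed

end

section \<open>Convolution and homotopies\<close>

text \<open>
  The pairing of \<open>\<Phi>\<close> with the coproduct of the enveloping algebra, for which letters are primitive.
\<close>

primrec conv :: "('l list \<Rightarrow> 'l list \<Rightarrow> 'k) \<Rightarrow> 'l list \<Rightarrow> 'k" where
  "conv \<Phi> [] = \<Phi> [] []"
| "conv \<Phi> (l # w) = conv (\<lambda>u v. \<Phi> (l # u) v) w + conv (\<lambda>u v. sg (par l \<and> wpar u) * \<Phi> u (l # v)) w"

lemma conv_linear:
  "conv (\<lambda>u v. 0) w = 0"
  "conv (\<lambda>u v. \<Phi> u v + \<Psi> u v) w = conv \<Phi> w + conv \<Psi> w"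
  "conv (\<lambda>u v. k * \<Phi> u v) w = k * conv \<Phi> w"
  "conv (\<lambda>u v. - \<Phi> u v) w = - conv \<Phi> w"
  "conv (\<lambda>u v. \<Phi> u v - \<Psi> u v) w = conv \<Phi> w - conv \<Psi> w"
  by (induction w arbitrary: \<Phi> \<Psi>) (simp_all add: distrib_left right_diff_distrib mult.left_commute)

lemma conv_param:
  assumes "\<And>u v. env (\<lambda>z. \<Phi> z u v)"
  shows "env (\<lambda>z. conv (\<Phi> z) w)"
  using assms by (induction w arbitrary: \<Phi>) (simp_all add: env_add env_mult)

lemma lin_conv: "(\<And>u v. lin (\<lambda>l. \<Phi> l u v)) \<Longrightarrow> lin (\<lambda>l. conv (\<Phi> l) w)"
  by (induction w arbitrary: \<Phi>) (simp_all add: lin_add lin_mult)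

definition env2 :: "('l list \<Rightarrow> 'l list \<Rightarrow> 'k) \<Rightarrow> bool"
  where "env2 \<Phi> \<longleftrightarrow> (\<forall>v. env (\<lambda>u. \<Phi> u v)) \<and> (\<forall>u. env (\<Phi> u))"

lemma env_sg': "env F \<Longrightarrow> env (\<lambda>w. sg (p \<and> wpar w) * F w)"
  by (cases p) (simp_all add: env_sg)

lemma env2_left: "env2 \<Phi> \<Longrightarrow> env2 (\<lambda>u v. \<Phi> (l # u) v)"
  unfolding env2_def using env_Cons[of "\<lambda>u. \<Phi> u _" l] by blast

lemma env2_right: "env2 \<Phi> \<Longrightarrow> env2 (\<lambda>u v. sg (p \<and> wpar u) * \<Phi> u (l # v))"
  unfolding env2_def by (simp add: env_sg' env_mult env_Cons)

text \<open>The coproduct is an algebra map because commutators of primitive elements are primitive: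
  of the four placements of \<open>a\<close> and \<open>b\<close>, the mixed ones match, and the
  others give the relation in one factor.\<close>

lemma conv_env:
  assumes "env2 \<Phi>"
  shows "env (conv \<Phi>)"
proof (rule envI)
  have "lin (\<lambda>l. conv \<Phi> (u @ l # v))" for u v
    using assms
  proof (induction u arbitrary: \<Phi>)
    case Nil
    have 1: "lin (\<lambda>l. \<Phi> (l # u) v)" and 2: "lin (\<lambda>l. \<Phi> u (l # v))" for u v
      using mlinD_Cons[of "\<lambda>u. \<Phi> u v"] mlinD_Cons[of "\<Phi> u"] Nil env_mlin by (auto simp: env2_def)
    have "lin (\<lambda>l. sg (par l \<and> wpar u) * \<Phi> u (l # v))" for u v
      using lin_par[OF 2[of u v], of "\<lambda>b. sg (b \<and> wpar u)"] .
    with 1 show ?case by (simp add: lin_add lin_conv)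
  next
    case (Cons a u)
    then show ?case by (simp add: lin_add env2_left env2_right)
  qed
  then show "mlin (conv \<Phi>)" unfolding mlin_def by blast
next
  fix u a b v
  show "conv \<Phi> (u @ a # b # v) = s a b * conv \<Phi> (u @ b # a # v) + conv \<Phi> (u @ br a b # v)"
    using assms
  proof (induction u arbitrary: \<Phi>)
    case Nil
    have 1: "\<Phi> (a # b # u) v = s a b * \<Phi> (b # a # u) v + \<Phi> (br a b # u) v"
      and 2: "\<Phi> u (a # b # v) = s a b * \<Phi> u (b # a # v) + \<Phi> u (br a b # v)" for u v
      using envD_Cons[of "\<lambda>u. \<Phi> u v" a b u] envD_Cons[of "\<Phi> u" a b v] Nil by (auto simp: env2_def)
    show ?case
      unfolding append_Nil conv.simps conv_linear(2,3)[symmetric]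
      by (intro arg_cong[where f = "\<lambda>\<Phi>. conv \<Phi> v"] ext)
        (cases "par a"; cases "par b"; simp add: 1[of _ _] 2 algebra_simps sg_sq)
  next
    case (Cons l u)
    show ?case
      using Cons.IH[OF env2_left[OF Cons.prems, of l]] Cons.IH[OF env2_right[OF Cons.prems, of "par l" l]]
      by (simp add: algebra_simps)
  qed
qed

lemma hat_sg':
  assumes "\<And>l. par (\<delta> l) = (par l \<noteq> e)"
  shows "hat e \<delta> (\<lambda>w. sg (p \<and> wpar w) * F w) w = sg (p \<and> (wpar w \<noteq> e)) * hat e \<delta> F w"
  using hat_sg[of \<delta> e F w] assms by (cases p) simp_all

lemma hat_conv:
  assumes par: "\<And>l. par (\<delta> l) = (par l \<noteq> e)"
  shows "hat e \<delta> (conv \<Phi>) w =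
    conv (\<lambda>u v. hat e \<delta> (\<lambda>u. \<Phi> u v) u + sg (e \<and> wpar u) * hat e \<delta> (\<Phi> u) v) w"
proof (induction w arbitrary: \<Phi>)
  case (Cons l w)
  show ?case
    unfolding hat.simps conv.simps hat_linear Cons.IH conv_linear(2,3)[symmetric] par hat_sg'[OF par]
    by (intro arg_cong[where f = "\<lambda>\<Phi>. conv \<Phi> w"] ext)
      (cases e; cases "par l"; simp add: algebra_simps sg_sq hat_linear)
qed simp

lemma conv_snoc:
  "conv \<Phi> (w @ [l]) =
    conv (\<lambda>u v. sg (par l \<and> wpar v) * \<Phi> (u @ [l]) v) w + conv (\<lambda>u v. \<Phi> u (v @ [l])) w"
proof (induction w arbitrary: \<Phi>)
  case (Cons a w)
  show ?case
    unfolding append_Cons conv.simps Cons.IH conv_linear(2,3)[symmetric]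
    by (intro arg_cong[where f = "\<lambda>\<Phi>. conv \<Phi> w"] ext)
      (cases "par a"; cases "par l"; simp add: algebra_simps sg_sq)
qed simp

lemma conv_sg: "conv (\<lambda>u v. sg (p \<and> (wpar u \<noteq> wpar v)) * \<Phi> u v) w = sg (p \<and> wpar w) * conv \<Phi> w"
proof (induction w arbitrary: \<Phi>)
  case (Cons l w)
  have 1: "conv (\<lambda>u v. sg (p \<and> (wpar (l # u) \<noteq> wpar v)) * \<Phi> (l # u) v) w =
      sg (p \<and> wpar (l # w)) * conv (\<lambda>u v. \<Phi> (l # u) v) w"
    using Cons.IH[of "\<lambda>u v. sg (p \<and> par l) * \<Phi> (l # u) v"]
    by (cases p; cases "par l") (simp_all add: conv_linear sg_eq)
  have 2: "(\<lambda>u v. sg (par l \<and> wpar u) * (sg (p \<and> (wpar u \<noteq> wpar (l # v))) * \<Phi> u (l # v))) =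
     (\<lambda>u v. sg (p \<and> (wpar u \<noteq> wpar v)) * (sg (p \<and> par l) * (sg (par l \<and> wpar u) * \<Phi> u (l # v))))"
    by (intro ext) (cases p; cases "par l"; simp add: sg_eq)
  show ?case
    unfolding conv.simps 1 2 Cons.IH
    by (cases p; cases "par l") (simp_all add: conv_linear algebra_simps)
qed simp

text \<open>Coassociativity; the signs agree because passing two factors costs the product of the
  two signs.\<close>

lemma conv_assoc:
  "conv (\<lambda>u z. conv (\<lambda>x y. \<Psi> x y z) u) w = conv (\<lambda>x v. conv (\<lambda>y z. \<Psi> x y z) v) w"
proof (induction w arbitrary: \<Psi>)
  case (Cons l w)
  have "conv (\<lambda>u z. sg (par l \<and> wpar u) * conv (\<lambda>x y. \<Psi> x y (l # z)) u) w =
    conv (\<lambda>u z. conv (\<lambda>x y. sg (par l \<and> (wpar x \<noteq> wpar y)) * \<Psi> x y (l # z)) u) w"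
    by (simp only: conv_sg)
  also have "\<dots> = conv (\<lambda>x v. conv (\<lambda>y z. sg (par l \<and> (wpar x \<noteq> wpar y)) * \<Psi> x y (l # z)) v) w"
    by (rule Cons.IH)
  also have "\<dots> = conv (\<lambda>x v. sg (par l \<and> wpar x) * conv (\<lambda>y z. sg (par l \<and> wpar y) * \<Psi> x y (l # z)) v) w"
  proof -
    have "sg (par l \<and> (wpar x \<noteq> wpar y)) * \<Psi> x y (l # z) = sg (par l \<and> wpar x) * (sg (par l \<and> wpar y) * \<Psi> x y (l # z))"
      for x y z by (cases "par l"; simp add: sg_eq)
    then show ?thesis by (simp only: conv_linear)
  qed
  finally show ?case
    using Cons.IH[of "\<lambda>x y z. \<Psi> (l # x) y z"]
      Cons.IH[of "\<lambda>x y z. sg (par l \<and> wpar x) * \<Psi> x (l # y) z"]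
    by (simp add: conv_linear distrib_left add.assoc)
qed simp

text \<open>Precomposition with the map that reverses a word and negates each letter; the sign is
  that of moving the leading letter behind the others.\<close>

primrec antipode :: "('l list \<Rightarrow> 'k) \<Rightarrow> 'l list \<Rightarrow> 'k" where
  "antipode F [] = F []"
| "antipode F (l # w) = - antipode (\<lambda>u. sg (par l \<and> wpar u) * F (u @ [l])) w"

lemma antipode_linear:
  "antipode (\<lambda>w. 0) w = 0"
  "antipode (\<lambda>w. F w + G w) w = antipode F w + antipode G w"
  "antipode (\<lambda>w. k * F w) w = k * antipode F w"
  "antipode (\<lambda>w. - F w) w = - antipode F w"
  "antipode (\<lambda>w. F w - G w) w = antipode F w - antipode G w"
  by (induction w arbitrary: F G) (simp_all add: distrib_left right_diff_distrib mult.left_commute)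

lemma antipode_param:
  assumes "\<And>x. env (\<lambda>z. F z x)"
  shows "env (\<lambda>z. antipode (F z) w)"
  using assms by (induction w arbitrary: F) (simp_all add: env_minus env_mult)

lemma lin_antipode: "(\<And>x. lin (\<lambda>l. F l x)) \<Longrightarrow> lin (\<lambda>l. antipode (F l) w)"
  by (induction w arbitrary: F) (simp_all add: lin_minus lin_mult)

lemma antipode_sg: "antipode (\<lambda>u. sg (p \<and> wpar u) * F u) w = sg (p \<and> wpar w) * antipode F w"
proof (induction w arbitrary: F)
  case (Cons l w)
  have "(\<lambda>u. sg (par l \<and> wpar u) * (sg (p \<and> wpar (u @ [l])) * F (u @ [l]))) =
    (\<lambda>u. sg (p \<and> wpar u) * (sg (p \<and> par l) * (sg (par l \<and> wpar u) * F (u @ [l]))))"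
    by (intro ext) (cases p; cases "par l"; simp)
  then show ?case
    by (simp only: antipode.simps Cons.IH) (cases p; cases "par l"; simp add: antipode_linear)
qed simp

lemma antipode_snoc: "antipode F (w @ [l]) = - (sg (par l \<and> wpar w) * antipode (\<lambda>u. F (l # u)) w)"
proof (induction w arbitrary: F)
  case (Cons a w)
  have "(\<lambda>u. sg (par a \<and> wpar (l # u)) * F ((l # u) @ [a])) =
    (\<lambda>u. s a l * (sg (par a \<and> wpar u) * F (l # u @ [a])))"
    by (intro ext) (cases "par a"; cases "par l"; simp)
  then show ?case
    unfolding append_Cons antipode.simps Cons.IH
    by (simp only: antipode_linear) (cases "par a"; cases "par l"; simp)
qed simp

lemma antipode_env:
  assumes "env F"
  shows "env (antipode F)"
proof (rule envI)
  have snoc: "env (\<lambda>u. sg (p \<and> wpar u) * F (u @ [l]))" if "env F" for F p l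
    by (rule env_sg'[OF env_suffix[OF that]])
  have "lin (\<lambda>l. antipode F (u @ l # v))" for u v
    using assms
  proof (induction u arbitrary: F)
    case Nil
    have "lin (\<lambda>l. sg (par l \<and> wpar u) * F (u @ [l]))" for u
      using lin_par[OF mlinD[OF env_mlin[OF Nil], of u "[]"], of "\<lambda>b. sg (b \<and> wpar u)"] .
    then show ?case by (simp add: lin_minus lin_antipode)
  next
    case (Cons a u)
    show ?case using Cons.IH[OF snoc[OF Cons.prems]] by (simp add: lin_minus)
  qed
  then show "mlin (antipode F)" unfolding mlin_def by blast
  fix u a b v
  show "antipode F (u @ a # b # v) = s a b * antipode F (u @ b # a # v) + antipode F (u @ br a b # v)"
    using assms
  proof (induction u arbitrary: F)
    case Nil
    have 1: "F (u @ [b, a]) = s a b * F (u @ [a, b]) + F (u @ [br b a])" for u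
      using envD[OF Nil, of u b a "[]"] by (simp add: conj_commute)
    have 2: "F (u @ [br b a]) = - s a b * F (u @ [br a b])" for u
      by (rule br_antisym[OF mlinD[OF env_mlin[OF Nil]]])
    show ?case
      unfolding append_Nil antipode.simps antipode_linear(2-4)[symmetric]
      by (intro arg_cong[where f = "\<lambda>F. antipode F v"] ext)
        (cases "par a"; cases "par b"; simp add: 1 2 algebra_simps sg_sq)
  next
    case (Cons l u)
    show ?case using Cons.IH[OF snoc[OF Cons.prems]] by (simp add: algebra_simps)
  qed
qed

lemma hat_antipode:
  assumes par: "\<And>l. par (\<delta> l) = (par l \<noteq> e)"
  shows "hat e \<delta> (antipode F) w = antipode (hat e \<delta> F) w"
proof (induction w arbitrary: F)
  case (Cons l w)
  show ?case
    unfolding hat.simps antipode.simps hat_linear Cons.IH par hat_sg'[OF par] hat_append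
      antipode_linear(2-4)[symmetric]
    by (intro arg_cong[where f = "\<lambda>F. antipode F w"] ext)
      (cases e; cases "par l"; simp add: algebra_simps sg_sq)
qed simp

text \<open>The antipode axiom: the first letter falls into either factor, and the two contributions
  are opposite.\<close>

lemma conv_antipode: "conv (\<lambda>x y. antipode (\<lambda>u. F (u @ y)) x) w = F [] * eps w"
proof (cases w)
  case (Cons l v)
  have "conv (\<lambda>x y. antipode (\<lambda>u. F (u @ y)) (l # x)) v + conv (\<lambda>x y. sg (par l \<and> wpar x) * antipode (\<lambda>u. F (u @ l # y)) x) v = 0"
    unfolding conv_linear(2)[symmetric] by (simp add: antipode_sg conv_linear)
  then show ?thesis by (simp add: Cons)
qed simp

lemma conv_eps: "conv (\<lambda>u v. eps u * A v) w = A w"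
proof (induction w arbitrary: A)
  case (Cons l w)
  have "(\<lambda>u v. sg (par l \<and> wpar u) * (eps u * A (l # v))) = (\<lambda>u v. eps u * A (l # v))"
    by (intro ext) (simp add: eps_def)
  then show ?case by (simp add: conv_linear Cons.IH)
qed simp

context
  fixes \<sigma> :: "'l \<Rightarrow> 'l"
  assumes par_\<sigma>: "\<And>l. par (\<sigma> l) = (\<not> par l)"
    and lin_\<sigma>: "\<And>\<phi>. lin \<phi> \<Longrightarrow> lin (\<lambda>l. \<phi> (\<sigma> l))"
begin

lemma contr_0: "contr \<sigma> (\<lambda>w. 0) = (\<lambda>w. 0)"
  using contr_diff[OF par_\<sigma> lin_\<sigma> env_0 env_0, of 1] by simp

lemma contr_add_mult:
  "env F \<Longrightarrow> env G \<Longrightarrow> contr \<sigma> (\<lambda>w. F w + k * G w) = (\<lambda>w. contr \<sigma> F w + k * contr \<sigma> G w)"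
  using contr_diff[OF par_\<sigma> lin_\<sigma>, of F G "- k"] by simp

lemma contr_add:
  "env F \<Longrightarrow> env G \<Longrightarrow> contr \<sigma> (\<lambda>w. F w + G w) = (\<lambda>w. contr \<sigma> F w + contr \<sigma> G w)"
  using contr_add_mult[of F G 1] by simp

text \<open>As \<open>contr\<close> is a definite description, each relation in \<open>z\<close> is
  read as an identity between functionals in \<open>x\<close> and pushed through the linearity of
  \<open>contr\<close>.\<close>

lemma contr_param:
  assumes F: "\<And>z. env (F z)" and "\<And>x. env (\<lambda>z. F z x)"
  shows "env (\<lambda>z. contr \<sigma> (F z) x)"
proof (rule envI)
  have "(\<Sum>p\<leftarrow>r. fst p * contr \<sigma> (F (u @ snd p # v)) x) = 0" if r: "r \<in> Rel" for r u v
  proof -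
    have env: "env (\<lambda>x. \<Sum>p\<leftarrow>r. fst p * F (u @ snd p # v) x)" for r
      by (induction r) (simp_all add: env_0 env_add env_mult F)
    have "(\<Sum>p\<leftarrow>r. fst p * contr \<sigma> (F (u @ snd p # v)) x) =
      contr \<sigma> (\<lambda>x. \<Sum>p\<leftarrow>r. fst p * F (u @ snd p # v) x) x" for r
    proof (induction r)
      case (Cons p r)
      then show ?case
        using contr_add_mult[OF env F, of r "fst p" "u @ snd p # v"] by (simp add: add.commute)
    qed (simp add: contr_0)
    moreover have "(\<lambda>x. \<Sum>p\<leftarrow>r. fst p * F (u @ snd p # v) x) = (\<lambda>x. 0)"
      using mlinD[OF env_mlin[OF assms(2)]] r by (auto simp: lin_def)
    ultimately show ?thesis by (simp add: contr_0)
  qed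
  then show "mlin (\<lambda>z. contr \<sigma> (F z) x)" by (simp add: mlin_def lin_def)
  fix u a b v
  have "F (u @ a # b # v) = (\<lambda>x. F (u @ br a b # v) x + s a b * F (u @ b # a # v) x)"
    using envD[OF assms(2), of u a b v] by (auto simp: add.commute)
  then show "contr \<sigma> (F (u @ a # b # v)) x = s a b * contr \<sigma> (F (u @ b # a # v)) x + contr \<sigma> (F (u @ br a b # v)) x"
    by (simp add: contr_add_mult F)
qed

lemma contr_hat_param:
  assumes "\<And>z. env (F z)"
  shows "hat e \<delta> (\<lambda>z. contr \<sigma> (F z) x) z = contr \<sigma> (\<lambda>x. hat e \<delta> (\<lambda>z. F z x) z) x"
    and "env (\<lambda>x. hat e \<delta> (\<lambda>z. F z x) z)"
proof -
  have "env (\<lambda>x. hat e \<delta> (\<lambda>z. F z x) z) \<and>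
    (\<forall>x. hat e \<delta> (\<lambda>z. contr \<sigma> (F z) x) z = contr \<sigma> (\<lambda>x. hat e \<delta> (\<lambda>z. F z x) z) x)"
    using assms
  proof (induction z arbitrary: F)
    case Nil
    show ?case by (simp add: contr_0 env_0)
  next
    case (Cons l z)
    from Cons.IH[of "\<lambda>z. F (l # z)"] Cons.prems show ?case
      by (simp add: contr_add_mult env_add env_mult)
  qed
  then show "hat e \<delta> (\<lambda>z. contr \<sigma> (F z) x) z = contr \<sigma> (\<lambda>x. hat e \<delta> (\<lambda>z. F z x) z) x"
    and "env (\<lambda>x. hat e \<delta> (\<lambda>z. F z x) z)" by auto
qed

end

section \<open>The homotopy from the identity to an endomorphism\<close>

context
  fixes r :: "'l \<Rightarrow> 'l"
  assumes par_r: "\<And>l. par (r l) = par l"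
    and lin_r: "\<And>\<phi>. lin \<phi> \<Longrightarrow> lin (\<lambda>l. \<phi> (r l))"
    and br_r: "\<And>\<phi> a b. lin \<phi> \<Longrightarrow> \<phi> (r (br a b)) = \<phi> (br (r a) (r b))"
begin

lemma wpar_map: "wpar (map r w) = wpar w"
  by (induction w) (simp_all add: par_r)

lemma env_map:
  assumes "env F"
  shows "env (\<lambda>w. F (map r w))"
proof (rule envI)
  have "lin (\<lambda>l. F (map r (u @ l # v)))" for u v
    using lin_r[OF mlinD[OF env_mlin[OF assms], of "map r u" "map r v"]] by simp
  then show "mlin (\<lambda>w. F (map r w))" unfolding mlin_def by blast
  fix u a b v
  show "F (map r (u @ a # b # v)) = s a b * F (map r (u @ b # a # v)) + F (map r (u @ br a b # v))"
    using envD[OF assms, of "map r u" "r a" "r b" "map r v"]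
      br_r[OF mlinD[OF env_mlin[OF assms], of "map r u" "map r v"], of a b] by (simp add: par_r)
qed

lemma hat_map:
  assumes "mlin F" and \<delta>: "\<And>\<phi> l. lin \<phi> \<Longrightarrow> \<phi> (r (\<delta> l)) = \<phi> (\<delta> (r l))"
  shows "hat e \<delta> (\<lambda>w. F (map r w)) w = hat e \<delta> F (map r w)"
  using assms(1)
proof (induction w arbitrary: F)
  case (Cons l w)
  then show ?case
    using Cons.IH[OF mlin_Cons[OF Cons.prems], of "r l"] \<delta>[OF mlinD_Cons[OF Cons.prems], of l "map r w"]
    by (simp add: par_r)
qed simp

text \<open>
  The convolution of the identity with \<open>S \<circ> r\<close>, as an operation on functionals.  Its values are killed
  by right multiplication with the fixed points of \<open>r\<close>.
\<close>

definition basic :: "('l list \<Rightarrow> 'k) \<Rightarrow> 'l list \<Rightarrow> 'k"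
  where "basic a w = conv (\<lambda>u v. antipode (\<lambda>x. a (u @ x)) (map r v)) w"

lemma basic_linear:
  "basic (\<lambda>w. 0) w = 0"
  "basic (\<lambda>w. F w + G w) w = basic F w + basic G w"
  "basic (\<lambda>w. k * F w) w = k * basic F w"
  "basic (\<lambda>w. - F w) w = - basic F w"
  "basic (\<lambda>w. F w - G w) w = basic F w - basic G w"
  by (simp_all add: basic_def conv_linear antipode_linear)

lemma basic_param: "(\<And>x. env (\<lambda>z. A z x)) \<Longrightarrow> env (\<lambda>z. basic (A z) w)"
  by (simp add: basic_def conv_param antipode_param)

lemma basic_env: "env a \<Longrightarrow> env (basic a)"
  unfolding basic_def[abs_def]
  by (rule conv_env) (auto simp: env2_def intro!: antipode_param env_suffix env_map antipode_env env_append[of a _ "[]", simplified])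

text \<open>A fixed letter at the end lands either in the left factor or, through \<open>r\<close>,
  in the antipode. The latter puts it directly behind the left factor with the opposite sign, so the
  two terms cancel.\<close>

lemma basic_snoc: "r g = g \<Longrightarrow> basic a (w @ [g]) = 0"
  unfolding basic_def conv_snoc conv_linear(2)[symmetric]
  by (simp add: antipode_snoc wpar_map conv_linear)

lemma basic_sg: "basic (\<lambda>w. sg (wpar w) * a w) w = sg (wpar w) * basic a w"
proof -
  have "antipode (\<lambda>x. sg (wpar (u @ x)) * a (u @ x)) v = sg (wpar u \<noteq> wpar v) * antipode (\<lambda>x. a (u @ x)) v" for u v
    using antipode_sg[of True "\<lambda>x. - sg (wpar u) * a (u @ x)" v] 
    by (simp add: sg_eq antipode_linear algebra_simps)
  then show ?thesis
    using conv_sg[of True "\<lambda>u v. antipode (\<lambda>x. a (u @ x)) (map r v)" w] by (simp add: basic_def wpar_map)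
qed

lemma basic_eps: "basic eps w = eps w"
proof -
  have "antipode (\<lambda>x. eps (u @ x)) v = eps u * eps v" for u v
    by (cases u; cases v) (simp_all add: antipode_linear)
  then have "basic eps w = conv (\<lambda>u v. eps u * eps (map r v)) w" by (simp add: basic_def)
  also have "\<dots> = eps w" unfolding conv_eps by (simp add: eps_def)
  finally show ?thesis .
qed

lemma hat_basic:
  assumes a: "env a" and par: "\<And>l. par (\<delta> l) = (par l \<noteq> e)"
    and \<delta>: "\<And>\<phi> l. lin \<phi> \<Longrightarrow> \<phi> (r (\<delta> l)) = \<phi> (\<delta> (r l))"
  shows "hat e \<delta> (basic a) w = basic (hat e \<delta> a) w"
proof -
  have 1: "hat e \<delta> (\<lambda>u. antipode (B u) w) u = antipode (\<lambda>x. hat e \<delta> (\<lambda>u. B u x) u) w" for B u w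
    by (induction w arbitrary: B) (simp_all add: hat_linear)
  have 2: "hat e \<delta> (\<lambda>v. antipode (\<lambda>x. a (u @ x)) (map r v)) v = antipode (hat e \<delta> (\<lambda>x. a (u @ x))) (map r v)" for u v
    using env_append[OF a, of u "[]"]
    by (simp add: hat_map \<delta> env_mlin antipode_env hat_antipode[OF par])
  show ?thesis
    unfolding basic_def[abs_def] hat_conv[OF par] 1 2 hat_append
    by (simp add: antipode_linear)
qed

context
  fixes \<sigma> :: "'l \<Rightarrow> 'l"
  assumes par_\<sigma>: "\<And>l. par (\<sigma> l) = (\<not> par l)"
    and lin_\<sigma>: "\<And>\<phi>. lin \<phi> \<Longrightarrow> lin (\<lambda>l. \<phi> (\<sigma> l))"
begin

text \<open>
  As \<open>id = (id \<star> S r) \<star> r\<close>, contracting the first factor yields a homotopy from the identity to \<open>r\<close>.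
\<close>

definition hcontr :: "('l list \<Rightarrow> 'k) \<Rightarrow> 'l list \<Rightarrow> 'k"
  where "hcontr F w = conv (\<lambda>u z. basic (contr \<sigma> (\<lambda>x. F (x @ map r z))) u) w"

lemma hcontr_env:
  assumes "env F"
  shows "env (hcontr F)"
proof -
  have 1: "env (\<lambda>x. F (x @ y))" for y by (rule env_suffix[OF assms])
  have 2: "env (\<lambda>z. F (x @ map r z))" for x
    using env_map[OF env_append[OF assms, of x "[]"]] by simp
  have "env2 (\<lambda>u z. basic (contr \<sigma> (\<lambda>x. F (x @ map r z))) u)"
    unfolding env2_def by (intro conjI allI basic_env basic_param env_contr contr_param[OF par_\<sigma> lin_\<sigma>] 1 2 par_\<sigma> lin_\<sigma>)
  then show ?thesis unfolding hcontr_def[abs_def] by (rule conv_env)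
qed

lemma hcontr_add:
  assumes "env F" "env G"
  shows "hcontr (\<lambda>w. F w + G w) w = hcontr F w + hcontr G w"
  by (simp add: hcontr_def contr_add[OF par_\<sigma> lin_\<sigma>] env_suffix assms basic_linear conv_linear)

text \<open>The last letter falls into the first factor, where \<open>basic\<close> kills it, or
  into the second, where it stays at the end of the argument of \<open>F\<close>. The first case
  works because \<open>basic\<close> is applied after the contraction.\<close>

lemma hcontr_snoc:
  assumes "r g = g" and "\<And>w. F (w @ [g]) = 0"
  shows "hcontr F (w @ [g]) = 0"
proof -
  have "F (x @ y @ [g]) = 0" for x y using assms(2)[of "x @ y"] by simp
  then show ?thesis
    by (simp add: hcontr_def conv_snoc basic_snoc assms contr_0[OF par_\<sigma> lin_\<sigma>] basic_linear conv_linear)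
qed

text \<open>The terms with \<open>\<delta>\<close> on the second factor cancel because the
  contraction is odd, and \<open>hat_contr\<close> applies to the first factor. Its
  \<open>eps\<close> defect becomes the value on \<open>map r w\<close>.\<close>

lemma hat_hcontr:
  assumes F: "env F" and par: "\<And>l. par (\<delta> l) = (\<not> par l)"
    and lin: "\<And>\<phi>. lin \<phi> \<Longrightarrow> lin (\<lambda>l. \<phi> (\<delta> l))"
    and der: "\<And>\<phi> a b. lin \<phi> \<Longrightarrow> \<phi> (\<delta> (br a b)) = \<phi> (br (\<delta> a) b) + sg (par a) * \<phi> (br a (\<delta> b))"
    and comm: "\<And>\<phi> l. lin \<phi> \<Longrightarrow> \<phi> (\<delta> (\<sigma> l)) + \<phi> (\<sigma> (\<delta> l)) = k * \<phi> l"
    and r: "\<And>\<phi> l. lin \<phi> \<Longrightarrow> \<phi> (r (\<delta> l)) = \<phi> (\<delta> (r l))"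
  shows "hat True \<delta> (hcontr F) w + hcontr (hat True \<delta> F) w = k * (F w - F (map r w))"
proof -
  let ?F = "\<lambda>z x. F (x @ map r z)"
  let ?A = "\<lambda>z. contr \<sigma> (?F z)"
  have par': "\<And>l. par (\<delta> l) = (par l \<noteq> True)" by (simp add: par)
  have env_F: "env (?F z)" for z by (rule env_suffix[OF F])
  have env_dF: "env (hat True \<delta> (?F z))" for z by (rule hat_env[OF env_F]) (simp_all add: par lin der)
  have env_A: "env (?A z)" for z by (rule env_contr[OF env_F par_\<sigma> lin_\<sigma>])
  have basic_hat: "hat True \<delta> (\<lambda>z. basic (B z) u) z = basic (\<lambda>x. hat True \<delta> (\<lambda>z. B z x) z) u" for B u z
    by (induction z arbitrary: B) (simp_all add: basic_linear)
  have 1: "hat True \<delta> (hcontr F) w = conv (\<lambda>u z. basic (hat True \<delta> (?A z)) u +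
      sg (wpar u) * basic (contr \<sigma> (\<lambda>x. hat True \<delta> (\<lambda>z. ?F z x) z)) u) w"
    unfolding hcontr_def[abs_def] hat_conv[OF par'] basic_hat
    by (simp add: hat_basic[OF env_A par' r] contr_hat_param(1)[OF par_\<sigma> lin_\<sigma> env_F])
  have 2: "contr \<sigma> (\<lambda>x. hat True \<delta> F (x @ map r z)) = (\<lambda>x. contr \<sigma> (hat True \<delta> (?F z)) x -
      sg (wpar x) * contr \<sigma> (\<lambda>x. hat True \<delta> (\<lambda>z. ?F z x) z) x)" for z
  proof -
    have "hat True \<delta> (\<lambda>y. F (x @ y)) (map r z) = hat True \<delta> (\<lambda>z. ?F z x) z" for x
      using hat_map[of "\<lambda>y. F (x @ y)" \<delta> True z] mlin_append[OF env_mlin[OF F], of x "[]"] r by simp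
    then have "(\<lambda>x. hat True \<delta> F (x @ map r z)) =
        (\<lambda>x. hat True \<delta> (?F z) x + sg (wpar x) * hat True \<delta> (\<lambda>z. ?F z x) z)"
      by (simp add: hat_append)
    then show ?thesis
      by (simp add: contr_add[OF par_\<sigma> lin_\<sigma>] env_dF env_sg contr_hat_param(2)[OF par_\<sigma> lin_\<sigma> env_F] contr_sg[OF par_\<sigma> lin_\<sigma>])
  qed
  have 3: "hcontr (hat True \<delta> F) w = conv (\<lambda>u z. basic (contr \<sigma> (hat True \<delta> (?F z))) u -
      sg (wpar u) * basic (contr \<sigma> (\<lambda>x. hat True \<delta> (\<lambda>z. ?F z x) z)) u) w"
    unfolding hcontr_def 2 by (simp add: basic_linear basic_sg)
  have 4: "basic (hat True \<delta> (?A z)) u + basic (contr \<sigma> (hat True \<delta> (?F z))) u =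
      k * (basic (?F z) u - eps u * F (map r z))" for u z
    unfolding basic_linear(2)[symmetric]
    by (simp add: hat_contr[OF par_\<sigma> lin_\<sigma> env_F par lin der comm] basic_linear basic_eps)
  have "hat True \<delta> (hcontr F) w + hcontr (hat True \<delta> F) w =
      conv (\<lambda>u z. k * (basic (?F z) u - eps u * F (map r z))) w"
    unfolding 1 3 conv_linear(2)[symmetric] 4[symmetric] by simp
  also have "\<dots> = k * (conv (\<lambda>u z. basic (?F z) u) w - F (map r w))"
    by (simp add: conv_linear conv_eps)
  \<comment> \<open>By coassociativity the antipode meets the last factor, where
    \<open>conv_antipode\<close> reduces both to \<open>eps\<close>; \<open>r\<close> commutes with
    the coproduct.\<close>
  also have "conv (\<lambda>u z. basic (?F z) u) w = F w"
  proof -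
    have "conv (\<lambda>u z. basic (?F z) u) w =
      conv (\<lambda>x v. conv (\<lambda>y z. antipode (\<lambda>t. F (x @ t @ map r z)) (map r y)) v) w"
      unfolding basic_def by (simp add: conv_assoc)
    also have "\<dots> = conv (\<lambda>x v. F x * eps v) w"
    proof -
      have conv_map: "conv (\<lambda>y z. \<Phi> (map r y) (map r z)) v = conv \<Phi> (map r v)" for \<Phi> v
      proof (induction v arbitrary: \<Phi>)
        case (Cons l v)
        show ?case
          using Cons.IH[of "\<lambda>u v. \<Phi> (r l # u) v"]
            Cons.IH[of "\<lambda>u v. sg (par l \<and> wpar u) * \<Phi> u (r l # v)"]
          by (simp add: par_r wpar_map)
      qed simp
      show ?thesis
        using conv_antipode[of "\<lambda>t. F (x @ t)" for x]
          conv_map[of "\<lambda>y z. antipode (\<lambda>t. F (x @ t @ z)) y" for x] by (simp add: eps_def)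
    qed
    also have "\<dots> = F w"
      by (induction w arbitrary: F) (simp_all add: conv_linear)
    finally show ?thesis .
  qed
  finally show ?thesis .
qed

end

end

section \<open>Functionals on sorted words\<close>

text \<open>The scalar is a Koszul sign; only its existence matters, since this serves to prove
  vanishing.\<close>

lemma sym_filter:
  assumes "gsym F"
  shows "\<exists>c. F w = c * F (filter Q w @ filter (\<lambda>l. \<not> Q l) w)"
  using assms
proof (induction w arbitrary: F)
  case Nil
  show ?case by (rule exI[of _ 1]) simp
next
  case (Cons l w)
  obtain c where c: "F (l # w) = c * F (l # filter Q w @ filter (\<lambda>l. \<not> Q l) w)"
    using Cons.IH[OF sym_Cons[OF Cons.prems]] by blast
  have move: "\<exists>c. F (l # u @ v) = c * F (u @ l # v)" if "gsym F" for F u v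
    using that
  proof (induction u arbitrary: F)
    case Nil
    show ?case by (rule exI[of _ 1]) simp
  next
    case (Cons a u)
    obtain c where "F (a # l # u @ v) = c * F (a # u @ l # v)"
      using Cons.IH[OF sym_Cons[OF Cons.prems]] by blast
    then have "F (l # a # u @ v) = (s l a * c) * F (a # u @ l # v)"
      using symD[OF Cons.prems, of l a] by simp
    then show ?case by auto
  qed
  show ?case
  proof (cases "Q l")
    case True
    then show ?thesis using c by auto
  next
    case False
    obtain c' where "F (l # filter Q w @ filter (\<lambda>l. \<not> Q l) w) = c' * F (filter Q w @ l # filter (\<lambda>l. \<not> Q l) w)"
      using move[OF Cons.prems] by blast
    with c have "F (l # w) = (c * c') * F (filter Q w @ l # filter (\<lambda>l. \<not> Q l) w)" by simp
    with False show ?thesis by auto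
  qed
qed

text \<open>Sorted words span the enveloping algebra: reordering costs only shorter words, on which
  \<open>F\<close> vanishes by induction.\<close>

lemma env_sorted_eq_0:
  assumes "env F"
    and "\<And>u v. (\<forall>l\<in>set u. Q l) \<Longrightarrow> (\<forall>l\<in>set v. \<not> Q l) \<Longrightarrow> F (u @ v) = 0"
  shows "F w = 0"
proof (induction w rule: length_induct)
  case (1 w)
  let ?G = "\<lambda>v. if length v = length w then F v else 0"
  have "gsym ?G"
  proof (rule symI)
    fix u a b v
    have "F (u @ br a b # v) = 0" if "length (u @ a # b # v) = length w"
      using 1 that by simp
    then show "?G (u @ a # b # v) = s a b * ?G (u @ b # a # v)"
      using envD[OF assms(1), of u a b v] by auto
  qed
  then obtain c where "?G w = c * ?G (filter Q w @ filter (\<lambda>l. \<not> Q l) w)"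
    using sym_filter by blast
  moreover have "F (filter Q w @ filter (\<lambda>l. \<not> Q l) w) = 0"
    by (rule assms(2)) auto
  ultimately show ?case by (auto split: if_splits)
qed

text \<open>Carried to the right end \<open>y\<close> is killed, so only its brackets with the
  letters that it passes remain. This is how an operator on single letters produces brackets of
  cochain arguments.\<close>

lemma env_move_right:
  assumes "env F" and "\<And>w. F (w @ [y]) = 0"
  shows "F (u @ y # v) = hat (par y) (br y) (\<lambda>v. F (u @ v)) v"
proof (induction v arbitrary: u)
  case Nil
  show ?case using assms(2) by simp
next
  case (Cons a v)
  show ?case
    using envD[OF assms(1), of u y a v] Cons.IH[of "u @ [a]"] by simp
qed

lemma hat_param:
  assumes "\<And>x. env (\<lambda>z. F z x)"
  shows "env (\<lambda>z. hat e \<delta> (F z) w)"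
  using assms by (induction w arbitrary: F) (simp_all add: env_0 env_add env_mult)

lemma hat_sum:
  "hat e \<delta> F w = (\<Sum>r<length w. sg (e \<and> wpar (take r w)) * F (w[r := \<delta> (w ! r)]))"
proof (induction w arbitrary: F)
  case (Cons l w)
  have "sg (e \<and> wpar (take (Suc r) (l # w))) = (sg (e \<and> par l) * sg (e \<and> wpar (take r w)) :: 'k)" for r
    by (cases e; cases "par l"; simp)
  then show ?case
    unfolding list.size add_Suc_right add_0_right sum.lessThan_Suc_shift
    by (simp add: Cons.IH sum_distrib_left mult.assoc)
qed simp

lemma sym_sg':
  assumes "gsym F"
  shows "gsym (\<lambda>w. sg (p \<and> wpar w) * F w)"
proof (rule symI)
  fix u a b v
  have "wpar (u @ a # b # v) = wpar (u @ b # a # v)" by auto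
  then show "sg (p \<and> wpar (u @ a # b # v)) * F (u @ a # b # v) =
      s a b * (sg (p \<and> wpar (u @ b # a # v)) * F (u @ b # a # v))"
    using symD_append[OF assms, of u a b v] by (simp only: mult.left_commute)
qed

lemma mlin_sg':
  assumes "mlin F"
  shows "mlin (\<lambda>w. sg (p \<and> wpar w) * F w)"
proof -
  have "lin (\<lambda>l. sg (p \<and> wpar (u @ l # v)) * F (u @ l # v))" for u v
    using lin_par[OF mlinD[OF assms, of u v], of "\<lambda>b. sg (p \<and> (wpar u \<noteq> (b \<noteq> wpar v)))"] by simp
  then show ?thesis unfolding mlin_def by blast
qed

text \<open>
  When the letters satisfying \<open>Q\<close> commute and the others form a subalgebra, the enveloping algebra
  is the symmetric algebra on the former tensored with the enveloping algebra of the latter, and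
  \<open>f g u\<close> is the value of a functional on \<open>g @ u\<close>.
\<close>

definition sym_env :: "('l list \<Rightarrow> 'l list \<Rightarrow> 'k) \<Rightarrow> bool"
  where "sym_env f \<longleftrightarrow> (\<forall>u. gsym (\<lambda>g. f g u) \<and> mlin (\<lambda>g. f g u)) \<and> (\<forall>g. env (f g))"

context
  fixes Q :: "'l \<Rightarrow> bool"
  assumes Q_br: "\<And>a b. Q (br a b) = (Q a \<noteq> Q b)"
    and Q_zero: "\<And>\<phi> a b. lin \<phi> \<Longrightarrow> Q a \<Longrightarrow> Q b \<Longrightarrow> \<phi> (br a b) = 0"
    and lin_Q: "\<And>\<phi>. lin \<phi> \<Longrightarrow> lin (\<lambda>l. if Q l then \<phi> l else 0)"
begin

text \<open>
  \<open>act l f\<close> is the functional whose value on \<open>g @ u\<close> is the value of \<open>f\<close> on \<open>l # g @ u\<close>, after moving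
  \<open>l\<close> past \<open>g\<close> unless \<open>Q l\<close>.
\<close>

definition act :: "'l \<Rightarrow> ('l list \<Rightarrow> 'l list \<Rightarrow> 'k) \<Rightarrow> 'l list \<Rightarrow> 'l list \<Rightarrow> 'k"
  where "act l f = (if Q l then (\<lambda>g u. f (l # g) u)
    else (\<lambda>g u. hat (par l) (br l) (\<lambda>g. f g u) g + sg (par l \<and> wpar g) * f g (l # u)))"

text \<open>Letters act from first to last, and evaluation at two empty words pairs the result with
  the unit. By \<open>act_rel\<close> the outcome depends only on the product of the letters in the
  enveloping algebra.\<close>

primrec lift :: "('l list \<Rightarrow> 'l list \<Rightarrow> 'k) \<Rightarrow> 'l list \<Rightarrow> 'k" where
  "lift f [] = f [] []"
| "lift f (l # w) = lift (act l f) w"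

lemma lift_add: "lift (\<lambda>g u. f g u + h g u) w = lift f w + lift h w"
proof (induction w arbitrary: f h)
  case (Cons l w)
  have "act l (\<lambda>g u. f g u + h g u) = (\<lambda>g u. act l f g u + act l h g u)"
    by (intro ext) (simp add: act_def hat_linear algebra_simps)
  then show ?case by (simp add: Cons.IH)
qed simp

lemma lift_mult: "lift (\<lambda>g u. k * f g u) w = k * lift f w"
proof (induction w arbitrary: f)
  case (Cons l w)
  have "act l (\<lambda>g u. k * f g u) = (\<lambda>g u. k * act l f g u)"
    by (intro ext) (simp add: act_def hat_linear algebra_simps)
  then show ?case by (simp add: Cons.IH)
qed simp

lemma lin_if_Q: "lin \<phi> \<Longrightarrow> lin \<psi> \<Longrightarrow> lin (\<lambda>l. if Q l then \<phi> l else \<psi> l)"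
proof -
  assume "lin \<phi>" "lin \<psi>"
  then have "lin (\<lambda>l. (if Q l then \<phi> l else 0) + (\<psi> l - (if Q l then \<psi> l else 0)))"
    by (intro lin_add lin_diff lin_Q)
  moreover have "(\<lambda>l. (if Q l then \<phi> l else 0) + (\<psi> l - (if Q l then \<psi> l else 0))) =
      (\<lambda>l. if Q l then \<phi> l else \<psi> l)" by auto
  ultimately show ?thesis by (rule back_subst)
qed

lemma lin_lift: "(\<And>g u. lin (\<lambda>l. f l g u)) \<Longrightarrow> lin (\<lambda>l. lift (f l) w)"
proof (induction w arbitrary: f)
  case (Cons a w)
  have "lin (\<lambda>l. act a (f l) g u)" for g u
    using Cons.prems by (cases "Q a") (simp_all add: act_def lin_add lin_mult lin_hat)
  then show ?case by (simp add: Cons.IH)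
qed simp

lemma lin_act:
  assumes "sym_env f"
  shows "lin (\<lambda>l. act l f g u)"
proof -
  have hat: "lin (\<lambda>l. hat (par l) (br l) F g)" if "mlin F" for F g
    using that
  proof (induction g arbitrary: F)
    case (Cons a g)
    have "lin (\<lambda>l. F (br l a # g))" by (rule lin_br_left[OF mlinD_Cons[OF Cons.prems]])
    then show ?case by (simp add: lin_add lin_s Cons.IH mlin_Cons[OF Cons.prems])
  qed simp
  have "lin (\<lambda>l. sg (par l \<and> wpar g) * f g (l # u))"
    using lin_par[of "\<lambda>l. f g (l # u)" "\<lambda>b. sg (b \<and> wpar g)"] assms mlinD_Cons env_mlin
    unfolding sym_env_def by blast
  moreover have "lin (\<lambda>l. f (l # g) u)" using assms mlinD_Cons[of "\<lambda>g. f g u"] unfolding sym_env_def by blast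
  moreover have "lin (\<lambda>l. hat (par l) (br l) (\<lambda>g. f g u) g)" using assms hat unfolding sym_env_def by blast
  ultimately have "lin (\<lambda>l. if Q l then f (l # g) u else
      hat (par l) (br l) (\<lambda>g. f g u) g + sg (par l \<and> wpar g) * f g (l # u))"
    by (intro lin_if_Q lin_add)
  moreover have "(\<lambda>l. act l f g u) = (\<lambda>l. if Q l then f (l # g) u else
      hat (par l) (br l) (\<lambda>g. f g u) g + sg (par l \<and> wpar g) * f g (l # u))"
    by (auto simp: act_def)
  ultimately show ?thesis by simp
qed

lemma sym_env_act:
  assumes "sym_env f"
  shows "sym_env (act l f)"
proof (cases "Q l")
  case True
  then show ?thesis
    using assms sym_Cons[of "\<lambda>g. f g _" l] mlin_Cons[of "\<lambda>g. f g _" l]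
    unfolding sym_env_def act_def by simp
next
  case False
  have "gsym (\<lambda>g. hat (par l) (br l) (\<lambda>g. f g u) g + sg (par l \<and> wpar g) * f g (l # u))" for u
    using assms unfolding sym_env_def by (intro sym_add hat_sym sym_sg') auto
  moreover have "mlin (\<lambda>g. hat (par l) (br l) (\<lambda>g. f g u) g + sg (par l \<and> wpar g) * f g (l # u))" for u
    using assms unfolding sym_env_def by (intro mlin_add hat_mlin mlin_sg' lin_br_right) auto
  moreover have "env (\<lambda>u. hat (par l) (br l) (\<lambda>g. f g u) g + sg (par l \<and> wpar g) * f g (l # u))" for g
    using assms unfolding sym_env_def by (intro env_add env_mult hat_param env_Cons) auto
  ultimately show ?thesis using False unfolding sym_env_def act_def by simp
qed

text \<open>For two letters in \<open>Q\<close> this is the symmetry of \<open>f\<close>. In the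
  mixed case the bracket lies in \<open>Q\<close> and is the term where the adjoint action hits the
  added letter. For two other letters the adjoint actions commute up to the bracket by Jacobi, and
  \<open>f g\<close> satisfies the relation on \<open>u\<close>.\<close>

lemma act_rel:
  assumes f: "sym_env f"
  shows "act b (act a f) g u = s a b * act a (act b f) g u + act (br a b) f g u"
proof -
  have lin: "lin (\<lambda>l. f (l # g) u)" for g u using f mlinD_Cons[of "\<lambda>g. f g u"] unfolding sym_env_def by blast
  note anti = br_antisym[OF lin, of b a g u]
  consider "Q a" "Q b" | "Q a" "\<not> Q b" | "\<not> Q a" "Q b" | "\<not> Q a" "\<not> Q b" by blast
  then show ?thesis
  proof cases
    case 1
    then have "act (br a b) f g u = 0" by (intro Q_zero[OF lin_act[OF f]])
    moreover have "f (a # b # g) u = s a b * f (b # a # g) u"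
      using f symD[of "\<lambda>g. f g u"] unfolding sym_env_def by blast
    ultimately show ?thesis using 1 by (simp add: act_def)
  next
    case 2
    then show ?thesis using anti
      by (cases "par a"; cases "par b"; simp add: act_def Q_br algebra_simps)
  next
    case 3
    then show ?thesis using anti
      by (cases "par a"; cases "par b"; simp add: act_def Q_br algebra_simps)
  next
    case 4
    have com: "hat (par b) (br b) (hat (par a) (br a) (\<lambda>g. f g u)) g -
        sg (par b \<and> par a) * hat (par a) (br a) (hat (par b) (br b) (\<lambda>g. f g u)) g =
      1 * hat (par b \<noteq> par a) (br (br a b)) (\<lambda>g. f g u) g"
    proof (rule hat_commutator)
      show "\<phi> (br a (br b l)) - sg (par b \<and> par a) * \<phi> (br b (br a l)) = 1 * \<phi> (br (br a b) l)"
        if "lin \<phi>" for \<phi> l using br_jacobi[OF that, of a b l] by (simp add: conj_commute)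
      show "mlin (\<lambda>g. f g u)" using f unfolding sym_env_def by blast
    qed auto
    have rel: "f g (a # b # u) = s a b * f g (b # a # u) + f g (br a b # u)"
      using f envD_Cons unfolding sym_env_def by blast
    have tw: "hat (par b) (br b) (\<lambda>g. sg (par a \<and> wpar g) * f g (a # u)) g =
        sg (par a \<and> (wpar g \<noteq> par b)) * hat (par b) (br b) (\<lambda>g. f g (a # u)) g" for a b
      by (rule hat_sg') auto
    have op2: "act b (act a f) g u =
        hat (par b) (br b) (\<lambda>g. hat (par a) (br a) (\<lambda>g. f g u) g + sg (par a \<and> wpar g) * f g (a # u)) g +
        sg (par b \<and> wpar g) * (hat (par a) (br a) (\<lambda>g. f g (b # u)) g + sg (par a \<and> wpar g) * f g (a # b # u))"
      if "\<not> Q a" "\<not> Q b" for a b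
      using that by (simp add: act_def)
    have "act (br a b) f g u =
        hat (par (br a b)) (br (br a b)) (\<lambda>g. f g u) g + sg (par (br a b) \<and> wpar g) * f g (br a b # u)"
      using 4 by (simp add: act_def Q_br)
    then show ?thesis
      using com unfolding op2[OF 4] op2[OF 4(2,1)] hat_linear tw rel
      by (cases "par a"; cases "par b"; simp add: algebra_simps sg_sq)
  qed
qed

lemma lift_env: "sym_env f \<Longrightarrow> env (lift f)"
proof (rule envI)
  assume f: "sym_env f"
  have "lin (\<lambda>l. lift f (u @ l # v))" for u v
    using f
  proof (induction u arbitrary: f)
    case Nil
    then show ?case by (simp add: lin_lift lin_act)
  next
    case (Cons a u)
    then show ?case by (simp add: sym_env_act)
  qed
  then show "mlin (lift f)" unfolding mlin_def by blast
  fix u a b v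
  show "lift f (u @ a # b # v) = s a b * lift f (u @ b # a # v) + lift f (u @ br a b # v)"
    using f
  proof (induction u arbitrary: f)
    case Nil
    have "act b (act a f) = (\<lambda>g u. s a b * act a (act b f) g u + act (br a b) f g u)"
      by (intro ext) (rule act_rel[OF Nil])
    then show ?case by (simp add: lift_add lift_mult)
  next
    case (Cons l u)
    then show ?case by (simp add: sym_env_act)
  qed
qed

lemma lift_sorted:
  "(\<forall>l\<in>set g. Q l) \<Longrightarrow> (\<forall>l\<in>set u. \<not> Q l) \<Longrightarrow> lift f (g @ u) = f g u"
proof (induction g arbitrary: f)
  case Nil
  then show ?case
  proof (induction u arbitrary: f)
    case (Cons l u)
    then have "lift f ([] @ l # u) = act l f [] u" by simp
    with Cons.prems show ?case by (simp add: act_def)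
  qed simp
next
  case (Cons l g)
  then have "lift f ((l # g) @ u) = act l f g u" by simp
  with Cons.prems show ?case by (simp add: act_def)
qed

end

end

section \<open>The cone of a dgla\<close>

lemma powi_sg: "(- 1) powi i = (sg (odd i) :: 'k::field)"
proof (cases "even i")
  case True
  then show ?thesis using power_int_minus_left_even[of i "1 :: 'k"] by simp
next
  case False
  then show ?thesis using power_int_minus_left_odd[of i "1 :: 'k"] by simp
qed

lemma sum_list_take: "q \<le> length w \<Longrightarrow> (\<Sum>k<q. f (w ! k)) = (\<Sum>p\<leftarrow>take q w. f p)"
  by (simp add: sum_list_sum_nth atLeast0LessThan)

lemma sum_pairs:
  "(\<Sum>p<n. \<Sum>k<n - Suc p. T p (Suc p + k)) = (\<Sum>(p, q)\<in>{(p, q). p < q \<and> q < (n :: nat)}. T p q)"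
proof -
  have "(\<Sum>p<n. \<Sum>k<n - Suc p. T p (Suc p + k)) = (\<Sum>(p, k)\<in>(SIGMA p:{..<n}. {..<n - Suc p}). T p (Suc p + k))"
    by (rule sum.Sigma) auto
  also have "\<dots> = (\<Sum>(p, q)\<in>{(p, q). p < q \<and> q < n}. T p q)"
    by (rule sum.reindex_bij_witness[of _ "\<lambda>(p, q). (p, q - Suc p)" "\<lambda>(p, k). (p, Suc p + k)"]) auto
  finally show ?thesis .
qed

lemma nths_remove2:
  "nths (x @ a # y @ b # z) (- {length x, Suc (length x + length y)}) = x @ y @ z"
proof -
  have 1: "nths x (- {length x, Suc (length x + length y)}) = x"
    by (rule nths_all) auto
  have 2: "nths y {j. Suc (j + length x) \<in> - {length x, Suc (length x + length y)}} = y"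
    by (rule nths_all) auto
  have 3: "nths z {j. Suc (Suc (j + length y) + length x) \<in> - {length x, Suc (length x + length y)}} = z"
    by (rule nths_all) auto
  show ?thesis
    using 2 3 by (simp add: nths_append nths_Cons 1)
qed

lemma pair_decomposition:
  assumes "p < q" "q < length w"
  obtains x y z where "w = x @ w ! p # y @ w ! q # z" "nths w (- {p, q}) = x @ y @ z"
proof -
  define x y z where "x = take p w" and "y = take (q - Suc p) (drop (Suc p) w)" and "z = drop (Suc q) w"
  have lens: "length x = p" "length y = q - Suc p" using assms by (auto simp: x_def y_def)
  have "drop (Suc p) w = y @ w ! q # z"
    using assms id_take_nth_drop[of "q - Suc p" "drop (Suc p) w"] by (simp add: y_def z_def)
  moreover have "w = x @ w ! p # drop (Suc p) w"
    using assms id_take_nth_drop[of p w] by (simp add: x_def)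
  ultimately have w: "w = x @ w ! p # y @ w ! q # z" by simp
  have "q = Suc (length x + length y)" using assms lens by simp
  then have "nths w (- {p, q}) = x @ y @ z"
    using nths_remove2[of x "w ! p" y "w ! q" z] lens w by metis
  with w show ?thesis by (rule that)
qed

text \<open>Both chosen letters pass the letters left of \<open>p\<close>, only \<open>w ! q\<close>
  passes those strictly between; \<open>p\<close> is itself chosen and hence subtracted from the
  second sum.\<close>

lemma koszul_sign_pair:
  assumes "p < q" "q < length w"
  shows "koszul_sign {p, q} w = (sg (odd ((\<Sum>k<p. sdeg (w ! k)) * sdeg (w ! p) +
    ((\<Sum>k<q. sdeg (w ! k)) - sdeg (w ! p)) * sdeg (w ! q))) :: 'k::field_char_0)"
proof -
  let ?f = "\<lambda>(p, q). sdeg (w ! p) * sdeg (w ! q)"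
  have "{(p', q'). p' < q' \<and> q' < length w \<and> p' \<notin> {p, q} \<and> q' \<in> {p, q}} =
    (\<lambda>k. (k, p)) ` {..<p} \<union> (\<lambda>k. (k, q)) ` ({..<q} - {p})"
    using assms by auto
  then have "sum ?f {(p', q'). p' < q' \<and> q' < length w \<and> p' \<notin> {p, q} \<and> q' \<in> {p, q}} =
    sum ?f ((\<lambda>k. (k, p)) ` {..<p}) + sum ?f ((\<lambda>k. (k, q)) ` ({..<q} - {p}))"
    using assms by (simp only:) (rule sum.union_disjoint, auto)
  also have "\<dots> = (\<Sum>k<p. sdeg (w ! k)) * sdeg (w ! p) + (\<Sum>k\<in>{..<q} - {p}. sdeg (w ! k)) * sdeg (w ! q)"
    by (simp add: sum.reindex inj_on_def sum_distrib_right)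
  also have "(\<Sum>k\<in>{..<q} - {p}. sdeg (w ! k)) = (\<Sum>k<q. sdeg (w ! k)) - sdeg (w ! p)"
    using assms by (simp add: sum_diff1)
  finally show ?thesis by (simp add: koszul_sign_def powi_sg)
qed

lemma map_snd_Pair: "map snd (map (Pair True) w) = w"
  by (induction w) auto

type_synonym 'a lword = "(bool \<times> int \<times> 'a) list"

text \<open>
  The letter \<open>(e, i, x)\<close> stands for \<open>x \<in> L\<^sub>i\<close> if \<open>e\<close> is false and for \<open>\<epsilon>x\<close>, of degree \<open>i + 1\<close>, if \<open>e\<close> is
  true.  A letter with \<open>x \<notin> L\<^sub>i\<close> is identified with \<open>0\<close>.
\<close>

definition lpar :: "bool \<times> int \<times> 'a \<Rightarrow> bool"
  where "lpar = (\<lambda>(e, i, x). odd i \<noteq> e)"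

inductive_set lrel :: "('k::field_char_0, 'a) dgla \<Rightarrow> ('k \<times> bool \<times> int \<times> 'a) list set"
  for L :: "('k::field_char_0, 'a) dgla" where
  plus: "x \<in> gr L i \<Longrightarrow> y \<in> gr L i \<Longrightarrow>
    [(1, e, i, x \<oplus>\<^bsub>homog L i\<^esub> y), (- 1, e, i, x), (- 1, e, i, y)] \<in> lrel L"
| smult: "x \<in> gr L i \<Longrightarrow> [(1, e, i, c \<odot>\<^bsub>homog L i\<^esub> x), (- c, e, i, x)] \<in> lrel L"
| invalid: "x \<notin> gr L i \<Longrightarrow> [(1, e, i, x)] \<in> lrel L"

text \<open>The sign is that of moving \<epsilon> past \<open>x\<close>. Invalid arguments and pairs
  of \<epsilon>-letters give a zero letter of the right parity, so that parity is additive without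
  hypotheses.\<close>

definition lbr :: "('k::field_char_0, 'a) dgla \<Rightarrow> bool \<times> int \<times> 'a \<Rightarrow> bool \<times> int \<times> 'a \<Rightarrow> bool \<times> int \<times> 'a"
  where "lbr L = (\<lambda>(e, i, x) (f, j, y). (e \<noteq> f, i + j,
    if x \<in> gr L i \<and> y \<in> gr L j \<and> \<not> (e \<and> f)
    then (if \<not> e \<and> f then (- 1) powi i \<odot>\<^bsub>homog L (i + j)\<^esub> brk L i j x y else brk L i j x y)
    else \<zero>\<^bsub>homog L (i + j)\<^esub>))"

text \<open>
  The differential of the cone is \<open>ldI + lde\<close>; \<open>lsig\<close> is a contraction of it that anticommutes with \<open>ldI\<close>.
\<close>

definition ldI :: "('k::field_char_0, 'a) dgla \<Rightarrow> bool \<times> int \<times> 'a \<Rightarrow> bool \<times> int \<times> 'a"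
  where "ldI L = (\<lambda>(e, i, x). (e, i - 1, if x \<in> gr L i
    then (if e then (- 1) \<odot>\<^bsub>homog L (i - 1)\<^esub> bdry L i x else bdry L i x) else \<zero>\<^bsub>homog L (i - 1)\<^esub>))"

definition lde :: "('k::field_char_0, 'a) dgla \<Rightarrow> bool \<times> int \<times> 'a \<Rightarrow> bool \<times> int \<times> 'a"
  where "lde L = (\<lambda>(e, i, x). (\<not> e, i,
    if e \<and> x \<in> gr L i then (- 1) \<odot>\<^bsub>homog L i\<^esub> x else \<zero>\<^bsub>homog L i\<^esub>))"

definition lsig :: "('k::field_char_0, 'a) dgla \<Rightarrow> bool \<times> int \<times> 'a \<Rightarrow> bool \<times> int \<times> 'a"
  where "lsig L = (\<lambda>(e, i, x). (\<not> e, i,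
    if \<not> e \<and> x \<in> gr L i then (- 1) \<odot>\<^bsub>homog L i\<^esub> x else \<zero>\<^bsub>homog L i\<^esub>))"

definition lmap :: "('k::field_char_0, 'a) dgla \<Rightarrow> ('k, 'b) dgla \<Rightarrow> (int \<Rightarrow> 'a \<Rightarrow> 'b) \<Rightarrow>
    bool \<times> int \<times> 'a \<Rightarrow> bool \<times> int \<times> 'b"
  where "lmap L M \<psi> = (\<lambda>(e, i, x). (e, i, if x \<in> gr L i then \<psi> i x else \<zero>\<^bsub>homog M i\<^esub>))"

lemma lpar_simps [simp]:
  "lpar (e, i, x) = (odd i \<noteq> e)"
  "lpar (lbr L a b) = (lpar a \<noteq> lpar b)"
  "lpar (ldI L a) = (\<not> lpar a)"
  "lpar (lde L a) = (\<not> lpar a)"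
  "lpar (lsig L a) = (\<not> lpar a)"
  "lpar (lmap L M \<psi> a) = lpar a"
  by (cases a; cases b; auto simp: lpar_def lbr_def ldI_def lde_def lsig_def lmap_def)+

context dgla
begin

sublocale letters: graded_letters "lpar :: bool \<times> int \<times> 'a \<Rightarrow> bool" "lrel L"
proof
  fix r assume "r \<in> lrel L"
  then show "\<exists>e. \<forall>p\<in>set r. lpar (snd p) = e" by cases auto
qed

lemma lin_iff: "letters.lin \<phi> \<longleftrightarrow>
  (\<forall>e i x y. x \<in> gr L i \<longrightarrow> y \<in> gr L i \<longrightarrow> \<phi> (e, i, x \<oplus>\<^bsub>homog L i\<^esub> y) = \<phi> (e, i, x) + \<phi> (e, i, y)) \<and>
  (\<forall>e i c x. x \<in> gr L i \<longrightarrow> \<phi> (e, i, c \<odot>\<^bsub>homog L i\<^esub> x) = c * \<phi> (e, i, x)) \<and>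
  (\<forall>e i x. x \<notin> gr L i \<longrightarrow> \<phi> (e, i, x) = 0)" (is "?l \<longleftrightarrow> ?a \<and> ?b \<and> ?c")
proof
  assume ?l
  then have l: "(\<Sum>p\<leftarrow>r. fst p * \<phi> (snd p)) = 0" if "r \<in> lrel L" for r
    using that unfolding letters.lin_def by blast
  have ?a
    using l[OF lrel.plus] by (simp add: algebra_simps)
  moreover have ?b
    using l[OF lrel.smult] by simp
  moreover have ?c
    using l[OF lrel.invalid] by simp
  ultimately show "?a \<and> ?b \<and> ?c" by blast
next
  assume *: "?a \<and> ?b \<and> ?c"
  show ?l
    unfolding letters.lin_def
  proof
    fix r assume "r \<in> lrel L"
    then show "(\<Sum>p\<leftarrow>r. fst p * \<phi> (snd p)) = 0"
      using * by cases simp_all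
  qed
qed

lemma lin_plus:
  "letters.lin \<phi> \<Longrightarrow> x \<in> gr L i \<Longrightarrow> y \<in> gr L i \<Longrightarrow>
    \<phi> (e, i, x \<oplus>\<^bsub>homog L i\<^esub> y) = \<phi> (e, i, x) + \<phi> (e, i, y)"
  unfolding lin_iff by blast

lemma lin_smult:
  "letters.lin \<phi> \<Longrightarrow> x \<in> gr L i \<Longrightarrow> \<phi> (e, i, c \<odot>\<^bsub>homog L i\<^esub> x) = c * \<phi> (e, i, x)"
  unfolding lin_iff by blast

lemma lin_invalid: "letters.lin \<phi> \<Longrightarrow> x \<notin> gr L i \<Longrightarrow> \<phi> (e, i, x) = 0"
  unfolding lin_iff by blast

lemma lin_zero:
  assumes "letters.lin \<phi>"
  shows "\<phi> (e, i, \<zero>\<^bsub>homog L i\<^esub>) = 0"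
proof -
  have "\<phi> (e, i, \<zero>\<^bsub>homog L i\<^esub> \<oplus>\<^bsub>homog L i\<^esub> \<zero>\<^bsub>homog L i\<^esub>) =
      \<phi> (e, i, \<zero>\<^bsub>homog L i\<^esub>) + \<phi> (e, i, \<zero>\<^bsub>homog L i\<^esub>)"
    by (rule lin_plus[OF assms vs_zero_closed vs_zero_closed])
  moreover have "\<zero>\<^bsub>homog L i\<^esub> \<oplus>\<^bsub>homog L i\<^esub> \<zero>\<^bsub>homog L i\<^esub> = \<zero>\<^bsub>homog L i\<^esub>"
    by (rule vs_zero[OF vs_zero_closed])
  ultimately have "0 + \<phi> (e, i, \<zero>\<^bsub>homog L i\<^esub>) = \<phi> (e, i, \<zero>\<^bsub>homog L i\<^esub>) + \<phi> (e, i, \<zero>\<^bsub>homog L i\<^esub>)"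
    by (simp only: add_0_left)
  then show ?thesis unfolding add_right_cancel by (rule HOL.sym)
qed

lemma linI:
  assumes "\<And>e i x y. x \<in> gr L i \<Longrightarrow> y \<in> gr L i \<Longrightarrow> \<phi> (e, i, x \<oplus>\<^bsub>homog L i\<^esub> y) = \<phi> (e, i, x) + \<phi> (e, i, y)"
    and "\<And>e i c x. x \<in> gr L i \<Longrightarrow> \<phi> (e, i, c \<odot>\<^bsub>homog L i\<^esub> x) = c * \<phi> (e, i, x)"
    and "\<And>e i x. x \<notin> gr L i \<Longrightarrow> \<phi> (e, i, x) = 0"
  shows "letters.lin \<phi>"
  by (intro iffD2[OF lin_iff] conjI allI impI assms)

lemma lin_lbr:
  assumes "letters.lin \<phi>"
  shows "\<phi> (lbr L (e, i, x) (f, j, y)) = (if x \<in> gr L i \<and> y \<in> gr L j \<and> \<not> (e \<and> f)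
    then sg (\<not> e \<and> f \<and> odd i) * \<phi> (e \<noteq> f, i + j, brk L i j x y) else 0)"
  by (cases e; cases f) (simp_all add: lbr_def lin_zero[OF assms] lin_smult[OF assms] brk_closed powi_sg)

lemma lin_ldI:
  assumes "letters.lin \<phi>"
  shows "\<phi> (ldI L (e, i, x)) = (if x \<in> gr L i then sg e * \<phi> (e, i - 1, bdry L i x) else 0)"
  by (simp add: ldI_def lin_zero[OF assms] lin_smult[OF assms] bdry_closed)

lemma lin_lde:
  assumes "letters.lin \<phi>"
  shows "\<phi> (lde L (e, i, x)) = (if e then - \<phi> (False, i, x) else 0)"
  by (simp add: lde_def lin_zero[OF assms] lin_smult[OF assms] lin_invalid[OF assms])

lemma lin_lsig:
  assumes "letters.lin \<phi>"
  shows "\<phi> (lsig L (e, i, x)) = (if e then 0 else - \<phi> (True, i, x))"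
  by (simp add: lsig_def lin_zero[OF assms] lin_smult[OF assms] lin_invalid[OF assms])

lemma lin_lbr_left: "letters.lin \<phi> \<Longrightarrow> letters.lin (\<lambda>a. \<phi> (lbr L a b))"
  by (cases b, rule linI)
    (auto simp: lin_lbr vs_add_closed vs_smult_closed brk_add_left brk_smult_left lin_plus lin_smult brk_closed
      distrib_left mult.left_commute)

lemma lin_lbr_right: "letters.lin \<phi> \<Longrightarrow> letters.lin (\<lambda>b. \<phi> (lbr L a b))"
  by (cases a, rule linI)
    (auto simp: lin_lbr vs_add_closed vs_smult_closed brk_add_right brk_smult_right lin_plus lin_smult brk_closed
      distrib_left mult.left_commute)

lemma lin_lbr_antisym:
  assumes "letters.lin \<phi>"
  shows "\<phi> (lbr L b a) = - letters.s a b * \<phi> (lbr L a b)"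
proof -
  obtain e i x f j y where ab: "a = (e, i, x)" "b = (f, j, y)" by (metis prod_cases3)
  show ?thesis
  proof (cases "x \<in> gr L i \<and> y \<in> gr L j")
    case True
    then have "\<phi> (g, j + i, brk L j i y x) = - sg (odd i \<and> odd j) * \<phi> (g, i + j, brk L i j x y)" for g
      using brk_antisym[of y j x i] lin_smult[OF assms brk_closed[of x i y j]]
      by (simp add: powi_sg add.commute conj_commute)
    then show ?thesis
      unfolding ab by (cases "odd i"; cases "odd j"; cases e; cases f) (simp_all add: lin_lbr[OF assms] True)
  next
    case False
    then show ?thesis unfolding ab by (auto simp: lin_lbr[OF assms])
  qed
qed

lemma lin_lbr_jacobi:
  assumes "letters.lin \<phi>"
  shows "\<phi> (lbr L (lbr L a b) c) = \<phi> (lbr L a (lbr L b c)) - letters.s a b * \<phi> (lbr L b (lbr L a c))"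
proof -
  obtain e i x f j y g l z where abc: "a = (e, i, x)" "b = (f, j, y)" "c = (g, l, z)" by (metis prod_cases3)
  note left = lin_lbr_left[OF assms, of c] and right = lin_lbr_right[OF assms]
  have 1: "\<phi> (lbr L (lbr L a b) c) = (if x \<in> gr L i \<and> y \<in> gr L j \<and> \<not> (e \<and> f)
    then sg (\<not> e \<and> f \<and> odd i) * \<phi> (lbr L (e \<noteq> f, i + j, brk L i j x y) c) else 0)"
    unfolding abc(1,2) using lin_lbr[OF left] by simp
  have 2: "\<phi> (lbr L a (lbr L b c)) = (if y \<in> gr L j \<and> z \<in> gr L l \<and> \<not> (f \<and> g)
    then sg (\<not> f \<and> g \<and> odd j) * \<phi> (lbr L a (f \<noteq> g, j + l, brk L j l y z)) else 0)"
    unfolding abc(2,3) using lin_lbr[OF right] by simp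
  have 3: "\<phi> (lbr L b (lbr L a c)) = (if x \<in> gr L i \<and> z \<in> gr L l \<and> \<not> (e \<and> g)
    then sg (\<not> e \<and> g \<and> odd i) * \<phi> (lbr L b (e \<noteq> g, i + l, brk L i l x z)) else 0)"
    unfolding abc(1,3) using lin_lbr[OF right] by simp
  show ?thesis
  proof (cases "x \<in> gr L i \<and> y \<in> gr L j \<and> z \<in> gr L l")
    case True
    then have cl: "brk L i j x y \<in> gr L (i + j)" "brk L j l y z \<in> gr L (j + l)" "brk L i l x z \<in> gr L (i + l)"
      by (simp_all add: brk_closed)
    have "\<phi> (h, i + (j + l), brk L i (j + l) x (brk L j l y z)) =
      \<phi> (h, i + j + l, brk L (i + j) l (brk L i j x y) z) +
      sg (odd i \<and> odd j) * \<phi> (h, j + (i + l), brk L j (i + l) y (brk L i l x z))" for h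
      using True jacobi[of x i y j z l] brk_closed[OF cl(1), of z l] brk_closed[OF _ cl(3), of y j]
      by (simp add: lin_plus[OF assms] lin_smult[OF assms] vs_smult_closed powi_sg add_ac)
    then show ?thesis
      unfolding 1 2 3 unfolding abc
      by (cases e; cases f; cases g; cases "odd i"; cases "odd j") (simp_all add: lin_lbr[OF assms] True cl)
  next
    case False
    then show ?thesis unfolding 1 2 3 unfolding abc by (auto simp: lin_lbr[OF assms])
  qed
qed

sublocale cone: glie "lpar :: bool \<times> int \<times> 'a \<Rightarrow> bool" "lrel L" "lbr L"
  by unfold_locales (rule lpar_simps lin_lbr_left lin_lbr_right lin_lbr_antisym lin_lbr_jacobi; assumption?)+

lemma lin_comp:
  assumes "letters.lin \<phi>"
  shows lin_comp_ldI: "letters.lin (\<lambda>a. \<phi> (ldI L a))"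
    and lin_comp_lde: "letters.lin (\<lambda>a. \<phi> (lde L a))"
    and lin_comp_lsig: "letters.lin (\<lambda>a. \<phi> (lsig L a))"
proof -
  show "letters.lin (\<lambda>a. \<phi> (ldI L a))"
    by (rule linI) (simp_all add: lin_ldI[OF assms] vs_ops(1-3) bdry_add bdry_smult bdry_closed
        lin_plus[OF assms] lin_smult[OF assms] algebra_simps)
  show "letters.lin (\<lambda>a. \<phi> (lde L a))"
    by (rule linI) (simp_all add: lin_lde[OF assms] lin_plus[OF assms] lin_smult[OF assms] lin_invalid[OF assms])
  show "letters.lin (\<lambda>a. \<phi> (lsig L a))"
    by (rule linI) (simp_all add: lin_lsig[OF assms] lin_plus[OF assms] lin_smult[OF assms] lin_invalid[OF assms])
qed

lemma lde_derivation:
  assumes "letters.lin \<phi>"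
  shows "\<phi> (lde L (lbr L a b)) = \<phi> (lbr L (lde L a) b) + sg (lpar a) * \<phi> (lbr L a (lde L b))"
proof -
  obtain e i x f j y where ab: "a = (e, i, x)" "b = (f, j, y)" by (metis prod_cases3)
  have 1: "\<phi> (lde L (lbr L a b)) = (if x \<in> gr L i \<and> y \<in> gr L j \<and> \<not> (e \<and> f)
    then sg (\<not> e \<and> f \<and> odd i) * \<phi> (lde L (e \<noteq> f, i + j, brk L i j x y)) else 0)"
    unfolding ab using lin_lbr[OF lin_comp_lde[OF assms]] by simp
  have 2: "\<phi> (lbr L (lde L a) b) = (if e then - \<phi> (lbr L (False, i, x) b) else 0)"
    unfolding ab(1) using lin_lde[OF lin_lbr_left[OF assms]] by simp
  have 3: "\<phi> (lbr L a (lde L b)) = (if f then - \<phi> (lbr L a (False, j, y)) else 0)"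
    unfolding ab(2) using lin_lde[OF lin_lbr_right[OF assms]] by simp
  show ?thesis unfolding 1 2 3 unfolding ab
    by (cases e; cases f) (auto simp: lin_lbr[OF assms] lin_lde[OF assms] sg_def)
qed

lemma ldI_derivation:
  assumes "letters.lin \<phi>"
  shows "\<phi> (ldI L (lbr L a b)) = \<phi> (lbr L (ldI L a) b) + sg (lpar a) * \<phi> (lbr L a (ldI L b))"
proof -
  obtain e i x f j y where ab: "a = (e, i, x)" "b = (f, j, y)" by (metis prod_cases3)
  have 1: "\<phi> (ldI L (lbr L a b)) = (if x \<in> gr L i \<and> y \<in> gr L j \<and> \<not> (e \<and> f)
    then sg (\<not> e \<and> f \<and> odd i) * \<phi> (ldI L (e \<noteq> f, i + j, brk L i j x y)) else 0)"
    unfolding ab using lin_lbr[OF lin_comp_ldI[OF assms]] by simp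
  have 2: "\<phi> (lbr L (ldI L a) b) = (if x \<in> gr L i then sg e * \<phi> (lbr L (e, i - 1, bdry L i x) b) else 0)"
    unfolding ab(1) using lin_ldI[OF lin_lbr_left[OF assms]] by simp
  have 3: "\<phi> (lbr L a (ldI L b)) = (if y \<in> gr L j then sg f * \<phi> (lbr L a (f, j - 1, bdry L j y)) else 0)"
    unfolding ab(2) using lin_ldI[OF lin_lbr_right[OF assms]] by simp
  show ?thesis
  proof (cases "x \<in> gr L i \<and> y \<in> gr L j")
    case True
    have "\<phi> (h, i + j - 1, bdry L (i + j) (brk L i j x y)) =
      \<phi> (h, i - 1 + j, brk L (i - 1) j (bdry L i x) y) +
      sg (odd i) * \<phi> (h, i + (j - 1), brk L i (j - 1) x (bdry L j y))" for h
      using True leibniz[of x i y j] brk_closed[of "bdry L i x" "i - 1" y j]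
        brk_closed[of x i "bdry L j y" "j - 1"] bdry_closed[of x i] bdry_closed[of y j]
      by (simp add: lin_plus[OF assms] lin_smult[OF assms] vs_smult_closed powi_sg add_diff_eq diff_add_eq)
    then show ?thesis
      unfolding 1 2 3 unfolding ab
      by (cases e; cases f; cases "odd i")
        (simp_all add: lin_lbr[OF assms] lin_ldI[OF assms] True bdry_closed brk_closed)
  next
    case False
    then show ?thesis unfolding 1 2 3 unfolding ab by (auto simp: lin_lbr[OF assms])
  qed
qed

text \<open>Up to sign \<open>lde\<close> and \<open>lsig\<close> are the inverse identifications
  between \<epsilon>L and L, each zero on the other half. The sign of \<open>ldI\<close> differs on
  the two halves, so it anticommutes with both.\<close>

lemma letter_commutators:
  assumes "letters.lin \<phi>"
  shows "\<phi> (ldI L (lsig L a)) + \<phi> (lsig L (ldI L a)) = 0"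
    and "\<phi> (lde L (lsig L a)) + \<phi> (lsig L (lde L a)) = \<phi> a"
    and "\<phi> (ldI L (ldI L a)) = 0"
    and "\<phi> (lde L (lde L a)) = 0"
    and "\<phi> (ldI L (lde L a)) + \<phi> (lde L (ldI L a)) = 0"
proof -
  obtain e i x where a: "a = (e, i, x)" by (metis prod_cases3)
  note c = lin_ldI[OF lin_comp_ldI[OF assms]] lin_ldI[OF lin_comp_lde[OF assms]] lin_ldI[OF lin_comp_lsig[OF assms]]
    lin_lde[OF lin_comp_ldI[OF assms]] lin_lde[OF lin_comp_lde[OF assms]] lin_lde[OF lin_comp_lsig[OF assms]]
    lin_lsig[OF lin_comp_ldI[OF assms]] lin_lsig[OF lin_comp_lde[OF assms]]
    lin_ldI[OF assms] lin_lde[OF assms] lin_lsig[OF assms]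
  have "x \<in> gr L i \<Longrightarrow> \<phi> (e, i - 1 - 1, bdry L (i - 1) (bdry L i x)) = 0"
    using lin_zero[OF assms, of e "i - 2"] by (simp add: bdry_bdry)
  then show "\<phi> (ldI L (ldI L a)) = 0" unfolding a by (simp add: c bdry_closed)
  show "\<phi> (ldI L (lsig L a)) + \<phi> (lsig L (ldI L a)) = 0"
    "\<phi> (lde L (lsig L a)) + \<phi> (lsig L (lde L a)) = \<phi> a" "\<phi> (lde L (lde L a)) = 0"
    "\<phi> (ldI L (lde L a)) + \<phi> (lde L (ldI L a)) = 0"
    unfolding a by (cases e; simp add: c)+
qed

section \<open>Cochains as functionals on the cone\<close>

definition D :: "('a lword \<Rightarrow> 'k) \<Rightarrow> 'a lword \<Rightarrow> 'k"
  where "D F w = letters.hat True (ldI L) F w + letters.hat True (lde L) F w"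

lemma D_linear:
  "D (\<lambda>w. F w + G w) w = D F w + D G w"
  "D (\<lambda>w. k * F w) w = k * D F w"
  "D (\<lambda>w. F w - G w) w = D F w - D G w"
  by (simp_all add: D_def letters.hat_linear algebra_simps)

lemma hat_ldI_env: "cone.env F \<Longrightarrow> cone.env (letters.hat True (ldI L) F)"
  by (rule cone.hat_env) (simp_all add: lin_comp_ldI ldI_derivation)

lemma hat_lde_env: "cone.env F \<Longrightarrow> cone.env (letters.hat True (lde L) F)"
  by (rule cone.hat_env) (simp_all add: lin_comp_lde lde_derivation)

lemma D_env: "cone.env F \<Longrightarrow> cone.env (D F)"
  unfolding D_def[abs_def] by (intro cone.env_add hat_ldI_env hat_lde_env)

lemma D_D:
  assumes "cone.env F"
  shows "D (D F) w = 0"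
proof -
  have m: "letters.mlin F" by (rule cone.env_mlin[OF assms])
  \<comment> \<open>The graded commutator of an odd derivation with itself is twice its square, and
    2 is invertible.\<close>
  have "letters.hat True (ldI L) (letters.hat True (ldI L) F) w -
      sg (True \<and> True) * letters.hat True (ldI L) (letters.hat True (ldI L) F) w =
      0 * letters.hat (True \<noteq> True) (\<lambda>l. l) F w"
    by (rule letters.hat_commutator[OF _ _ _ m]) (simp_all add: letter_commutators)
  moreover have "letters.hat True (lde L) (letters.hat True (lde L) F) w -
      sg (True \<and> True) * letters.hat True (lde L) (letters.hat True (lde L) F) w =
      0 * letters.hat (True \<noteq> True) (\<lambda>l. l) F w"
    by (rule letters.hat_commutator[OF _ _ _ m]) (simp_all add: letter_commutators)
  moreover have "letters.hat True (lde L) (letters.hat True (ldI L) F) w -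
      sg (True \<and> True) * letters.hat True (ldI L) (letters.hat True (lde L) F) w =
      0 * letters.hat (True \<noteq> True) (\<lambda>l. l) F w"
    by (rule letters.hat_commutator[OF _ _ _ m]) (simp_all add: letter_commutators)
  ultimately show ?thesis
    unfolding D_def[abs_def] letters.hat_linear by (simp add: add.commute)
qed

text \<open>\<open>ldI\<close> anticommutes with \<open>lsig\<close>, so the identity comes from
  \<open>lde\<close> alone: a case \<open>k = 0\<close> of \<open>hat_contr\<close> is added to a
  case \<open>k = 1\<close>.\<close>

lemma D_contr:
  assumes F: "cone.env F"
  shows "D (cone.contr (lsig L) F) w + cone.contr (lsig L) (D F) w = F w - F [] * cone.eps w"
proof -
  have par: "lpar (lsig L l) = (\<not> lpar l)" for l :: "bool \<times> int \<times> 'a" by simp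
  have "letters.hat True (ldI L) (cone.contr (lsig L) F) w + cone.contr (lsig L) (letters.hat True (ldI L) F) w =
      0 * (F w - F [] * cone.eps w)"
    by (rule cone.hat_contr[OF par lin_comp_lsig F]) (simp_all add: lin_comp_ldI ldI_derivation letter_commutators)
  moreover have "letters.hat True (lde L) (cone.contr (lsig L) F) w + cone.contr (lsig L) (letters.hat True (lde L) F) w =
      1 * (F w - F [] * cone.eps w)"
    by (rule cone.hat_contr[OF par lin_comp_lsig F]) (simp_all add: lin_comp_lde lde_derivation letter_commutators)
  ultimately have "(letters.hat True (ldI L) (cone.contr (lsig L) F) w +
      cone.contr (lsig L) (letters.hat True (ldI L) F) w) +
      (letters.hat True (lde L) (cone.contr (lsig L) F) w +
      cone.contr (lsig L) (letters.hat True (lde L) F) w) = F w - F [] * cone.eps w" by simp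
  then show ?thesis
    by (simp add: D_def[abs_def] cone.contr_add[OF par lin_comp_lsig hat_ldI_env[OF F] hat_lde_env[OF F]] add_ac)
qed

lemma D_hcontr:
  assumes F: "cone.env F"
    and par: "\<And>l. lpar (r l) = lpar l"
    and lin: "\<And>\<phi>. letters.lin \<phi> \<Longrightarrow> letters.lin (\<lambda>l. \<phi> (r l))"
    and br: "\<And>\<phi> a b. letters.lin \<phi> \<Longrightarrow> \<phi> (r (lbr L a b)) = \<phi> (lbr L (r a) (r b))"
    and dI: "\<And>\<phi> l. letters.lin \<phi> \<Longrightarrow> \<phi> (r (ldI L l)) = \<phi> (ldI L (r l))"
    and de: "\<And>\<phi> l. letters.lin \<phi> \<Longrightarrow> \<phi> (r (lde L l)) = \<phi> (lde L (r l))"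
  shows "D (cone.hcontr r (lsig L) F) w + cone.hcontr r (lsig L) (D F) w = F w - F (map r w)"
proof -
  note c = par lin br lpar_simps(5) lin_comp_lsig
  have "letters.hat True (ldI L) (cone.hcontr r (lsig L) F) w +
      cone.hcontr r (lsig L) (letters.hat True (ldI L) F) w = 0 * (F w - F (map r w))"
    by (rule cone.hat_hcontr[OF c F]) (simp_all add: lin_comp_ldI ldI_derivation letter_commutators dI)
  moreover have "letters.hat True (lde L) (cone.hcontr r (lsig L) F) w +
      cone.hcontr r (lsig L) (letters.hat True (lde L) F) w = 1 * (F w - F (map r w))"
    by (rule cone.hat_hcontr[OF c F]) (simp_all add: lin_comp_lde lde_derivation letter_commutators de)
  ultimately have "(letters.hat True (ldI L) (cone.hcontr r (lsig L) F) w +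
      cone.hcontr r (lsig L) (letters.hat True (ldI L) F) w) +
      (letters.hat True (lde L) (cone.hcontr r (lsig L) F) w +
      cone.hcontr r (lsig L) (letters.hat True (lde L) F) w) = F w - F (map r w)" by simp
  then show ?thesis
    by (simp add: D_def[abs_def] cone.hcontr_add[OF c hat_ldI_env[OF F] hat_lde_env[OF F]] add_ac)
qed

text \<open>On the last letter \<open>lde\<close> gives zero, as it is a letter of L, and
  \<open>ldI\<close> replaces it by its boundary; on earlier letters the last one stays in
  place.\<close>

lemma D_snoc:
  assumes F: "cone.env F" and 0: "\<And>w. F (w @ [(False, i, x)]) = 0" "\<And>w. F (w @ [(False, i - 1, bdry L i x)]) = 0"
  shows "D F (w @ [(False, i, x)]) = 0"
proof -
  have lin: "letters.lin (\<lambda>l. F (w @ [l]))" by (rule letters.mlinD[OF cone.env_mlin[OF F]])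
  show ?thesis
    unfolding D_def letters.hat_append
    by (simp add: 0 letters.hat_linear lin_ldI[OF lin] lin_lde[OF lin])
qed

lemma fst_lbr: "fst (lbr L a b) = (fst a \<noteq> fst b)"
  by (simp add: lbr_def split: prod.splits)

lemma lin_lbr_eps: "letters.lin \<phi> \<Longrightarrow> fst a \<Longrightarrow> fst b \<Longrightarrow> \<phi> (lbr L a b) = 0"
  by (cases a; cases b) (simp add: lin_lbr)

lemma lin_fst: "letters.lin \<phi> \<Longrightarrow> letters.lin (\<lambda>l. if fst l then \<phi> l else 0)"
  by (rule linI) (simp_all add: lin_plus lin_smult lin_invalid)

lemma env_move_left:
  assumes "cone.env F" "\<forall>l\<in>set u. fst l" "fst c"
  shows "F (u @ c # v) = sg (lpar c \<and> letters.wpar u) * F (c # u @ v)"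
  using assms(1,2)
proof (induction u arbitrary: F)
  case (Cons a u)
  have "F (lbr L a c # u @ v) = 0"
    using lin_lbr_eps[OF letters.mlinD_Cons[OF cone.env_mlin[OF Cons.prems(1)]]] Cons.prems(2) assms(3) by simp
  then show ?case
    using Cons.IH[OF cone.env_Cons[OF Cons.prems(1), of a]] Cons.prems(2) cone.envD_Cons[OF Cons.prems(1), of a c "u @ v"]
    by (cases "lpar a"; cases "lpar c") simp_all
qed simp

text \<open>The product of \<open>f\<close> on the \<epsilon>-letters with the counit on the letters
  of L; the counit makes the lifted functional vanish after right multiplication with L.\<close>

definition extend :: "((int \<times> 'a) list \<Rightarrow> 'k) \<Rightarrow> 'a lword \<Rightarrow> 'a lword \<Rightarrow> 'k"
  where "extend f g u = (if u = [] \<and> (\<forall>l\<in>set g. fst l) then f (map snd g) else 0)"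

lemma extend_sym_env:
  assumes f: "f \<in> cochains L m"
  shows "cone.sym_env (extend f)"
  unfolding cone.sym_env_def
proof (intro conjI allI)
  fix u g
  show "letters.gsym (\<lambda>g. extend f g u)"
  proof (rule letters.symI)
    fix x y :: "'a lword" and a b :: "bool \<times> int \<times> 'a"
    have "f (map snd x @ snd a # snd b # map snd y) =
        (- 1) powi (sdeg (snd a) * sdeg (snd b)) * f (map snd x @ snd b # snd a # map snd y)"
      using f unfolding cochains_def by blast
    then show "extend f (x @ a # b # y) u = letters.s a b * extend f (x @ b # a # y) u"
      by (cases a; cases b) (auto simp: extend_def powi_sg)
  qed
  show "letters.mlin (\<lambda>g. extend f g u)"
    unfolding letters.mlin_def
  proof (intro allI linI)
    fix x v e i y y'
    assume "y \<in> gr L i" "y' \<in> gr L i"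
    then show "extend f (x @ (e, i, y \<oplus>\<^bsub>homog L i\<^esub> y') # v) u = extend f (x @ (e, i, y) # v) u + extend f (x @ (e, i, y') # v) u"
      using f unfolding cochains_def by (auto simp: extend_def)
  next
    fix x v e i c y
    assume "y \<in> gr L i"
    then show "extend f (x @ (e, i, c \<odot>\<^bsub>homog L i\<^esub> y) # v) u = c * extend f (x @ (e, i, y) # v) u"
      using f unfolding cochains_def by (auto simp: extend_def)
  next
    fix x v :: "'a lword" and e i y
    assume "y \<notin> gr L i"
    then have "\<not> is_word L (map snd x @ (i, y) # map snd v)" by (auto simp: is_word_def)
    then have "f (map snd x @ (i, y) # map snd v) = 0" using f unfolding cochains_def by blast
    then show "extend f (x @ (e, i, y) # v) u = 0" by (simp add: extend_def)
  qed
  have "extend f g = (\<lambda>u. (if \<forall>l\<in>set g. fst l then f (map snd g) else 0) * cone.eps u)"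
    by (rule HOL.ext) (simp add: extend_def cone.eps_def)
  then show "cone.env (extend f g)" by (simp add: cone.env_mult cone.env_eps)
qed

definition lift_cochain :: "((int \<times> 'a) list \<Rightarrow> 'k) \<Rightarrow> 'a lword \<Rightarrow> 'k"
  where "lift_cochain f = cone.lift fst (extend f)"

lemma lift_cochain_env: "f \<in> cochains L m \<Longrightarrow> cone.env (lift_cochain f)"
  unfolding lift_cochain_def by (rule cone.lift_env[where Q = fst, OF fst_lbr _ _ extend_sym_env]) (simp_all add: lin_lbr_eps lin_fst)

lemma lift_cochain_sorted: "(\<forall>l\<in>set g. fst l) \<Longrightarrow> (\<forall>l\<in>set u. \<not> fst l) \<Longrightarrow> lift_cochain f (g @ u) = extend f g u"
  unfolding lift_cochain_def by (rule cone.lift_sorted[where Q = fst, OF fst_lbr]) (simp_all add: lin_lbr_eps lin_fst)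

lemma lift_cochain_eps: "lift_cochain f (map (Pair True) w) = f w"
  using lift_cochain_sorted[of "map (Pair True) w" "[]" f] by (simp add: extend_def map_snd_Pair del: map_map)

lemma lift_cochain_snoc:
  assumes "f \<in> cochains L m"
  shows "lift_cochain f (w @ [(False, i, x)]) = 0"
proof (rule cone.env_sorted_eq_0[where F = "\<lambda>w. lift_cochain f (w @ [(False, i, x)])" and Q = fst])
  show "cone.env (\<lambda>w. lift_cochain f (w @ [(False, i, x)]))" by (rule cone.env_suffix[OF lift_cochain_env[OF assms]])
  fix u v :: "'a lword"
  assume "\<forall>l\<in>set u. fst l" "\<forall>l\<in>set v. \<not> fst l"
  then show "lift_cochain f ((u @ v) @ [(False, i, x)]) = 0"
    using lift_cochain_sorted[of u "v @ [(False, i, x)]" f] by (simp add: extend_def)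
qed

lemma wpar_eps: "letters.wpar (map (Pair True) v) = odd (\<Sum>p\<leftarrow>v. sdeg p)"
  by (induction v) auto

lemma hat_ldI_eps:
  assumes F: "letters.mlin F" and w: "is_word L w"
  shows "letters.hat True (ldI L) F (map (Pair True) w) = ce_dI L (\<lambda>w. F (map (Pair True) w)) w"
proof -
  have "sg (letters.wpar (take r (map (Pair True) w))) * F ((map (Pair True) w)[r := ldI L (True, w ! r)]) =
      - ((- 1) powi (\<Sum>q<r. sdeg (w ! q))) *
        F (map (Pair True) (w[r := (fst (w ! r) - 1, bdry L (fst (w ! r)) (snd (w ! r)))]))" if r: "r < length w" for r
  proof -
    obtain i x where ix: "w ! r = (i, x)" by fastforce
    then have "x \<in> gr L i" using w r nth_mem[OF r] unfolding is_word_def by fastforce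
    moreover have "letters.lin (\<lambda>l. F ((map (Pair True) w)[r := l]))"
      using letters.mlinD[OF F] r by (simp add: upd_conv_take_nth_drop)
    ultimately have "F ((map (Pair True) w)[r := ldI L (True, w ! r)]) =
      - F (map (Pair True) (w[r := (fst (w ! r) - 1, bdry L (fst (w ! r)) (snd (w ! r)))]))"
      using lin_ldI[of "\<lambda>l. F ((map (Pair True) w)[r := l])" True i x] by (simp add: ix map_update)
    moreover have "letters.wpar (take r (map (Pair True) w)) = odd (\<Sum>q<r. sdeg (w ! q))"
      using wpar_eps[of "take r w"] sum_list_take[of r w sdeg] r by (simp add: take_map)
    ultimately show ?thesis by (simp add: powi_sg)
  qed
  then show ?thesis using w by (simp add: cone.hat_sum ce_dI_def)
qed

text \<open>\<open>lde\<close> turns the \<epsilon>-letter at \<open>p\<close> into a letter of L.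
  By invariance this can be moved to the right end, leaving its bracket with each later
  \<epsilon>-letter, and the new \<epsilon>-letter is carried to the front: this is the quadratic
  part of the differential.\<close>

lemma hat_lde_eps:
  assumes F: "cone.env F" and inv: "\<And>w i x. F (w @ [(False, i, x)]) = 0" and w: "is_word L w"
  shows "letters.hat True (lde L) F (map (Pair True) w) = ce_dII L (\<lambda>w. F (map (Pair True) w)) w"
proof -
  let ?W = "map (Pair True) w"
  let ?n = "length w"
  let ?y = "\<lambda>p. (False, w ! p)"
  \<comment> \<open>The summand for a pair: the sign of \<open>lde\<close> and of its position, the
    sign of passing the letters between, and the value with the bracket still in the place of the
    letter at \<open>q\<close>.\<close>
  define T where "T p q = - sg (letters.wpar (take p ?W)) *
    (sg (lpar (?y p) \<and> letters.wpar (take (q - Suc p) (drop (Suc p) ?W))) *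
      F (take p ?W @ (drop (Suc p) ?W)[q - Suc p := lbr L (?y p) (True, w ! q)]))" for p q
  have "letters.hat True (lde L) F ?W = (\<Sum>p<?n. \<Sum>k<?n - Suc p. T p (Suc p + k))"
    unfolding cone.hat_sum length_map
  proof (rule sum.cong)
    fix p assume "p \<in> {..<?n}"
    then have p: "p < ?n" by simp
    obtain i x where ix: "w ! p = (i, x)" by fastforce
    have "letters.lin (\<lambda>l. F (?W[p := l]))"
      using letters.mlinD[OF cone.env_mlin[OF F]] p by (simp add: upd_conv_take_nth_drop)
    then have "F (?W[p := lde L (?W ! p)]) = - F (?W[p := ?y p])"
      using lin_lde[of "\<lambda>l. F (?W[p := l])" True i x] p ix by simp
    also have "?W[p := ?y p] = take p ?W @ ?y p # drop (Suc p) ?W"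
      using p by (simp add: upd_conv_take_nth_drop)
    also have "F \<dots> = letters.hat (lpar (?y p)) (lbr L (?y p)) (\<lambda>v. F (take p ?W @ v)) (drop (Suc p) ?W)"
      using inv by (intro cone.env_move_right[OF F]) (simp add: ix)
    finally show "sg (True \<and> letters.wpar (take p ?W)) * F (?W[p := lde L (?W ! p)]) = (\<Sum>k<?n - Suc p. T p (Suc p + k))"
      by (simp add: cone.hat_sum T_def sum_distrib_left sum_negf del: lpar_simps)
  qed simp
  also have "\<dots> = (\<Sum>(p, q)\<in>{(p, q). p < q \<and> q < ?n}. T p q)" by (rule sum_pairs)
  also have "\<dots> = ce_dII L (\<lambda>w. F (map (Pair True) w)) w"
    unfolding ce_dII_def if_P[OF w]
  proof (rule sum.cong)
    fix pq assume "pq \<in> {(p, q). p < q \<and> q < ?n}"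
    then obtain p q where pq: "pq = (p, q)" "p < q" "q < ?n" by auto
    obtain i x j y where ix: "w ! p = (i, x)" and jy: "w ! q = (j, y)" by fastforce
    define wa where "wa = take p w"
    define wb where "wb = take (q - Suc p) (drop (Suc p) w)"
    define wc where "wc = drop (Suc q) w"
    have lens: "length wa = p" "length wb = q - Suc p" using pq by (auto simp: wa_def wb_def)
    have "drop (Suc p) w = wb @ (j, y) # wc"
      using pq id_take_nth_drop[of "q - Suc p" "drop (Suc p) w"] by (simp add: wb_def wc_def jy)
    moreover have "w = wa @ (i, x) # drop (Suc p) w"
      using pq id_take_nth_drop[of p w] by (simp add: wa_def ix)
    ultimately have wabc: "w = wa @ (i, x) # wb @ (j, y) # wc" by simp
    have xy: "x \<in> gr L i" "y \<in> gr L j" using w by (auto simp: is_word_def wabc)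
    have q: "q = Suc (length wa + length wb)" using pq lens by simp
    have nths: "nths w (- {p, q}) = wa @ wb @ wc"
      using nths_remove2[of wa "(i, x)" wb "(j, y)" wc] by (simp add: wabc q lens(1)[symmetric])
    have sums: "(\<Sum>k<p. sdeg (w ! k)) = (\<Sum>p\<leftarrow>wa. sdeg p)"
      "(\<Sum>k<q. sdeg (w ! k)) = (\<Sum>p\<leftarrow>wa. sdeg p) + (i + 1) + (\<Sum>p\<leftarrow>wb. sdeg p)"
      using sum_list_take[of p w sdeg] sum_list_take[of q w sdeg] pq
      by (simp_all add: wabc q lens(1)[symmetric])
    have lin: "letters.lin (\<lambda>l. F (map (Pair True) (wa @ wb) @ l # map (Pair True) wc))"
      by (rule letters.mlinD[OF cone.env_mlin[OF F]])
    have "T p q = - sg (letters.wpar (map (Pair True) wa)) * (sg (odd i \<and> letters.wpar (map (Pair True) wb)) *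
      F (map (Pair True) (wa @ wb) @ lbr L (False, i, x) (True, j, y) # map (Pair True) wc))"
      unfolding T_def ix jy by (simp add: wabc q lens(1)[symmetric] list_update_append)
    also have "F (map (Pair True) (wa @ wb) @ lbr L (False, i, x) (True, j, y) # map (Pair True) wc) =
      sg (odd i) * F (map (Pair True) (wa @ wb) @ (True, i + j, brk L i j x y) # map (Pair True) wc)"
      using lin_lbr[OF lin, of False i x True j y] xy by simp
    \<comment> \<open>\<epsilon>[x, y] has degree i + j + 1, so it is odd exactly when i + j is
      even.\<close>
    also have "F (map (Pair True) (wa @ wb) @ (True, i + j, brk L i j x y) # map (Pair True) wc) =
      sg (even (i + j) \<and> letters.wpar (map (Pair True) (wa @ wb))) *
        F (map (Pair True) ((i + j, brk L i j x y) # wa @ wb @ wc))"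
      using env_move_left[OF F, of "map (Pair True) (wa @ wb)" "(True, i + j, brk L i j x y)" "map (Pair True) wc"]
      by (simp add: ball_Un)
    finally show "(case pq of (p, q) \<Rightarrow> T p q) = (case pq of (p, q) \<Rightarrow> (-1) powi (sdeg (w ! p)) * koszul_sign {p, q} w *
        F (map (Pair True) ((fst (w ! p) + fst (w ! q), brk L (fst (w ! p)) (fst (w ! q)) (snd (w ! p)) (snd (w ! q)))
           # nths w (- {p, q}))))"
      unfolding pq(1) fst_conv snd_conv prod.case nths koszul_sign_pair[OF pq(2,3)] sums ix jy map_append
        letters.wpar_append wpar_eps powi_sg
      by (cases "odd i"; cases "odd j"; cases "odd (\<Sum>p\<leftarrow>wa. sdeg p)"; cases "odd (\<Sum>p\<leftarrow>wb. sdeg p)") simp_all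
  qed auto
  finally show ?thesis .
qed

end

context two_dglas
begin

sublocale P: dgla "free_product G H"
  by (rule free_product_is_dgla)

abbreviation GH :: "('k, ('k, 'a, 'b) fp_term set) dgla"
  where "GH \<equiv> free_product G H"

section \<open>Splitting functionals over a free product\<close>

abbreviation wf :: "('k, 'a, 'b) fp_term \<Rightarrow> bool"
  where "wf \<equiv> fp_wf G H"

definition letter :: "('k, 'a, 'b) fp_term \<Rightarrow> bool \<times> int \<times> ('k, 'a, 'b) fp_term set"
  where "letter t = (False, fp_deg t, fp_class G H t)"

definition rmul :: "('k, 'a, 'b) fp_term \<Rightarrow> (('k, 'a, 'b) fp_term set lword \<Rightarrow> 'k) \<Rightarrow>
    ('k, 'a, 'b) fp_term set lword \<Rightarrow> 'k"
  where "rmul t F = (\<lambda>w. F (w @ [letter t]))"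

lemma terms: "wf t \<Longrightarrow> t \<in> fp_terms G H (fp_deg t)"
  by (simp add: fp_terms_def)

lemma class_gr: "wf t \<Longrightarrow> fp_class G H t \<in> gr GH (fp_deg t)"
  using terms by (auto simp: fp_ops)

lemma fst_letter [simp]: "\<not> fst (letter t)"
  by (simp add: letter_def)

lemma lpar_letter [simp]: "lpar (letter t) = odd (fp_deg t)"
  by (simp add: letter_def)

lemma letter_cong: "fp_eq G H s t \<Longrightarrow> letter s = letter t"
  using fp_class_eqI fp_eq_wf by (auto simp: letter_def)

lemma rmul_cong: "fp_eq G H s t \<Longrightarrow> rmul s = rmul t"
  by (intro ext) (simp add: rmul_def letter_cong)

lemma rmul_env: "P.cone.env F \<Longrightarrow> P.cone.env (rmul t F)"
  unfolding rmul_def by (rule P.cone.env_suffix)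

lemma lin_last: "P.cone.env F \<Longrightarrow> P.letters.lin (\<lambda>l. F (w @ [l]))"
  by (rule P.letters.mlinD[OF P.cone.env_mlin])

lemma rmul_Zero: "P.cone.env F \<Longrightarrow> rmul (Zero i) F = (\<lambda>w. 0)"
  using P.lin_zero[OF lin_last, of F] by (auto simp: rmul_def letter_def fp_ops)

lemma rmul_Plus:
  assumes "wf s" "wf t" "fp_deg s = fp_deg t" "P.cone.env F"
  shows "rmul (Plus s t) F = (\<lambda>w. rmul s F w + rmul t F w)"
proof
  fix w
  have "fp_class G H (Plus s t) =
      fp_class G H s \<oplus>\<^bsub>homog GH (fp_deg s)\<^esub> fp_class G H t"
    using fp_ops(3)[OF terms[OF assms(1)], of t] terms[OF assms(2)] assms(3) by simp
  then show "rmul (Plus s t) F w = rmul s F w + rmul t F w"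
    using P.lin_plus[OF lin_last[OF assms(4)] class_gr[OF assms(1)], of "fp_class G H t" w False]
      class_gr[OF assms(2)] assms(3)
    by (simp add: rmul_def letter_def)
qed

lemma rmul_Scal:
  assumes "wf s" "P.cone.env F"
  shows "rmul (Scal c s) F = (\<lambda>w. c * rmul s F w)"
proof
  fix w
  show "rmul (Scal c s) F w = c * rmul s F w"
    using P.lin_smult[OF lin_last[OF assms(2)] class_gr[OF assms(1)], of w False c]
      fp_ops(4)[OF terms[OF assms(1)], of c]
    by (simp add: rmul_def letter_def)
qed

lemma lbr_letter:
  assumes "wf s" "wf t"
  shows "lbr GH (letter s) (letter t) = letter (Brk s t)"
  using fp_ops(5)[OF terms[OF assms(1)] terms[OF assms(2)]] class_gr[OF assms(1)] class_gr[OF assms(2)]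
  by (simp add: letter_def lbr_def)

lemma rmul_Brk:
  assumes "wf s" "wf t" "P.cone.env F"
  shows "rmul (Brk s t) F = (\<lambda>w. rmul s (rmul t F) w - sg (odd (fp_deg s) \<and> odd (fp_deg t)) * rmul t (rmul s F) w)"
proof
  fix w
  show "rmul (Brk s t) F w = rmul s (rmul t F) w - sg (odd (fp_deg s) \<and> odd (fp_deg t)) * rmul t (rmul s F) w"
    using P.cone.envD[OF assms(3), of w "letter s" "letter t" "[]"]
    by (simp add: rmul_def lbr_letter[OF assms(1,2)])
qed

lemma rmul_Bdry:
  assumes "P.cone.env F"
  shows rmul_Bdry_Plus: "wf s \<Longrightarrow> wf t \<Longrightarrow> fp_deg s = fp_deg t \<Longrightarrow>
      rmul (Bdry (Plus s t)) F = (\<lambda>w. rmul (Bdry s) F w + rmul (Bdry t) F w)"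
    and rmul_Bdry_Scal: "wf s \<Longrightarrow> rmul (Bdry (Scal c s)) F = (\<lambda>w. c * rmul (Bdry s) F w)"
    and rmul_Bdry_Bdry: "wf s \<Longrightarrow> rmul (Bdry (Bdry s)) F = (\<lambda>w. 0)"
    and rmul_Bdry_Brk: "wf s \<Longrightarrow> wf t \<Longrightarrow> rmul (Bdry (Brk s t)) F =
      (\<lambda>w. rmul (Brk (Bdry s) t) F w + sg (odd (fp_deg s)) * rmul (Brk s (Bdry t)) F w)"
proof -
  show "rmul (Bdry (Plus s t)) F = (\<lambda>w. rmul (Bdry s) F w + rmul (Bdry t) F w)"
    if "wf s" "wf t" "fp_deg s = fp_deg t"
  proof -
    have "rmul (Bdry (Plus s t)) = rmul (Plus (Bdry s) (Bdry t))"
      using that by (intro rmul_cong fp_eq.bdry_add[of _ _ _ "fp_deg s"]) (simp_all add: fp_terms_def)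
    then show ?thesis using that assms by (simp add: rmul_Plus)
  qed
  show "rmul (Bdry (Scal c s)) F = (\<lambda>w. c * rmul (Bdry s) F w)" if "wf s"
  proof -
    have "rmul (Bdry (Scal c s)) = rmul (Scal c (Bdry s))"
      using that by (intro rmul_cong fp_eq.bdry_smult[OF terms])
    then show ?thesis using that assms by (simp add: rmul_Scal)
  qed
  show "rmul (Bdry (Bdry s)) F = (\<lambda>w. 0)" if "wf s"
  proof -
    have "rmul (Bdry (Bdry s)) = rmul (Zero (fp_deg s - 2))"
      using that by (intro rmul_cong fp_eq.bdry_bdry[OF terms])
    then show ?thesis using assms by (simp add: rmul_Zero)
  qed
  show "rmul (Bdry (Brk s t)) F =
      (\<lambda>w. rmul (Brk (Bdry s) t) F w + sg (odd (fp_deg s)) * rmul (Brk s (Bdry t)) F w)"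
    if "wf s" "wf t"
  proof -
    have "rmul (Bdry (Brk s t)) = rmul (Plus (Brk (Bdry s) t) (Scal ((-1) powi fp_deg s) (Brk s (Bdry t))))"
      using that by (intro rmul_cong fp_eq.leibniz[OF terms terms])
    then show ?thesis using that assms by (simp add: rmul_Plus rmul_Scal powi_sg)
  qed
qed

text \<open>The terms that act as zero together with their boundaries are closed under all
  operations. The boundary is carried along because the claim for \<open>Bdry t\<close> does not
  follow from that for \<open>t\<close> alone.\<close>

lemma env_generated:
  assumes F: "P.cone.env F"
    and l: "\<And>w i x. x \<in> gr G i \<Longrightarrow> F (w @ [(False, i, incl_left i x)]) = 0"
    and r: "\<And>w i y. y \<in> gr H i \<Longrightarrow> F (w @ [(False, i, incl_right i y)]) = 0"
  shows "F (w @ [(False, i, p)]) = 0"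
proof -
  have "wf t \<Longrightarrow> rmul t F = (\<lambda>w. 0) \<and> rmul (Bdry t) F = (\<lambda>w. 0)" for t
  proof (induction t)
    case (InL i x)
    then have "rmul (Bdry (InL i x)) = rmul (InL (i - 1) (bdry G i x))"
      by (intro rmul_cong[symmetric] fp_eq.InL_bdry) simp
    then show ?case using l InL G.bdry_closed by (simp add: rmul_def letter_def incl_left_def)
  next
    case (InR i y)
    then have "rmul (Bdry (InR i y)) = rmul (InR (i - 1) (bdry H i y))"
      by (intro rmul_cong[symmetric] fp_eq.InR_bdry) simp
    then show ?case using r InR H.bdry_closed by (simp add: rmul_def letter_def incl_right_def)
  next
    \<comment> \<open>Additivity applied to \<open>Plus (Zero i) (Zero i)\<close> shows that the
      value of the boundary equals its own double.\<close>
    case (Zero i)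
    have "rmul (Bdry (Plus (Zero i) (Zero i))) F = rmul (Bdry (Zero i)) F"
      by (intro fun_cong[OF rmul_cong] fp_eq.Bdry fp_eq.add_zero) (simp add: fp_terms_def)
    then have "rmul (Bdry (Zero i)) F = (\<lambda>w. 0)"
      by (simp add: rmul_Bdry_Plus F fun_eq_iff)
    then show ?case by (simp add: rmul_Zero F)
  next
    case (Plus s t)
    then show ?case by (simp add: rmul_Plus rmul_Bdry_Plus F)
  next
    case (Scal c t)
    then show ?case by (simp add: rmul_Scal rmul_Bdry_Scal F)
  next
    case (Brk s t)
    then show ?case
      by (simp add: rmul_Brk rmul_Bdry_Brk F) (simp add: rmul_def)
  next
    case (Bdry t)
    then show ?case by (simp add: rmul_Bdry_Bdry F)
  qed
  then have "F (w @ [letter t]) = 0" if "wf t" for t using that unfolding rmul_def by metis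
  moreover have "\<exists>t. wf t \<and> (False, i, p) = letter t" if "p \<in> gr GH i"
    using that by (auto simp: fp_ops fp_terms_def letter_def)
  moreover have "F (w @ [(False, i, p)]) = 0" if "p \<notin> gr GH i"
    using P.lin_invalid[OF lin_last[OF F] that] .
  ultimately show ?thesis by metis
qed

text \<open>
  The derivation on the free product with values in functionals (a module by right multiplication)
  that sends \<open>x \<in> G\<close> to \<open>\<zeta>\<close> multiplied by \<open>x\<close> and kills \<open>H\<close>.  The derivation need not commute with the
  differentials, so its value on \<open>d t\<close> has to be carried along as a second component.
\<close>

primrec der_term :: "(('k, 'a, 'b) fp_term set lword \<Rightarrow> 'k) \<Rightarrow> ('k, 'a, 'b) fp_term \<Rightarrow>
    (('k, 'a, 'b) fp_term set lword \<Rightarrow> 'k) \<times>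
    (('k, 'a, 'b) fp_term set lword \<Rightarrow> 'k)" where
  "der_term \<zeta> (InL i x) = (rmul (InL i x) \<zeta>, rmul (Bdry (InL i x)) \<zeta>)"
| "der_term \<zeta> (InR i y) = (\<lambda>w. 0, \<lambda>w. 0)"
| "der_term \<zeta> (Zero i) = (\<lambda>w. 0, \<lambda>w. 0)"
| "der_term \<zeta> (Plus s t) = (\<lambda>w. fst (der_term \<zeta> s) w + fst (der_term \<zeta> t) w, \<lambda>w. snd (der_term \<zeta> s) w + snd (der_term \<zeta> t) w)"
| "der_term \<zeta> (Scal c t) = (\<lambda>w. c * fst (der_term \<zeta> t) w, \<lambda>w. c * snd (der_term \<zeta> t) w)"
| "der_term \<zeta> (Brk s t) =
    (\<lambda>w. rmul s (fst (der_term \<zeta> t)) w - sg (odd (fp_deg s) \<and> odd (fp_deg t)) * rmul t (fst (der_term \<zeta> s)) w,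
     \<lambda>w. (rmul (Bdry s) (fst (der_term \<zeta> t)) w - sg (even (fp_deg s) \<and> odd (fp_deg t)) * rmul t (snd (der_term \<zeta> s)) w) +
       sg (odd (fp_deg s)) *
         (rmul s (snd (der_term \<zeta> t)) w - sg (odd (fp_deg s) \<and> even (fp_deg t)) * rmul (Bdry t) (fst (der_term \<zeta> s)) w))"
| "der_term \<zeta> (Bdry t) = (snd (der_term \<zeta> t), \<lambda>w. 0)"

lemma rmul_linear:
  "rmul t (\<lambda>w. 0) = (\<lambda>w. 0)"
  "rmul t (\<lambda>w. F w + F' w) = (\<lambda>w. rmul t F w + rmul t F' w)"
  "rmul t (\<lambda>w. c * F w) = (\<lambda>w. c * rmul t F w)"
  "rmul t (\<lambda>w. F w - F' w) = (\<lambda>w. rmul t F w - rmul t F' w)"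
  by (simp_all add: rmul_def)

lemma der_term_env:
  assumes "P.cone.env \<zeta>"
  shows "P.cone.env (fst (der_term \<zeta> t))" "P.cone.env (snd (der_term \<zeta> t))"
  by (induction t) (simp_all add: rmul_env assms P.cone.env_0 P.cone.env_add P.cone.env_mult P.cone.env_diff)

text \<open>On G multiplication of \<open>\<zeta>\<close> by \<open>x\<close> is a derivation
  because \<open>rmul\<close> is an action (\<open>rmul_Brk\<close>), and on H the derivation is
  zero, so the relations of both factors are respected. The remaining dgla relations hold because
  the clauses of \<open>der_term\<close> are the derivation rules for an action.\<close>

lemma der_term_eq:
  assumes \<zeta>: "P.cone.env \<zeta>"
  shows "fp_eq G H s t \<Longrightarrow> der_term \<zeta> s = der_term \<zeta> t"
proof (induction rule: fp_eq.induct)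
  case (Plus s s' t t')
  then show ?case by simp
next
  case (Brk s s' t t')
  then show ?case
    using fp_eq_wf[OF Brk(1)] fp_eq_wf[OF Brk(2)]
    by (simp add: rmul_cong[OF Brk(1)] rmul_cong[OF Brk(2)] rmul_cong[OF fp_eq.Bdry[OF Brk(1)]] rmul_cong[OF fp_eq.Bdry[OF Brk(2)]])
next
  case (add_neg s i)
  then show ?case by (simp add: distrib_right[symmetric])
next
  case (brk_add_left s i s' t j)
  then have "wf s" "wf s'" "wf t" "fp_deg s = fp_deg s'" by (auto simp: fp_terms_def)
  then show ?case
    by (simp add: rmul_Plus rmul_Bdry_Plus der_term_env[OF \<zeta>] rmul_linear algebra_simps)
next
  case (brk_add_right s i t j t')
  then have "wf s" "wf t" "wf t'" "fp_deg t = fp_deg t'" by (auto simp: fp_terms_def)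
  then show ?case
    by (simp add: rmul_Plus rmul_Bdry_Plus der_term_env[OF \<zeta>] rmul_linear algebra_simps)
next
  case (brk_smult_left s i t j c)
  then have "wf s" "wf t" by (auto simp: fp_terms_def)
  then show ?case
    by (simp add: rmul_Scal rmul_Bdry_Scal der_term_env[OF \<zeta>] rmul_linear algebra_simps)
next
  case (brk_smult_right s i t j c)
  then have "wf s" "wf t" by (auto simp: fp_terms_def)
  then show ?case
    by (simp add: rmul_Scal rmul_Bdry_Scal der_term_env[OF \<zeta>] rmul_linear algebra_simps)
next
  case (brk_antisym s i t j)
  then have "fp_deg s = i" "fp_deg t = j" by (auto simp: fp_terms_def)
  then show ?case
    by (cases "odd i"; cases "odd j") (simp_all add: algebra_simps)
next
  case (jacobi s i t j u l)
  then have "wf s" "wf t" "wf u" "fp_deg s = i" "fp_deg t = j" "fp_deg u = l" by (auto simp: fp_terms_def)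
  then show ?case
    by (cases "odd i"; cases "odd j"; cases "odd l")
      (simp_all add: rmul_Brk rmul_Bdry_Brk der_term_env[OF \<zeta>] rmul_linear rmul_env powi_sg algebra_simps)
next
  case (leibniz s i t j)
  then have "wf s" "wf t" "fp_deg s = i" "fp_deg t = j" by (auto simp: fp_terms_def)
  then show ?case
    by (cases "odd i"; cases "odd j")
      (simp_all add: rmul_Bdry_Bdry der_term_env[OF \<zeta>] rmul_linear rmul_env powi_sg algebra_simps)
next
  case (InL_add x i x')
  have "InL i x \<in> fp_terms G H i" "InL i x' \<in> fp_terms G H i" using InL_add by (simp_all add: fp_terms_def)
  then show ?case
    using rmul_cong[OF fp_eq.InL_add[OF InL_add]] rmul_cong[OF fp_eq.Bdry[OF fp_eq.InL_add[OF InL_add]]] InL_add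
    by (simp add: rmul_Plus rmul_Bdry_Plus \<zeta>)
next
  case (InL_smult x i c)
  then show ?case
    using rmul_cong[OF fp_eq.InL_smult[OF InL_smult]] rmul_cong[OF fp_eq.Bdry[OF fp_eq.InL_smult[OF InL_smult]]]
    by (simp add: rmul_Scal rmul_Bdry_Scal \<zeta>)
next
  case (InL_brk x i x' j)
  then show ?case
    using rmul_cong[OF fp_eq.InL_brk[OF InL_brk]] rmul_cong[OF fp_eq.Bdry[OF fp_eq.InL_brk[OF InL_brk]]]
    by (simp add: rmul_Brk rmul_Bdry_Brk \<zeta>)
next
  case (InL_bdry x i)
  then show ?case
    using rmul_cong[OF fp_eq.InL_bdry[OF InL_bdry]] rmul_cong[OF fp_eq.Bdry[OF fp_eq.InL_bdry[OF InL_bdry]]]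
    by (simp add: rmul_Bdry_Bdry \<zeta>)
qed (simp_all add: rmul_linear algebra_simps)

text \<open>
  The functional on the enveloping algebra of the free product, extended by \<open>0\<close> to words with
  some \<open>\<epsilon>\<close>-letter, whose multiples by the letters \<open>x\<close> are given by the derivation.
\<close>

definition der_env :: "(('k, 'a, 'b) fp_term set lword \<Rightarrow> 'k) \<Rightarrow>
    ('k, 'a, 'b) fp_term set lword \<Rightarrow> 'k"
  where "der_env \<zeta> u = (if u = [] \<or> (\<exists>l\<in>set u. fst l) then 0 else
    case last u of (e, i, p) \<Rightarrow> if p \<in> gr GH i
      then fst (der_term \<zeta> (SOME t. t \<in> fp_terms G H i \<and> fp_class G H t = p)) (butlast u) else 0)"

lemma letter_cases:
  obtains "fst l" | t where "wf t" "l = letter t" | i p where "l = (False, i, p)" "p \<notin> gr GH i"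
proof -
  obtain e i p where l: "l = (e, i, p)" by (metis prod_cases3)
  have "\<exists>t. wf t \<and> (False, i, p) = letter t" if "p \<in> gr GH i"
    using that by (auto simp: fp_ops fp_terms_def letter_def)
  then consider "e" | t where "\<not> e" "wf t" "(False, i, p) = letter t" | "\<not> e" "p \<notin> gr GH i"
    by blast
  then show ?thesis
  proof cases
    case 1
    then show ?thesis by (intro that(1)) (simp add: l)
  next
    case (2 t)
    then show ?thesis by (intro that(2)[of t]) (simp_all add: l)
  next
    case 3
    then show ?thesis by (intro that(3)[of i p]) (simp_all add: l)
  qed
qed

text \<open>The choice of a representative does not matter, by \<open>der_term_eq\<close>.\<close>

lemma der_env_letter:
  assumes \<zeta>: "P.cone.env \<zeta>" and t: "wf t" and u: "\<forall>l\<in>set u. \<not> fst l"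
  shows "der_env \<zeta> (u @ [letter t]) = fst (der_term \<zeta> t) u"
proof -
  define t' where "t' = (SOME t'. t' \<in> fp_terms G H (fp_deg t) \<and> fp_class G H t' = fp_class G H t)"
  have t': "t' \<in> fp_terms G H (fp_deg t) \<and> fp_class G H t' = fp_class G H t"
    unfolding t'_def by (rule someI[of _ t]) (simp add: terms t)
  then have "t' \<in> fp_class G H t" using fp_class_self by blast
  then have "fp_eq G H t t'" unfolding fp_class_def by (rule CollectD)
  then have "der_term \<zeta> t' = der_term \<zeta> t" by (rule der_term_eq[OF \<zeta>, symmetric])
  then show ?thesis using u class_gr[OF t] by (auto simp: der_env_def letter_def t'_def)
qed

text \<open>For a fixed last letter only a functional of the preceding letters is left, cut off at
  words with an \<epsilon>-letter. This settles every relation that does not touch the end of the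
  word.\<close>

lemma der_env_snoc:
  assumes \<zeta>: "P.cone.env \<zeta>"
  shows "\<exists>A. P.cone.env A \<and> (\<forall>u. der_env \<zeta> (u @ [z]) = (if \<exists>l\<in>set u. fst l then 0 else A u))"
proof (cases z rule: letter_cases)
  case 1
  then have "der_env \<zeta> (u @ [z]) = 0" for u by (simp add: der_env_def)
  then show ?thesis using P.cone.env_0 by (intro exI[of _ "\<lambda>w. 0"]) simp
next
  case (2 t)
  have "der_env \<zeta> (u @ [z]) = (if \<exists>l\<in>set u. fst l then 0 else fst (der_term \<zeta> t) u)" for u
    using der_env_letter[OF \<zeta> 2(1), of u] 2(2) by (cases "\<exists>l\<in>set u. fst l") (simp_all add: der_env_def)
  then show ?thesis using der_term_env(1)[OF \<zeta>] by blast
next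
  case (3 i p)
  then have "der_env \<zeta> (u @ [z]) = 0" for u by (simp add: der_env_def)
  then show ?thesis using P.cone.env_0 by (intro exI[of _ "\<lambda>w. 0"]) simp
qed

lemma der_env_eps: "\<exists>l\<in>set u. fst l \<Longrightarrow> der_env \<zeta> u = 0"
  by (simp add: der_env_def)

lemma lin_not_fst: "P.letters.lin \<phi> \<Longrightarrow> P.letters.lin (\<lambda>l. if fst l then 0 else \<phi> l)"
proof -
  assume "P.letters.lin \<phi>"
  then have "P.letters.lin (\<lambda>l. \<phi> l - (if fst l then \<phi> l else 0))"
    by (intro P.letters.lin_diff P.lin_fst)
  moreover have "(\<lambda>l. \<phi> l - (if fst l then \<phi> l else 0)) = (\<lambda>l. if fst l then 0 else \<phi> l)" by auto
  ultimately show ?thesis by simp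
qed

lemma der_env_mlin:
  assumes \<zeta>: "P.cone.env \<zeta>"
  shows "P.letters.mlin (der_env \<zeta>)"
  unfolding P.letters.mlin_def
proof (intro allI)
  fix u v
  show "P.letters.lin (\<lambda>l. der_env \<zeta> (u @ l # v))"
  proof (cases "\<exists>l\<in>set (u @ v). fst l")
    case True
    then have "(\<lambda>l. der_env \<zeta> (u @ l # v)) = (\<lambda>l. 0)" by (auto simp: der_env_def)
    then show ?thesis by simp
  next
    case False
    then have u: "\<forall>l\<in>set u. \<not> fst l" by auto
    show ?thesis
    proof (cases v rule: rev_cases)
      case Nil
      show ?thesis unfolding Nil
      proof (rule P.linI)
        fix e i x y
        assume "x \<in> gr GH i" "y \<in> gr GH i"
        then obtain s t where st: "s \<in> fp_terms G H i" "x = fp_class G H s" "t \<in> fp_terms G H i" "y = fp_class G H t"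
          by (auto simp: fp_ops)
        then have *: "wf s" "wf t" "fp_deg s = i" "fp_deg t = i" by (auto simp: fp_terms_def)
        have "(False, i, x \<oplus>\<^bsub>homog GH i\<^esub> y) = letter (Plus s t)" "(False, i, x) = letter s"
          "(False, i, y) = letter t"
          using st * by (simp_all add: letter_def fp_ops)
        then show "der_env \<zeta> (u @ [(e, i, x \<oplus>\<^bsub>homog GH i\<^esub> y)]) = der_env \<zeta> (u @ [(e, i, x)]) + der_env \<zeta> (u @ [(e, i, y)])"
          using * u by (cases e) (simp_all add: der_env_eps der_env_letter[OF \<zeta>])
      next
        fix e i c x
        assume "x \<in> gr GH i"
        then obtain s where s: "s \<in> fp_terms G H i" "x = fp_class G H s"
          by (auto simp: fp_ops)
        then have *: "wf s" "fp_deg s = i" by (auto simp: fp_terms_def)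
        have "(False, i, c \<odot>\<^bsub>homog GH i\<^esub> x) = letter (Scal c s)" "(False, i, x) = letter s"
          using s * by (simp_all add: letter_def fp_ops)
        then show "der_env \<zeta> (u @ [(e, i, c \<odot>\<^bsub>homog GH i\<^esub> x)]) = c * der_env \<zeta> (u @ [(e, i, x)])"
          using * u by (cases e) (simp_all add: der_env_eps der_env_letter[OF \<zeta>])
      next
        fix e i x
        assume "x \<notin> gr GH i"
        then show "der_env \<zeta> (u @ [(e, i, x)]) = 0" by (simp add: der_env_def)
      qed
    next
      case (snoc v' z)
      obtain A where A: "P.cone.env A" "\<And>u. der_env \<zeta> (u @ [z]) = (if \<exists>l\<in>set u. fst l then 0 else A u)"
        using der_env_snoc[OF \<zeta>] by blast
      have "der_env \<zeta> (u @ l # v) = (if fst l then 0 else A (u @ l # v'))" for l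
        using A(2)[of "u @ l # v'"] False snoc by auto
      then show ?thesis
        using lin_not_fst[OF P.letters.mlinD[OF P.cone.env_mlin[OF A(1)]], of u v'] by simp
    qed
  qed
qed

text \<open>Away from the end the relation holds because the values of the derivation are
  functionals; at the end it is the derivation rule for \<open>Brk\<close>. This realizes
  derivations into the dual of U(L) as functionals on its augmentation ideal. The cut-off is
  consistent, since a bracket with one \<epsilon>-letter is an \<epsilon>-letter and a bracket of
  two is zero.\<close>

lemma der_env_env:
  assumes \<zeta>: "P.cone.env \<zeta>"
  shows "P.cone.env (der_env \<zeta>)"
proof (rule P.cone.envI[OF der_env_mlin[OF \<zeta>]])
  fix u a b v
  let ?b = "lbr GH a b"
  have lin: "P.letters.lin (\<lambda>l. der_env \<zeta> (u @ l # v))" for u v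
    by (rule P.letters.mlinD[OF der_env_mlin[OF \<zeta>]])
  show "der_env \<zeta> (u @ a # b # v) = P.letters.s a b * der_env \<zeta> (u @ b # a # v) + der_env \<zeta> (u @ ?b # v)"
  proof (cases "(\<exists>l\<in>set (u @ v). fst l) \<or> fst a \<or> fst b")
    case True
    then have "der_env \<zeta> (u @ ?b # v) = 0"
      using P.lin_lbr_eps[OF lin, of a b] by (cases "fst a"; cases "fst b") (auto simp: P.fst_lbr intro!: der_env_eps)
    moreover have "der_env \<zeta> (u @ a # b # v) = 0" "der_env \<zeta> (u @ b # a # v) = 0"
      using True by (intro der_env_eps, force)+
    ultimately show ?thesis by simp
  next
    case False
    show ?thesis
    proof (cases v rule: rev_cases)
      case (snoc v' z)
      obtain A where A: "P.cone.env A" "\<And>u. der_env \<zeta> (u @ [z]) = (if \<exists>l\<in>set u. fst l then 0 else A u)"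
        using der_env_snoc[OF \<zeta>] by blast
      show ?thesis
        using A(2)[of "u @ a # b # v'"] A(2)[of "u @ b # a # v'"] A(2)[of "u @ ?b # v'"] False snoc
          P.cone.envD[OF A(1), of u a b v'] by (auto simp: P.fst_lbr)
    next
      case Nil
      have inv: "der_env \<zeta> (u @ [(False, i, p), l]) = 0" "der_env \<zeta> (u @ [l, (False, i, p)]) = 0"
        if "p \<notin> gr GH i" for i p l
        using P.lin_invalid[OF lin that, of u False "[l]"] P.lin_invalid[OF lin that, of "u @ [l]" False "[]"] by simp_all
      show ?thesis
      proof (cases a rule: letter_cases)
        case (2 s)
        note s = this
        show ?thesis
        proof (cases b rule: letter_cases)
          case (2 t)
          have "der_env \<zeta> (u @ [letter s, letter t]) = fst (der_term \<zeta> t) (u @ [letter s])"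
            "der_env \<zeta> (u @ [letter t, letter s]) = fst (der_term \<zeta> s) (u @ [letter t])"
            "der_env \<zeta> (u @ [letter (Brk s t)]) = fst (der_term \<zeta> (Brk s t)) u"
            using der_env_letter[OF \<zeta>, of t "u @ [letter s]"] der_env_letter[OF \<zeta>, of s "u @ [letter t]"]
              der_env_letter[OF \<zeta>, of "Brk s t" u] False s 2 by auto
          then show ?thesis using s 2 by (simp add: Nil lbr_letter rmul_def)
        next
          case (3 i p)
          then show ?thesis
            using inv[OF 3(2)] P.lin_invalid[OF P.lin_lbr_right[OF lin[of u "[]"], of a] 3(2), of False] by (simp add: Nil)
        qed (use False in auto)
      next
        case (3 i p)
        then show ?thesis
          using inv[OF 3(2)] P.lin_invalid[OF P.lin_lbr_left[OF lin[of u "[]"], of b] 3(2), of False] by (simp add: Nil)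
      qed (use False in auto)
    qed
  qed
qed

lemma der_term_lin:
  assumes "\<And>w. P.letters.lin (\<lambda>l. \<zeta> l w)"
  shows "P.letters.lin (\<lambda>l. fst (der_term (\<zeta> l) t) w)" "P.letters.lin (\<lambda>l. snd (der_term (\<zeta> l) t) w)"
  by (induction t arbitrary: w)
    (simp_all add: rmul_def assms P.letters.lin_add P.letters.lin_diff P.letters.lin_mult)

lemma der_term_mult:
  "der_term (\<lambda>w. c * \<zeta> w) t = (\<lambda>w. c * fst (der_term \<zeta> t) w, \<lambda>w. c * snd (der_term \<zeta> t) w)"
  by (induction t) (simp_all add: rmul_def fun_eq_iff algebra_simps)

lemma der_env_lin:
  assumes "\<And>w. P.letters.lin (\<lambda>l. \<zeta> l w)"
  shows "P.letters.lin (\<lambda>l. der_env (\<zeta> l) u)"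
  unfolding der_env_def
  by (cases "last u"; cases "u = [] \<or> (\<exists>l\<in>set u. fst l)";
      cases "snd (snd (last u)) \<in> gr GH (fst (snd (last u)))")
    (simp_all only: if_True if_False prod.case fst_conv snd_conv der_term_lin(1)[OF assms] P.letters.lin_0)

lemma der_env_mult: "der_env (\<lambda>w. c * \<zeta> w) u = c * der_env \<zeta> u"
  by (simp add: der_env_def der_term_mult split: prod.split)

text \<open>
  \<open>\<Omega> = \<Omega>\<^sub>G + \<Omega>\<^sub>H\<close>, as \<open>\<xi> - \<eta>\<close> is killed by \<open>G\<close> and \<open>\<eta>\<close> by \<open>H\<close>.
\<close>

lemma env_split:
  assumes \<xi>: "P.cone.env \<xi>"
  obtains \<eta> where "P.cone.env \<eta>"
    and "\<And>w i y. y \<in> gr H i \<Longrightarrow> \<eta> (w @ [(False, i, incl_right i y)]) = 0"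
    and "\<And>w i x. x \<in> gr G i \<Longrightarrow> \<eta> (w @ [(False, i, incl_left i x)]) = \<xi> (w @ [(False, i, incl_left i x)])"
proof -
  \<comment> \<open>Over each word \<open>g\<close> of \<epsilon>-letters the derivation is built
    from \<open>\<lambda>w. \<xi> (g @ w)\<close>; \<open>lift\<close> assembles these
    pieces.\<close>
  define f where "f g u = (if \<forall>l\<in>set g. fst l then der_env (\<lambda>w. \<xi> (g @ w)) u else 0)"
    for g u :: "('k, 'a, 'b) fp_term set lword"
  have env: "P.cone.env (\<lambda>w. \<xi> (g @ w))" for g
    using P.cone.env_append[OF \<xi>, of g "[]"] by simp
  have inv: "P.cone.sym_env f"
    unfolding P.cone.sym_env_def
  proof (intro conjI allI)
    fix u g
    show "P.letters.gsym (\<lambda>g. f g u)"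
    proof (rule P.letters.symI)
      fix x y :: "('k, 'a, 'b) fp_term set lword" and a b :: "bool \<times> int \<times> ('k, 'a, 'b) fp_term set"
      show "f (x @ a # b # y) u = P.letters.s a b * f (x @ b # a # y) u"
      proof (cases "\<forall>l\<in>set (x @ a # b # y). fst l")
        case True
        have "\<xi> ((x @ a # b # y) @ w) = P.letters.s a b * \<xi> ((x @ b # a # y) @ w)" for w
          using P.cone.envD[OF \<xi>, of x a b "y @ w"] True
            P.lin_lbr_eps[OF P.letters.mlinD[OF P.cone.env_mlin[OF \<xi>]], of a b x "y @ w"] by simp
        then have "(\<lambda>w. \<xi> ((x @ a # b # y) @ w)) = (\<lambda>w. P.letters.s a b * \<xi> ((x @ b # a # y) @ w))"
          by (rule ext)
        then have "der_env (\<lambda>w. \<xi> ((x @ a # b # y) @ w)) u = P.letters.s a b * der_env (\<lambda>w. \<xi> ((x @ b # a # y) @ w)) u"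
          by (simp only: der_env_mult)
        then show ?thesis using True by (simp add: f_def)
      qed (auto simp: f_def)
    qed
    show "P.letters.mlin (\<lambda>g. f g u)"
      unfolding P.letters.mlin_def
    proof (intro allI)
      fix x y :: "('k, 'a, 'b) fp_term set lword"
      show "P.letters.lin (\<lambda>l. f (x @ l # y) u)"
      proof (cases "\<forall>l\<in>set (x @ y). fst l")
        case True
        then have "(\<lambda>l. f (x @ l # y) u) = (\<lambda>l. if fst l then der_env (\<lambda>w. \<xi> (x @ l # y @ w)) u else 0)"
          by (auto simp: f_def)
        moreover have "P.letters.lin (\<lambda>l. if fst l then der_env (\<lambda>w. \<xi> (x @ l # y @ w)) u else 0)"
          by (intro P.lin_fst der_env_lin P.letters.mlinD[OF P.cone.env_mlin[OF \<xi>]])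
        ultimately show ?thesis by simp
      next
        case False
        then have "f (x @ l # y) u = 0" for l unfolding f_def by (intro if_not_P) force
        then show ?thesis by simp
      qed
    qed
    have "P.cone.env (\<lambda>u. if b then F u else 0)" if "P.cone.env F" for b F
      using that P.cone.env_0 by (cases b) simp_all
    then show "P.cone.env (f g)"
      unfolding f_def[abs_def] using der_env_env[OF env] by blast
  qed
  let ?\<eta> = "P.cone.lift fst f"
  have \<eta>: "P.cone.env ?\<eta>"
    by (rule P.cone.lift_env[where Q = fst, OF P.fst_lbr _ _ inv]) (simp_all add: P.lin_lbr_eps P.lin_fst)
  have sorted: "?\<eta> (g @ u) = f g u" if "\<forall>l\<in>set g. fst l" "\<forall>l\<in>set u. \<not> fst l" for g u
    using that by (intro P.cone.lift_sorted[where Q = fst, OF P.fst_lbr]) (simp_all add: P.lin_lbr_eps P.lin_fst)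
  have letter: "?\<eta> (g @ u @ [letter t]) = fst (der_term (\<lambda>w. \<xi> (g @ w)) t) u"
    if "\<forall>l\<in>set g. fst l" "\<forall>l\<in>set u. \<not> fst l" "wf t" for g u t
    using sorted[of g "u @ [letter t]"] that der_env_letter[OF env, of t u g] by (auto simp: f_def)
  show ?thesis
  proof (rule that[OF \<eta>])
    fix w i y assume "y \<in> gr H i"
    then have y: "wf (InR i y)" "(False, i, incl_right i y) = letter (InR i y)"
      by (simp_all add: letter_def incl_right_def)
    have "?\<eta> (w @ [letter (InR i y)]) = 0"
    proof (rule P.cone.env_sorted_eq_0[where Q = fst and F = "\<lambda>w. ?\<eta> (w @ [letter (InR i y)])"])
      show "P.cone.env (\<lambda>w. ?\<eta> (w @ [letter (InR i y)]))" by (rule P.cone.env_suffix[OF \<eta>])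
      fix g u :: "('k, 'a, 'b) fp_term set lword"
      assume "\<forall>l\<in>set g. fst l" "\<forall>l\<in>set u. \<not> fst l"
      then show "?\<eta> ((g @ u) @ [letter (InR i y)]) = 0"
        using letter[of g u "InR i y"] y by simp
    qed
    then show "?\<eta> (w @ [(False, i, incl_right i y)]) = 0"
      using y by simp
  next
    fix w i x assume "x \<in> gr G i"
    then have x: "wf (InL i x)" "(False, i, incl_left i x) = letter (InL i x)"
      by (simp_all add: letter_def incl_left_def)
    have "?\<eta> (w @ [letter (InL i x)]) - \<xi> (w @ [letter (InL i x)]) = 0"
    proof (rule P.cone.env_sorted_eq_0[where Q = fst and F = "\<lambda>w. ?\<eta> (w @ [letter (InL i x)]) - \<xi> (w @ [letter (InL i x)])"])
      show "P.cone.env (\<lambda>w. ?\<eta> (w @ [letter (InL i x)]) - \<xi> (w @ [letter (InL i x)]))"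
        by (intro P.cone.env_diff P.cone.env_suffix \<eta> \<xi>)
      fix g u :: "('k, 'a, 'b) fp_term set lword"
      assume "\<forall>l\<in>set g. fst l" "\<forall>l\<in>set u. \<not> fst l"
      then show "?\<eta> ((g @ u) @ [letter (InL i x)]) - \<xi> ((g @ u) @ [letter (InL i x)]) = 0"
        using letter[of g u "InL i x"] x by (simp add: rmul_def)
    qed
    then show "?\<eta> (w @ [(False, i, incl_left i x)]) = \<xi> (w @ [(False, i, incl_left i x)])"
      using x by simp
  qed
qed

end

section \<open>Pullback of cochains\<close>

definition ce_d :: "('k::field_char_0, 'a) dgla \<Rightarrow> ((int \<times> 'a) list \<Rightarrow> 'k) \<Rightarrow> (int \<times> 'a) list \<Rightarrow> 'k"
  where "ce_d L f w = ce_dI L f w + ce_dII L f w"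

definition wmap :: "(int \<Rightarrow> 'a \<Rightarrow> 'b) \<Rightarrow> (int \<times> 'a) list \<Rightarrow> (int \<times> 'b) list"
  where "wmap \<psi> = map (\<lambda>(i, x). (i, \<psi> i x))"

definition pullback :: "('k::field_char_0, 'a) dgla \<Rightarrow> (int \<Rightarrow> 'a \<Rightarrow> 'b) \<Rightarrow> ((int \<times> 'b) list \<Rightarrow> 'k) \<Rightarrow> (int \<times> 'a) list \<Rightarrow> 'k"
  where "pullback L \<psi> f w = (if is_word L w then f (wmap \<psi> w) else 0)"

lemma wmap_simps [simp]:
  "wmap \<psi> [] = []"
  "wmap \<psi> ((i, x) # w) = (i, \<psi> i x) # wmap \<psi> w"
  "wmap \<psi> (u @ v) = wmap \<psi> u @ wmap \<psi> v"
  "length (wmap \<psi> w) = length w"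
  "wmap \<psi> w = [] \<longleftrightarrow> w = []"
  by (simp_all add: wmap_def)

lemma wmap_nth: "r < length w \<Longrightarrow> wmap \<psi> w ! r = (fst (w ! r), \<psi> (fst (w ! r)) (snd (w ! r)))"
  by (simp add: wmap_def case_prod_beta)

lemma wmap_nths: "nths (wmap \<psi> w) A = wmap \<psi> (nths w A)"
  by (simp add: wmap_def nths_map)

lemma wmap_update: "wmap \<psi> (w[r := (i, x)]) = (wmap \<psi> w)[r := (i, \<psi> i x)]"
  by (simp add: wmap_def map_update)

lemma sdeg_wmap: "(\<Sum>p\<leftarrow>wmap \<psi> w. sdeg p) = (\<Sum>p\<leftarrow>w. sdeg p)"
  by (induction w) auto

lemma is_word_simps [simp]:
  "is_word L []"
  "is_word L ((i, x) # w) \<longleftrightarrow> x \<in> gr L i \<and> is_word L w"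
  "is_word L (u @ v) \<longleftrightarrow> is_word L u \<and> is_word L v"
  by (auto simp: is_word_def)

lemma is_word_nth: "is_word L w \<Longrightarrow> r < length w \<Longrightarrow> snd (w ! r) \<in> gr L (fst (w ! r))"
  by (simp add: is_word_def)

lemma is_word_nths: "is_word L w \<Longrightarrow> is_word L (nths w A)"
  using set_nths_subset[of w A] by (auto simp: is_word_def)

lemma is_word_update: "is_word L w \<Longrightarrow> x \<in> gr L i \<Longrightarrow> is_word L (w[r := (i, x)])"
  using set_update_subset_insert[of w r "(i, x)"] by (auto simp: is_word_def)

lemma koszul_sign_wmap: "koszul_sign A (wmap \<psi> w) = koszul_sign A w"
proof -
  have "(\<Sum>(p, q)\<in>{(p, q). p < q \<and> q < length w \<and> p \<notin> A \<and> q \<in> A}. sdeg (wmap \<psi> w ! p) * sdeg (wmap \<psi> w ! q)) =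
    (\<Sum>(p, q)\<in>{(p, q). p < q \<and> q < length w \<and> p \<notin> A \<and> q \<in> A}. sdeg (w ! p) * sdeg (w ! q))"
    by (rule sum.cong) (auto simp: wmap_nth)
  then show ?thesis by (simp add: koszul_sign_def)
qed

lemma cochains_D:
  assumes "f \<in> cochains L m"
  shows cochains_supp: "f w \<noteq> 0 \<Longrightarrow> w \<noteq> [] \<and> is_word L w \<and> (\<Sum>p\<leftarrow>w. sdeg p) = m"
    and cochains_plus: "x \<in> gr L i \<Longrightarrow> y \<in> gr L i \<Longrightarrow>
      f (u @ (i, x \<oplus>\<^bsub>homog L i\<^esub> y) # v) = f (u @ (i, x) # v) + f (u @ (i, y) # v)"
    and cochains_smult: "x \<in> gr L i \<Longrightarrow> f (u @ (i, c \<odot>\<^bsub>homog L i\<^esub> x) # v) = c * f (u @ (i, x) # v)"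
    and cochains_sym: "f (u @ p # q # v) = (-1) powi (sdeg p * sdeg q) * f (u @ q # p # v)"
proof -
  show "f w \<noteq> 0 \<Longrightarrow> w \<noteq> [] \<and> is_word L w \<and> (\<Sum>p\<leftarrow>w. sdeg p) = m"
    using assms unfolding cochains_def by blast
  show "f (u @ (i, x \<oplus>\<^bsub>homog L i\<^esub> y) # v) = f (u @ (i, x) # v) + f (u @ (i, y) # v)"
    if "x \<in> gr L i" "y \<in> gr L i" using assms that unfolding cochains_def by blast
  show "f (u @ (i, c \<odot>\<^bsub>homog L i\<^esub> x) # v) = c * f (u @ (i, x) # v)"
    if "x \<in> gr L i" using assms that unfolding cochains_def by blast
  show "f (u @ p # q # v) = (-1) powi (sdeg p * sdeg q) * f (u @ q # p # v)"
    using assms unfolding cochains_def by blast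
qed

lemma cochainsI:
  assumes "\<And>w. f w \<noteq> 0 \<Longrightarrow> w \<noteq> [] \<and> is_word L w \<and> (\<Sum>p\<leftarrow>w. sdeg p) = m"
    and "\<And>u v i x y. x \<in> gr L i \<Longrightarrow> y \<in> gr L i \<Longrightarrow>
      f (u @ (i, x \<oplus>\<^bsub>homog L i\<^esub> y) # v) = f (u @ (i, x) # v) + f (u @ (i, y) # v)"
    and "\<And>u v i c x. x \<in> gr L i \<Longrightarrow> f (u @ (i, c \<odot>\<^bsub>homog L i\<^esub> x) # v) = c * f (u @ (i, x) # v)"
    and "\<And>u v p q. f (u @ p # q # v) = (-1) powi (sdeg p * sdeg q) * f (u @ q # p # v)"
  shows "f \<in> cochains L m"
  unfolding cochains_def by (intro CollectI conjI allI impI ballI assms)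

lemma dgla_homD:
  assumes "dgla_hom L M \<psi>"
  shows hom_closed: "x \<in> gr L i \<Longrightarrow> \<psi> i x \<in> gr M i"
    and hom_plus: "x \<in> gr L i \<Longrightarrow> y \<in> gr L i \<Longrightarrow> \<psi> i (x \<oplus>\<^bsub>homog L i\<^esub> y) = \<psi> i x \<oplus>\<^bsub>homog M i\<^esub> \<psi> i y"
    and hom_smult: "x \<in> gr L i \<Longrightarrow> \<psi> i (c \<odot>\<^bsub>homog L i\<^esub> x) = c \<odot>\<^bsub>homog M i\<^esub> \<psi> i x"
    and hom_brk: "x \<in> gr L i \<Longrightarrow> y \<in> gr L j \<Longrightarrow> \<psi> (i + j) (brk L i j x y) = brk M i j (\<psi> i x) (\<psi> j y)"
    and hom_bdry: "x \<in> gr L i \<Longrightarrow> \<psi> (i - 1) (bdry L i x) = bdry M i (\<psi> i x)"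
  using assms unfolding dgla_hom_def by blast+

lemma is_word_wmap: "dgla_hom L M \<psi> \<Longrightarrow> is_word L w \<Longrightarrow> is_word M (wmap \<psi> w)"
  by (induction w) (auto simp: hom_closed)

lemma wmap_comp: "wmap \<psi> (wmap \<chi> w) = wmap (\<lambda>i x. \<psi> i (\<chi> i x)) w"
  by (induction w) auto

lemma wmap_id: "(\<And>i x. x \<in> gr L i \<Longrightarrow> \<psi> i x = x) \<Longrightarrow> is_word L w \<Longrightarrow> wmap \<psi> w = w"
  by (induction w) auto

lemma dgla_hom_comp:
  assumes "dgla_hom K L \<psi>" "dgla_hom L M \<chi>"
  shows "dgla_hom K M (\<lambda>i x. \<chi> i (\<psi> i x))"
  using assms unfolding dgla_hom_def by simp

lemma pullback_add: "pullback L \<psi> (\<lambda>w. f w + g w) = (\<lambda>w. pullback L \<psi> f w + pullback L \<psi> g w)"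
  by (simp add: pullback_def fun_eq_iff)

lemma pullback_smult: "pullback L \<psi> (\<lambda>w. c * f w) = (\<lambda>w. c * pullback L \<psi> f w)"
  by (simp add: pullback_def fun_eq_iff)

lemma pullback_mult:
  "ce_mult (pullback L \<psi> f) (pullback L \<psi> g) w = pullback L \<psi> (ce_mult f g) w"
proof (cases "is_word L w")
  case True
  then show ?thesis
    by (simp add: ce_mult_def pullback_def is_word_nths wmap_nths koszul_sign_wmap)
next
  case False
  have "is_word L (nths w A) \<Longrightarrow> is_word L (nths w (- A)) \<Longrightarrow> is_word L w" for A
    unfolding is_word_def by (fastforce simp: set_nths in_set_conv_nth)
  then have "koszul_sign A w * pullback L \<psi> f (nths w A) * pullback L \<psi> g (nths w (- A)) = 0" for A
    using False by (auto simp: pullback_def)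
  then have "ce_mult (pullback L \<psi> f) (pullback L \<psi> g) w = 0"
    unfolding ce_mult_def by (intro sum.neutral) blast
  then show ?thesis using False by (simp add: pullback_def)
qed

context dgla
begin

lemma smult_0: "x \<in> gr L i \<Longrightarrow> 0 \<odot>\<^bsub>homog L i\<^esub> x = \<zero>\<^bsub>homog L i\<^esub>"
proof -
  interpret M: Module.module "ring_of_type_algebra :: 'k ring" "homog L i" by (rule vs)
  show "x \<in> gr L i \<Longrightarrow> 0 \<odot>\<^bsub>homog L i\<^esub> x = \<zero>\<^bsub>homog L i\<^esub>"
    using M.smult_l_null[of x] by (simp add: ring_of_type_algebra_def)
qed

lemma zero_ops:
  "c \<odot>\<^bsub>homog L i\<^esub> \<zero>\<^bsub>homog L i\<^esub> = \<zero>\<^bsub>homog L i\<^esub>"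
  "brk L i j \<zero>\<^bsub>homog L i\<^esub> \<zero>\<^bsub>homog L j\<^esub> = \<zero>\<^bsub>homog L (i + j)\<^esub>"
  "bdry L i \<zero>\<^bsub>homog L i\<^esub> = \<zero>\<^bsub>homog L (i - 1)\<^esub>"
  using vs_smult_assoc[of "\<zero>\<^bsub>homog L i\<^esub>" i c 0] smult_0[OF vs_zero_closed, of i]
    brk_smult_left[of "\<zero>\<^bsub>homog L i\<^esub>" i "\<zero>\<^bsub>homog L j\<^esub>" j 0]
    bdry_smult[of "\<zero>\<^bsub>homog L i\<^esub>" i 0]
    smult_0[OF brk_closed[OF vs_zero_closed vs_zero_closed], of i j]
    smult_0[OF bdry_closed[OF vs_zero_closed], of i]
  by (simp_all add: vs_zero_closed)

lemma zero_hom: "dgla_hom K L (\<lambda>i x. \<zero>\<^bsub>homog L i\<^esub>)"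
  unfolding dgla_hom_def by (auto simp: zero_ops vs_zero_closed vs_zero)

lemma cochains_zero:
  assumes "f \<in> cochains L m"
  shows "f (u @ (i, \<zero>\<^bsub>homog L i\<^esub>) # v) = 0"
  using cochains_smult[OF assms vs_zero_closed, of u i 0 v] by (simp add: zero_ops)

lemma pullback_cochains:
  assumes \<psi>: "dgla_hom L M \<psi>" and f: "f \<in> cochains M m"
  shows "pullback L \<psi> f \<in> cochains L m"
proof (rule cochainsI)
  fix w
  assume "pullback L \<psi> f w \<noteq> 0"
  then have "is_word L w" "f (wmap \<psi> w) \<noteq> 0" by (auto simp: pullback_def split: if_splits)
  then show "w \<noteq> [] \<and> is_word L w \<and> (\<Sum>p\<leftarrow>w. sdeg p) = m"
    using cochains_supp[OF f, of "wmap \<psi> w"] sdeg_wmap[of \<psi> w] by auto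
next
  fix u v i x y
  assume "x \<in> gr L i" "y \<in> gr L i"
  then show "pullback L \<psi> f (u @ (i, x \<oplus>\<^bsub>homog L i\<^esub> y) # v) =
      pullback L \<psi> f (u @ (i, x) # v) + pullback L \<psi> f (u @ (i, y) # v)"
    by (simp add: pullback_def vs_add_closed hom_plus[OF \<psi>] cochains_plus[OF f] hom_closed[OF \<psi>])
next
  fix u v i c x
  assume "x \<in> gr L i"
  then show "pullback L \<psi> f (u @ (i, c \<odot>\<^bsub>homog L i\<^esub> x) # v) = c * pullback L \<psi> f (u @ (i, x) # v)"
    by (simp add: pullback_def vs_smult_closed hom_smult[OF \<psi>] cochains_smult[OF f] hom_closed[OF \<psi>])
next
  fix u v p q
  show "pullback L \<psi> f (u @ p # q # v) = (-1) powi (sdeg p * sdeg q) * pullback L \<psi> f (u @ q # p # v)"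
    using cochains_sym[OF f, of "wmap \<psi> u" "(fst p, \<psi> (fst p) (snd p))" "(fst q, \<psi> (fst q) (snd q))" "wmap \<psi> v"]
    by (cases p; cases q) (auto simp: pullback_def)
qed

lemma pullback_ce_d:
  assumes \<psi>: "dgla_hom L M \<psi>"
  shows "ce_d L (pullback L \<psi> f) w = pullback L \<psi> (ce_d M f) w"
proof (cases "is_word L w")
  case True
  note w = True
  have "ce_dI L (pullback L \<psi> f) w = ce_dI M f (wmap \<psi> w)"
    unfolding ce_dI_def if_P[OF w] if_P[OF is_word_wmap[OF \<psi> w]]
  proof (rule sum.cong)
    fix r assume "r \<in> {..<length (wmap \<psi> w)}"
    then have r: "r < length w" by simp
    have "(\<Sum>q<r. sdeg (wmap \<psi> w ! q)) = (\<Sum>q<r. sdeg (w ! q))"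
      using r by (intro sum.cong) (auto simp: wmap_nth)
    then show "- ((- 1) powi (\<Sum>q<r. sdeg (w ! q))) *
        pullback L \<psi> f (w[r := (fst (w ! r) - 1, bdry L (fst (w ! r)) (snd (w ! r)))]) =
      - ((- 1) powi (\<Sum>q<r. sdeg (wmap \<psi> w ! q))) * f ((wmap \<psi> w)[r := (fst (wmap \<psi> w ! r) - 1,
          bdry M (fst (wmap \<psi> w ! r)) (snd (wmap \<psi> w ! r)))])"
      using is_word_nth[OF w r] r
      by (simp add: pullback_def is_word_update w bdry_closed wmap_update hom_bdry[OF \<psi>] wmap_nth)
  qed simp
  moreover have "ce_dII L (pullback L \<psi> f) w = ce_dII M f (wmap \<psi> w)"
    unfolding ce_dII_def if_P[OF w] if_P[OF is_word_wmap[OF \<psi> w]]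
  proof (rule sum.cong)
    fix pq assume "pq \<in> {(p, q). p < q \<and> q < length (wmap \<psi> w)}"
    then obtain p q where pq: "pq = (p, q)" "p < q" "q < length w" by auto
    then show "(case pq of (p, q) \<Rightarrow> (- 1) powi sdeg (w ! p) * koszul_sign {p, q} w *
        pullback L \<psi> f ((fst (w ! p) + fst (w ! q), brk L (fst (w ! p)) (fst (w ! q)) (snd (w ! p)) (snd (w ! q)))
          # nths w (- {p, q}))) =
      (case pq of (p, q) \<Rightarrow> (- 1) powi sdeg (wmap \<psi> w ! p) * koszul_sign {p, q} (wmap \<psi> w) *
        f ((fst (wmap \<psi> w ! p) + fst (wmap \<psi> w ! q),
            brk M (fst (wmap \<psi> w ! p)) (fst (wmap \<psi> w ! q)) (snd (wmap \<psi> w ! p)) (snd (wmap \<psi> w ! q)))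
          # nths (wmap \<psi> w) (- {p, q})))"
      using is_word_nth[OF w, of p] is_word_nth[OF w, of q]
      by (simp add: pullback_def is_word_nths w brk_closed hom_brk[OF \<psi>] wmap_nth wmap_nths koszul_sign_wmap)
  qed simp
  ultimately show ?thesis by (simp add: ce_d_def pullback_def w)
qed (simp add: ce_d_def ce_dI_def ce_dII_def pullback_def)

text \<open>Both parts of the differential look at words of total degree one less: the boundary
  lowers one letter, and the bracket merges degrees i + 1 and j + 1 into i + j + 1.\<close>

lemma ce_d_cong:
  assumes w: "is_word L w"
    and fg: "\<And>v. v \<noteq> [] \<Longrightarrow> is_word L v \<Longrightarrow> (\<Sum>p\<leftarrow>v. sdeg p) = (\<Sum>p\<leftarrow>w. sdeg p) - 1 \<Longrightarrow> f v = g v"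
  shows "ce_d L f w = ce_d L g w"
proof -
  have "ce_dI L f w = ce_dI L g w"
    unfolding ce_dI_def if_P[OF w]
  proof (rule sum.cong)
    fix r assume "r \<in> {..<length w}"
    then have r: "r < length w" by simp
    let ?v = "w[r := (fst (w ! r) - 1, bdry L (fst (w ! r)) (snd (w ! r)))]"
    have "w = take r w @ w ! r # drop (Suc r) w" by (rule id_take_nth_drop[OF r])
    then have "(\<Sum>p\<leftarrow>w. sdeg p) = (\<Sum>p\<leftarrow>take r w @ w ! r # drop (Suc r) w. sdeg p)" by (rule arg_cong)
    then have "(\<Sum>p\<leftarrow>?v. sdeg p) = (\<Sum>p\<leftarrow>w. sdeg p) - 1"
      using r by (simp add: upd_conv_take_nth_drop)
    then have "f ?v = g ?v"
      using r is_word_nth[OF w r] by (intro fg is_word_update w bdry_closed) auto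
    then show "- ((- 1) powi (\<Sum>q<r. sdeg (w ! q))) * f ?v = - ((- 1) powi (\<Sum>q<r. sdeg (w ! q))) * g ?v"
      by simp
  qed simp
  moreover have "ce_dII L f w = ce_dII L g w"
    unfolding ce_dII_def if_P[OF w]
  proof (rule sum.cong)
    fix pq assume "pq \<in> {(p, q). p < q \<and> q < length w}"
    then obtain p q where pq: "pq = (p, q)" "p < q" "q < length w" by auto
    let ?v = "(fst (w ! p) + fst (w ! q), brk L (fst (w ! p)) (fst (w ! q)) (snd (w ! p)) (snd (w ! q)))
          # nths w (- {p, q})"
    obtain x y z where xyz: "w = x @ w ! p # y @ w ! q # z" "nths w (- {p, q}) = x @ y @ z"
      using pair_decomposition[OF pq(2,3)] .
    have "(\<Sum>p\<leftarrow>w. sdeg p) = (\<Sum>p\<leftarrow>x @ w ! p # y @ w ! q # z. sdeg p)"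
      using xyz(1) by (rule arg_cong)
    then have "(\<Sum>p\<leftarrow>?v. sdeg p) = (\<Sum>p\<leftarrow>w. sdeg p) - 1"
      by (simp add: xyz(2))
    then have "f ?v = g ?v"
      using is_word_nth[OF w, of p] is_word_nth[OF w, of q] pq
      by (intro fg) (auto simp: is_word_nths w brk_closed)
    then show "(case pq of (p, q) \<Rightarrow> (- 1) powi sdeg (w ! p) * koszul_sign {p, q} w *
        f ((fst (w ! p) + fst (w ! q), brk L (fst (w ! p)) (fst (w ! q)) (snd (w ! p)) (snd (w ! q)))
          # nths w (- {p, q}))) =
      (case pq of (p, q) \<Rightarrow> (- 1) powi sdeg (w ! p) * koszul_sign {p, q} w *
        g ((fst (w ! p) + fst (w ! q), brk L (fst (w ! p)) (fst (w ! q)) (snd (w ! p)) (snd (w ! q)))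
          # nths w (- {p, q})))"
      by (simp add: pq(1))
  qed simp
  ultimately show ?thesis by (simp add: ce_d_def)
qed

lemma D_eps:
  assumes F: "cone.env F" and inv: "\<And>w i x. F (w @ [(False, i, x)]) = 0" and w: "is_word L w"
  shows "D F (map (Pair True) w) = ce_d L (\<lambda>w. F (map (Pair True) w)) w"
  by (simp add: D_def ce_d_def hat_ldI_eps[OF cone.env_mlin[OF F] w] hat_lde_eps[OF F inv w])

lemma env_invalid:
  assumes "letters.mlin F" and "\<not> is_word L w"
  shows "F (map (Pair True) w) = 0"
proof -
  obtain p where p: "p \<in> set w" "snd p \<notin> gr L (fst p)" using assms(2) by (auto simp: is_word_def)
  then obtain u v where "w = u @ p # v" by (meson split_list)
  then show ?thesis
    using lin_invalid[OF letters.mlinD[OF assms(1)] p(2), of "map (Pair True) u" True "map (Pair True) v"] by simp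
qed

text \<open>A sorted word with some letter of L ends in such a letter and gives zero, so only words
  in \<epsilon>-letters remain to be tested.\<close>

lemma env_inv_eq_0:
  assumes F: "cone.env F" and inv: "\<And>w i x. F (w @ [(False, i, x)]) = 0"
    and w: "\<And>w. is_word L w \<Longrightarrow> F (map (Pair True) w) = 0"
  shows "F w = 0"
proof (rule cone.env_sorted_eq_0[OF F, where Q = fst])
  fix g u :: "'a lword"
  assume g: "\<forall>l\<in>set g. fst l" and u: "\<forall>l\<in>set u. \<not> fst l"
  show "F (g @ u) = 0"
  proof (cases u rule: rev_cases)
    case Nil
    have "g = map (Pair True) (map snd g)" using g by (induction g) auto
    then show ?thesis using w env_invalid[OF cone.env_mlin[OF F]] Nil by (metis append_Nil2)
  next
    case (snoc u' l)
    then show ?thesis using u inv[of "g @ u'" "fst (snd l)" "snd (snd l)"] by (cases l) auto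
  qed
qed

lemma lin_lmap:
  assumes "letters.lin \<phi>"
  shows "\<phi> (lmap L L \<rho> (e, i, x)) = (if x \<in> gr L i then \<phi> (e, i, \<rho> i x) else 0)"
  by (simp add: lmap_def lin_zero[OF assms])

lemma lmap_hom:
  assumes \<rho>: "dgla_hom L L \<rho>" and \<phi>: "letters.lin \<phi>"
  shows lmap_lin: "letters.lin (\<lambda>a. \<phi> (lmap L L \<rho> a))"
    and lmap_lbr: "\<phi> (lmap L L \<rho> (lbr L a b)) = \<phi> (lbr L (lmap L L \<rho> a) (lmap L L \<rho> b))"
    and lmap_ldI: "\<phi> (lmap L L \<rho> (ldI L a)) = \<phi> (ldI L (lmap L L \<rho> a))"
    and lmap_lde: "\<phi> (lmap L L \<rho> (lde L a)) = \<phi> (lde L (lmap L L \<rho> a))"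
proof -
  have lin: "letters.lin (\<lambda>a. \<phi> (lmap L L \<rho> a))" if "letters.lin \<phi>" for \<phi>
    by (rule linI) (simp_all add: lin_lmap[OF that] vs_ops(1,2) hom_plus[OF \<rho>] hom_smult[OF \<rho>] hom_closed[OF \<rho>]
        lin_plus[OF that] lin_smult[OF that])
  obtain e i x where a: "a = (e, i, x)" by (metis prod_cases3)
  obtain f j y where b: "b = (f, j, y)" by (metis prod_cases3)
  show L: "letters.lin (\<lambda>a. \<phi> (lmap L L \<rho> a))" by (rule lin[OF \<phi>])
  have "\<phi> (lmap L L \<rho> (lbr L a b)) = (if x \<in> gr L i \<and> y \<in> gr L j \<and> \<not> (e \<and> f)
    then sg (\<not> e \<and> f \<and> odd i) * \<phi> (e \<noteq> f, i + j, brk L i j (\<rho> i x) (\<rho> j y)) else 0)"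
    unfolding a b using lin_lbr[OF L, of e i x f j y] by (auto simp: lin_lmap[OF \<phi>] brk_closed hom_brk[OF \<rho>])
  also have "\<dots> = \<phi> (lbr L (lmap L L \<rho> a) (lmap L L \<rho> b))"
    unfolding a b using lin_lmap[OF lin_lbr_left[OF \<phi>], of \<rho> e i x] lin_lmap[OF lin_lbr_right[OF \<phi>], of _ \<rho> f j y]
    by (auto simp: lin_lbr[OF \<phi>] hom_closed[OF \<rho>])
  finally show "\<phi> (lmap L L \<rho> (lbr L a b)) = \<phi> (lbr L (lmap L L \<rho> a) (lmap L L \<rho> b))" .
  show "\<phi> (lmap L L \<rho> (ldI L a)) = \<phi> (ldI L (lmap L L \<rho> a))"
    unfolding a using lin_ldI[OF L, of e i x] lin_lmap[OF lin_comp_ldI[OF \<phi>], of \<rho> e i x]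
    by (simp add: lin_lmap[OF \<phi>] lin_ldI[OF \<phi>] bdry_closed hom_closed[OF \<rho>] hom_bdry[OF \<rho>])
  show "\<phi> (lmap L L \<rho> (lde L a)) = \<phi> (lde L (lmap L L \<rho> a))"
    unfolding a using lin_lde[OF L, of e i x] lin_lmap[OF lin_comp_lde[OF \<phi>], of \<rho> e i x]
    by (simp add: lin_lmap[OF \<phi>] lin_lde[OF \<phi>])
qed

text \<open>As \<open>D F\<close> and the pullback of \<open>F\<close> vanish, the homotopy formula
  for \<open>hcontr\<close> shrinks to \<open>D \<eta> = F\<close>; vanishing at fixed letters is
  inherited by \<open>hcontr_snoc\<close>.\<close>

lemma retract_primitive:
  assumes F: "cone.env F" and \<rho>: "dgla_hom L L \<rho>"
    and DF: "\<And>w. D F w = 0" and 0: "\<And>w. F (map (lmap L L \<rho>) w) = 0"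
  obtains \<eta> where "cone.env \<eta>" "\<And>w. D \<eta> w = F w"
    and "\<And>i x. x \<in> gr L i \<Longrightarrow> \<rho> i x = x \<Longrightarrow> (\<And>w. F (w @ [(False, i, x)]) = 0) \<Longrightarrow>
      (\<And>w. \<eta> (w @ [(False, i, x)]) = 0)"
proof (rule that)
  let ?r = "lmap L L \<rho>"
  let ?\<eta> = "cone.hcontr ?r (lsig L) F"
  note c = lpar_simps(6) lmap_lin[OF \<rho>] lmap_lbr[OF \<rho>] lpar_simps(5) lin_comp_lsig
  show "cone.env ?\<eta>" by (rule cone.hcontr_env[OF c F])
  have "cone.hcontr ?r (lsig L) (\<lambda>w. 0) w = 0" for w
    using cone.hcontr_add[OF c cone.env_0 cone.env_0, of w] by simp
  moreover have "D F = (\<lambda>w. 0)" using DF by blast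
  ultimately show "D ?\<eta> w = F w" for w
    using D_hcontr[OF F lpar_simps(6) lmap_lin[OF \<rho>] lmap_lbr[OF \<rho>] lmap_ldI[OF \<rho>] lmap_lde[OF \<rho>], of w] 0
    by simp
  fix i x w
  assume "x \<in> gr L i" "\<rho> i x = x" "\<And>w. F (w @ [(False, i, x)]) = 0"
  then show "?\<eta> (w @ [(False, i, x)]) = 0"
    by (intro cone.hcontr_snoc[OF c]) (simp_all add: lmap_def)
qed

end

section \<open>Retractions onto the factors and gluing of primitives\<close>

context two_dglas
begin

lemma projections:
  obtains \<alpha> :: "int \<Rightarrow> ('k, 'a, 'b) fp_term set \<Rightarrow> 'a" and \<beta> :: "int \<Rightarrow> ('k, 'a, 'b) fp_term set \<Rightarrow> 'b"
  where "dgla_hom GH G \<alpha>" "dgla_hom GH H \<beta>"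
    and "\<And>i x. x \<in> gr G i \<Longrightarrow> \<alpha> i (incl_left i x) = x"
    and "\<And>i y. y \<in> gr H i \<Longrightarrow> \<alpha> i (incl_right i y) = \<zero>\<^bsub>homog G i\<^esub>"
    and "\<And>i x. x \<in> gr G i \<Longrightarrow> \<beta> i (incl_left i x) = \<zero>\<^bsub>homog H i\<^esub>"
    and "\<And>i y. y \<in> gr H i \<Longrightarrow> \<beta> i (incl_right i y) = y"
proof -
  have id: "dgla_hom L L (\<lambda>i x. x)" for L :: "('k, 'c) dgla" by (simp add: dgla_hom_def)
  obtain \<alpha> where "dgla_hom GH G \<alpha>" "\<forall>i. \<forall>x\<in>gr G i. \<alpha> i (incl_left i x) = x"
    "\<forall>i. \<forall>y\<in>gr H i. \<alpha> i (incl_right i y) = \<zero>\<^bsub>homog G i\<^esub>"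
    using free_product_universal(1)[OF G.dgla_axioms id G.zero_hom] by blast
  moreover obtain \<beta> where "dgla_hom GH H \<beta>" "\<forall>i. \<forall>x\<in>gr G i. \<beta> i (incl_left i x) = \<zero>\<^bsub>homog H i\<^esub>"
    "\<forall>i. \<forall>y\<in>gr H i. \<beta> i (incl_right i y) = y"
    using free_product_universal(1)[OF H.dgla_axioms H.zero_hom id] by blast
  ultimately show ?thesis by (intro that[of \<alpha> \<beta>]) blast+
qed

lemma glue:
  assumes F: "P.cone.env F" and DF: "\<And>w. P.D F w = 0"
    and inv: "\<And>w i x. F (w @ [(False, i, x)]) = 0"
    and \<rho>\<^sub>1: "dgla_hom GH GH \<rho>\<^sub>1"
      "\<And>i x. x \<in> gr G i \<Longrightarrow> \<rho>\<^sub>1 i (incl_left i x) = incl_left i x"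
    and \<rho>\<^sub>2: "dgla_hom GH GH \<rho>\<^sub>2"
      "\<And>i y. y \<in> gr H i \<Longrightarrow> \<rho>\<^sub>2 i (incl_right i y) = incl_right i y"
    and 0: "\<And>w. F (map (lmap GH GH \<rho>\<^sub>1) w) = 0"
      "\<And>w. F (map (lmap GH GH \<rho>\<^sub>2) w) = 0"
  obtains K where "P.cone.env K" "\<And>w. P.D K w = F w" "\<And>w i x. K (w @ [(False, i, x)]) = 0"
proof -
  note incl_closed = hom_closed[OF incl_left_hom] hom_closed[OF incl_right_hom]
  obtain \<eta>\<^sub>1 where 1: "P.cone.env \<eta>\<^sub>1" "\<And>w. P.D \<eta>\<^sub>1 w = F w"
    "\<And>i x w. x \<in> gr G i \<Longrightarrow> \<eta>\<^sub>1 (w @ [(False, i, incl_left i x)]) = 0"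
    using P.retract_primitive[OF F \<rho>\<^sub>1(1) DF 0(1)] inv \<rho>\<^sub>1(2) incl_closed(1) by metis
  obtain \<eta>\<^sub>2 where 2: "P.cone.env \<eta>\<^sub>2" "\<And>w. P.D \<eta>\<^sub>2 w = F w"
    "\<And>i y w. y \<in> gr H i \<Longrightarrow> \<eta>\<^sub>2 (w @ [(False, i, incl_right i y)]) = 0"
    using P.retract_primitive[OF F \<rho>\<^sub>2(1) DF 0(2)] inv \<rho>\<^sub>2(2) incl_closed(2) by metis
  define \<delta> where "\<delta> = (\<lambda>w. \<eta>\<^sub>1 w - \<eta>\<^sub>2 w)"
  have \<delta>: "P.cone.env \<delta>" unfolding \<delta>_def by (intro P.cone.env_diff 1 2)
  have D\<delta>: "P.D \<delta> = (\<lambda>w. 0)" by (simp add: \<delta>_def P.D_linear 1 2 fun_eq_iff)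
  define \<xi> where "\<xi> = P.cone.contr (lsig GH) \<delta>"
  have par: "lpar (lsig GH l) = (\<not> lpar l)" for l :: "bool \<times> int \<times> ('k, 'a, 'b) fp_term set" by simp
  have \<xi>: "P.cone.env \<xi>" unfolding \<xi>_def by (rule P.cone.env_contr[OF \<delta> par P.lin_comp_lsig])
  have "P.cone.contr (lsig GH) (\<lambda>w. 0) = (\<lambda>w. 0)"
    by (rule P.cone.contr_0[OF par P.lin_comp_lsig])
  then have D\<xi>: "P.D \<xi> w = \<delta> w - \<delta> [] * P.cone.eps w" for w
    using P.D_contr[OF \<delta>, of w] by (simp add: \<xi>_def[symmetric] D\<delta>)
  obtain \<eta> where \<eta>: "P.cone.env \<eta>"
    "\<And>w i y. y \<in> gr H i \<Longrightarrow> \<eta> (w @ [(False, i, incl_right i y)]) = 0"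
    "\<And>w i x. x \<in> gr G i \<Longrightarrow> \<eta> (w @ [(False, i, incl_left i x)]) = \<xi> (w @ [(False, i, incl_left i x)])"
    using env_split[OF \<xi>] by metis
  have DD: "P.D \<xi> w = P.D (\<lambda>w. \<xi> w - \<eta> w) w + P.D \<eta> w" for w by (simp add: P.D_linear)
  \<comment> \<open>\<open>\<eta>\<^sub>1\<close> is corrected by the part of the primitive that G
    kills; the same functional is, up to a constant, \<open>\<eta>\<^sub>2\<close> corrected by the
    part that H kills.\<close>
  define K where "K = (\<lambda>w. \<eta>\<^sub>1 w - P.D (\<lambda>w. \<xi> w - \<eta> w) w)"
  have \<xi>\<eta>: "P.cone.env (\<lambda>w. \<xi> w - \<eta> w)" by (intro P.cone.env_diff \<xi> \<eta>)
  have K: "P.cone.env K" unfolding K_def by (intro P.cone.env_diff 1 P.D_env \<xi>\<eta>)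
  show ?thesis
  proof (rule that[OF K])
    show "P.D K w = F w" for w
      by (simp add: K_def P.D_linear 1 P.D_D[OF \<xi>] P.D_D[OF \<eta>(1)])
    fix w i p
    show "K (w @ [(False, i, p)]) = 0"
    proof (rule env_generated[OF K])
      fix w i x assume x: "x \<in> gr G i"
      have "P.D (\<lambda>w. \<xi> w - \<eta> w) (w @ [(False, i, incl_left i x)]) = 0"
        using \<eta>(3) x G.bdry_closed[OF x]
        by (intro P.D_snoc[OF \<xi>\<eta>]) (simp_all add: hom_bdry[OF incl_left_hom, symmetric])
      then show "K (w @ [(False, i, incl_left i x)]) = 0" by (simp add: K_def 1 x)
    next
      fix w i y assume y: "y \<in> gr H i"
      have "P.D \<eta> (w @ [(False, i, incl_right i y)]) = 0"
        using \<eta>(2) y H.bdry_closed[OF y]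
        by (intro P.D_snoc[OF \<eta>(1)]) (simp_all add: hom_bdry[OF incl_right_hom, symmetric])
      \<comment> \<open>The constant \<open>\<delta> []\<close> left by the contraction is harmless,
        since \<open>eps\<close> vanishes on nonempty words.\<close>
      moreover have "K v = \<eta>\<^sub>2 v + \<delta> [] * P.cone.eps v + P.D \<eta> v" for v
        using D\<xi>[of v] DD[of v] fun_cong[OF \<delta>_def, of v] by (simp add: K_def algebra_simps)
      ultimately show "K (w @ [(False, i, incl_right i y)]) = 0" by (simp add: 2 y)
    qed
  qed
qed

end

section \<open>The restriction map\<close>

text \<open>Surjectivity is asked before passing to quotients, which is available because cocycles
  on the factors extend to cocycles, not just up to coboundaries.\<close>

lemma factor_group_iso:
  fixes A :: "('a, 'm) monoid_scheme" and B :: "('b, 'n) monoid_scheme"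
  assumes "comm_group A" "comm_group B" and N: "subgroup N A" and M: "subgroup M B"
    and \<phi>: "\<phi> \<in> hom A B" and NM: "\<And>a. a \<in> N \<Longrightarrow> \<phi> a \<in> M"
    and inj: "\<And>a. a \<in> carrier A \<Longrightarrow> \<phi> a \<in> M \<Longrightarrow> a \<in> N"
    and surj: "\<And>b. b \<in> carrier B \<Longrightarrow> \<exists>a\<in>carrier A. \<phi> a = b"
  shows "(\<lambda>C. M <#>\<^bsub>B\<^esub> (\<phi> ` C)) \<in> iso (A Mod N) (B Mod M)"
proof -
  interpret A: comm_group A by fact
  interpret B: comm_group B by fact
  interpret \<phi>: group_hom A B \<phi> using \<phi> by (simp add: group_hom_def group_hom_axioms_def A.is_group B.is_group)
  interpret N: normal N A by (rule A.subgroup_imp_normal[OF N])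
  interpret M: normal M B by (rule B.subgroup_imp_normal[OF M])
  have img: "M <#>\<^bsub>B\<^esub> (\<phi> ` (N #>\<^bsub>A\<^esub> a)) = M #>\<^bsub>B\<^esub> \<phi> a" if a: "a \<in> carrier A" for a
  proof
    show "M <#>\<^bsub>B\<^esub> (\<phi> ` (N #>\<^bsub>A\<^esub> a)) \<subseteq> M #>\<^bsub>B\<^esub> \<phi> a"
    proof
      fix z assume "z \<in> M <#>\<^bsub>B\<^esub> (\<phi> ` (N #>\<^bsub>A\<^esub> a))"
      then obtain m n where mn: "m \<in> M" "n \<in> N" "z = m \<otimes>\<^bsub>B\<^esub> \<phi> (n \<otimes>\<^bsub>A\<^esub> a)"
        by (auto simp: set_mult_def r_coset_def)
      then have "z = (m \<otimes>\<^bsub>B\<^esub> \<phi> n) \<otimes>\<^bsub>B\<^esub> \<phi> a" using a by (simp add: B.m_assoc)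
      then show "z \<in> M #>\<^bsub>B\<^esub> \<phi> a" using mn NM[of n] M.m_closed[of m "\<phi> n"] unfolding r_coset_def by blast
    qed
    show "M #>\<^bsub>B\<^esub> \<phi> a \<subseteq> M <#>\<^bsub>B\<^esub> (\<phi> ` (N #>\<^bsub>A\<^esub> a))"
      using A.rcos_self[OF a N] by (auto simp: set_mult_def r_coset_def[of B])
  qed
  have "(\<lambda>C. M <#>\<^bsub>B\<^esub> (\<phi> ` C)) \<in> hom (A Mod N) (B Mod M)"
  proof (rule homI)
    fix C assume "C \<in> carrier (A Mod N)"
    then obtain a where "a \<in> carrier A" "C = N #>\<^bsub>A\<^esub> a" by (auto simp: FactGroup_def RCOSETS_def)
    then show "M <#>\<^bsub>B\<^esub> (\<phi> ` C) \<in> carrier (B Mod M)" by (auto simp: img FactGroup_def RCOSETS_def)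
    fix C' assume "C' \<in> carrier (A Mod N)"
    then obtain a' where "a' \<in> carrier A" "C' = N #>\<^bsub>A\<^esub> a'" by (auto simp: FactGroup_def RCOSETS_def)
    with \<open>a \<in> carrier A\<close> \<open>C = N #>\<^bsub>A\<^esub> a\<close>
    show "M <#>\<^bsub>B\<^esub> (\<phi> ` (C \<otimes>\<^bsub>A Mod N\<^esub> C')) = (M <#>\<^bsub>B\<^esub> (\<phi> ` C)) \<otimes>\<^bsub>B Mod M\<^esub> (M <#>\<^bsub>B\<^esub> (\<phi> ` C'))"
      by (simp add: img FactGroup_def N.rcos_sum M.rcos_sum)
  qed
  moreover have "bij_betw (\<lambda>C. M <#>\<^bsub>B\<^esub> (\<phi> ` C)) (carrier (A Mod N)) (carrier (B Mod M))"
    unfolding bij_betw_def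
  proof
    show "inj_on (\<lambda>C. M <#>\<^bsub>B\<^esub> (\<phi> ` C)) (carrier (A Mod N))"
    proof (rule inj_onI)
      fix C C' assume "C \<in> carrier (A Mod N)" "C' \<in> carrier (A Mod N)"
      then obtain a a' where a: "a \<in> carrier A" "C = N #>\<^bsub>A\<^esub> a" "a' \<in> carrier A" "C' = N #>\<^bsub>A\<^esub> a'"
        by (auto simp: FactGroup_def RCOSETS_def)
      assume "M <#>\<^bsub>B\<^esub> (\<phi> ` C) = M <#>\<^bsub>B\<^esub> (\<phi> ` C')"
      then have "\<phi> a \<in> M #>\<^bsub>B\<^esub> \<phi> a'" using a B.rcos_self[OF \<phi>.hom_closed[OF a(1)] M] by (simp add: img)
      then obtain m where m: "m \<in> M" "\<phi> a = m \<otimes>\<^bsub>B\<^esub> \<phi> a'" by (auto simp: r_coset_def)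
      then have "\<phi> (a \<otimes>\<^bsub>A\<^esub> inv\<^bsub>A\<^esub> a') = m" using a M.mem_carrier by (simp add: B.m_assoc)
      then have "a \<otimes>\<^bsub>A\<^esub> inv\<^bsub>A\<^esub> a' \<in> N" using m a by (intro inj) simp_all
      moreover have "(a \<otimes>\<^bsub>A\<^esub> inv\<^bsub>A\<^esub> a') \<otimes>\<^bsub>A\<^esub> a' = a" using a by (simp add: A.m_assoc)
      ultimately have "a \<in> N #>\<^bsub>A\<^esub> a'" unfolding r_coset_def by force
      then show "C = C'" using a A.repr_independence[OF _ a(3) N] by simp
    qed
    show "(\<lambda>C. M <#>\<^bsub>B\<^esub> (\<phi> ` C)) ` carrier (A Mod N) = carrier (B Mod M)"
    proof
      show "(\<lambda>C. M <#>\<^bsub>B\<^esub> (\<phi> ` C)) ` carrier (A Mod N) \<subseteq> carrier (B Mod M)"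
        by (auto simp: img FactGroup_def RCOSETS_def intro!: bexI[OF _ \<phi>.hom_closed])
      show "carrier (B Mod M) \<subseteq> (\<lambda>C. M <#>\<^bsub>B\<^esub> (\<phi> ` C)) ` carrier (A Mod N)"
      proof
        fix E assume "E \<in> carrier (B Mod M)"
        then obtain b where b: "b \<in> carrier B" "E = M #>\<^bsub>B\<^esub> b" by (auto simp: FactGroup_def RCOSETS_def)
        then obtain a where a: "a \<in> carrier A" "\<phi> a = b" using surj by blast
        then have "E = M <#>\<^bsub>B\<^esub> (\<phi> ` (N #>\<^bsub>A\<^esub> a))" by (simp add: img b)
        moreover have "N #>\<^bsub>A\<^esub> a \<in> carrier (A Mod N)" using a by (auto simp: FactGroup_def RCOSETS_def)
        ultimately show "E \<in> (\<lambda>C. M <#>\<^bsub>B\<^esub> (\<phi> ` C)) ` carrier (A Mod N)" by blast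
      qed
    qed
  qed
  ultimately show ?thesis by (simp add: iso_def)
qed

lemma ce_simps:
  "carrier (comp (chevalley_eilenberg L) m) = cochains L m"
  "\<zero>\<^bsub>comp (chevalley_eilenberg L) m\<^esub> = (\<lambda>w. 0)"
  "f \<oplus>\<^bsub>comp (chevalley_eilenberg L) m\<^esub> g = (\<lambda>w. f w + g w)"
  "c \<odot>\<^bsub>comp (chevalley_eilenberg L) m\<^esub> f = (\<lambda>w. c * f w)"
  "amult (chevalley_eilenberg L) m n = ce_mult"
  "cobdry (chevalley_eilenberg L) m f = ce_d L f"
  "atop (chevalley_eilenberg L) m =
    subtopology (product_topology (\<lambda>w. discrete_topology UNIV) UNIV) (cochains L m)"
  by (simp_all add: chevalley_eilenberg_def ce_d_def[abs_def])

lemma product_simps: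
  "carrier (comp (cdga_product A B) m) = carrier (comp A m) \<times> carrier (comp B m)"
  "\<zero>\<^bsub>comp (cdga_product A B) m\<^esub> = (\<zero>\<^bsub>comp A m\<^esub>, \<zero>\<^bsub>comp B m\<^esub>)"
  "(a, b) \<oplus>\<^bsub>comp (cdga_product A B) m\<^esub> (a', b') = (a \<oplus>\<^bsub>comp A m\<^esub> a', b \<oplus>\<^bsub>comp B m\<^esub> b')"
  "c \<odot>\<^bsub>comp (cdga_product A B) m\<^esub> (a, b) = (c \<odot>\<^bsub>comp A m\<^esub> a, c \<odot>\<^bsub>comp B m\<^esub> b)"
  "amult (cdga_product A B) m n (a, b) (a', b') = (amult A m n a a', amult B m n b b')"
  "cobdry (cdga_product A B) m (a, b) = (cobdry A m a, cobdry B m b)"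
  "atop (cdga_product A B) m = prod_topology (atop A m) (atop B m)"
  by (simp_all add: cdga_product_def)

lemma cochains_0: "(\<lambda>w. 0) \<in> cochains L m"
  by (rule cochainsI) simp_all

lemma cochains_add:
  assumes "f \<in> cochains L m" "g \<in> cochains L m"
  shows "(\<lambda>w. f w + g w) \<in> cochains L m"
proof (rule cochainsI)
  fix w assume "f w + g w \<noteq> 0"
  then have "f w \<noteq> 0 \<or> g w \<noteq> 0" by auto
  then show "w \<noteq> [] \<and> is_word L w \<and> (\<Sum>p\<leftarrow>w. sdeg p) = m"
    using cochains_supp[OF assms(1)] cochains_supp[OF assms(2)] by blast
next
  fix u v p q
  show "f (u @ p # q # v) + g (u @ p # q # v) = (-1) powi (sdeg p * sdeg q) * (f (u @ q # p # v) + g (u @ q # p # v))"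
    using cochains_sym[OF assms(1), of u p q v] cochains_sym[OF assms(2), of u p q v] by (simp add: distrib_left)
qed (simp_all add: cochains_plus[OF assms(1)] cochains_plus[OF assms(2)] cochains_smult[OF assms(1)]
    cochains_smult[OF assms(2)] distrib_left)

lemma cochains_mult:
  assumes "f \<in> cochains L m"
  shows "(\<lambda>w. c * f w) \<in> cochains L m"
proof (rule cochainsI)
  fix w assume "c * f w \<noteq> 0"
  then show "w \<noteq> [] \<and> is_word L w \<and> (\<Sum>p\<leftarrow>w. sdeg p) = m"
    using cochains_supp[OF assms] by auto
next
  fix u v p q
  show "c * f (u @ p # q # v) = (-1) powi (sdeg p * sdeg q) * (c * f (u @ q # p # v))"
    using cochains_sym[OF assms, of u p q v] by simp
qed (simp_all add: cochains_plus[OF assms] cochains_smult[OF assms] distrib_left)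

lemma ce_d_linear:
  "ce_d L (\<lambda>w. 0) w = 0"
  "ce_d L (\<lambda>w. f w + g w) w = ce_d L f w + ce_d L g w"
  "ce_d L (\<lambda>w. c * f w) w = c * ce_d L f w"
  by (simp_all add: ce_d_def ce_dI_def ce_dII_def sum.distrib[symmetric] sum_distrib_left case_prod_beta algebra_simps)

context dgla
begin

text \<open>
  Functionals on the cone need not be homogeneous, but cochains have to be.
\<close>

definition cut :: "int \<Rightarrow> ('a lword \<Rightarrow> 'k) \<Rightarrow> (int \<times> 'a) list \<Rightarrow> 'k"
  where "cut m K w = (if w \<noteq> [] \<and> (\<Sum>p\<leftarrow>w. sdeg p) = m then K (map (Pair True) w) else 0)"

lemma cut_cochains:
  assumes K: "cone.env K"
  shows "cut m K \<in> cochains L m"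
proof (rule cochainsI)
  note lin = letters.mlinD[OF cone.env_mlin[OF K]]
  show "cut m K w \<noteq> 0 \<Longrightarrow> w \<noteq> [] \<and> is_word L w \<and> (\<Sum>p\<leftarrow>w. sdeg p) = m" for w
    using env_invalid[OF cone.env_mlin[OF K], of w] by (auto simp: cut_def split: if_splits)
  show "cut m K (u @ (i, x \<oplus>\<^bsub>homog L i\<^esub> y) # v) = cut m K (u @ (i, x) # v) + cut m K (u @ (i, y) # v)"
    if "x \<in> gr L i" "y \<in> gr L i" for u v i x y
    using lin_plus[OF lin that, of "map (Pair True) u" True "map (Pair True) v"] by (simp add: cut_def)
  show "cut m K (u @ (i, c \<odot>\<^bsub>homog L i\<^esub> x) # v) = c * cut m K (u @ (i, x) # v)"
    if "x \<in> gr L i" for u v i c x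
    using lin_smult[OF lin that, of "map (Pair True) u" True c "map (Pair True) v"] by (simp add: cut_def)
  fix u v and p q :: "int \<times> 'a"
  have "K (map (Pair True) u @ lbr L (True, p) (True, q) # map (Pair True) v) = 0"
    by (rule lin_lbr_eps[OF lin]) simp_all
  then have "K (map (Pair True) (u @ p # q # v)) = (-1) powi (sdeg p * sdeg q) * K (map (Pair True) (u @ q # p # v))"
    using cone.envD[OF K, of "map (Pair True) u" "(True, p)" "(True, q)" "map (Pair True) v"]
    by (cases p; cases q) (simp add: powi_sg)
  then show "cut m K (u @ p # q # v) = (-1) powi (sdeg p * sdeg q) * cut m K (u @ q # p # v)"
    by (simp add: cut_def add_ac)
qed

text \<open>A word of degree m + 1 sees only words of degree \<open>m\<close>, where
  \<open>cut m K\<close> agrees with \<open>K\<close>; a word of any other degree sees only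
  zeros.\<close>

lemma ce_d_cut:
  assumes K: "cone.env K" and inv: "\<And>w i x. K (w @ [(False, i, x)]) = 0"
  shows "ce_d L (cut m K) = cut (m + 1) (D K)"
proof
  fix w
  show "ce_d L (cut m K) w = cut (m + 1) (D K) w"
  proof (cases "is_word L w")
    case False
    then show ?thesis
      using env_invalid[OF cone.env_mlin[OF D_env[OF K]] False]
      by (simp add: cut_def ce_d_def ce_dI_def ce_dII_def)
  next
    case True
    show ?thesis
    proof (cases "(\<Sum>p\<leftarrow>w. sdeg p) = m + 1")
      case sum: True
      have "ce_d L (cut m K) w = ce_d L (\<lambda>w. K (map (Pair True) w)) w"
        using sum by (intro ce_d_cong True) (simp add: cut_def)
      also have "\<dots> = D K (map (Pair True) w)" by (rule D_eps[OF K inv True, symmetric])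
      \<comment> \<open>On the empty word \<open>cut\<close> gives 0, in agreement with
        \<open>D K [] = 0\<close>.\<close>
      also have "\<dots> = cut (m + 1) (D K) w" using sum by (simp add: cut_def) (simp add: D_def)
      finally show ?thesis .
    next
      case False
      have "ce_d L (cut m K) w = ce_d L (\<lambda>w. 0) w"
        using False by (intro ce_d_cong True) (auto simp: cut_def)
      then show ?thesis using False by (simp add: ce_d_linear cut_def)
    qed
  qed
qed

lemma cut_lift_cochain:
  assumes "f \<in> cochains L m"
  shows "cut m (lift_cochain f) = f"
  by (rule HOL.ext) (use cochains_supp[OF assms] in \<open>auto simp: cut_def lift_cochain_eps\<close>)

lemma ce_d_lift_cochain:
  assumes f: "f \<in> cochains L m"
  shows "ce_d L f = cut (m + 1) (D (lift_cochain f))"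
  using ce_d_cut[OF lift_cochain_env[OF f] lift_cochain_snoc[OF f], of m] by (simp add: cut_lift_cochain[OF f])

lemma ce_d_cochains: "f \<in> cochains L m \<Longrightarrow> ce_d L f \<in> cochains L (m + 1)"
  by (simp add: ce_d_lift_cochain cut_cochains D_env lift_cochain_env)

lemma D_lift_cochain_snoc: "f \<in> cochains L m \<Longrightarrow> D (lift_cochain f) (w @ [(False, i, x)]) = 0"
  by (intro D_snoc lift_cochain_env lift_cochain_snoc)

text \<open>Inherited from \<open>D_D\<close> on the cone, which replaces a sign computation with
  pairs of brackets on cochains.\<close>

lemma ce_d_ce_d:
  assumes f: "f \<in> cochains L m"
  shows "ce_d L (ce_d L f) = (\<lambda>w. 0)"
proof -
  have "ce_d L (ce_d L f) = cut (m + 1 + 1) (D (D (lift_cochain f)))"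
    using ce_d_cut[OF D_env[OF lift_cochain_env[OF f]] D_lift_cochain_snoc[OF f], of "m + 1"]
    by (simp add: ce_d_lift_cochain[OF f])
  then show ?thesis by (simp add: cut_def D_D[OF lift_cochain_env[OF f]] fun_eq_iff)
qed

lemma pullback_retract:
  assumes \<psi>: "dgla_hom L M \<psi>" and f: "f \<in> cochains L m" and id: "\<And>i x. x \<in> gr L i \<Longrightarrow> \<chi> i (\<psi> i x) = x"
  shows "pullback L \<psi> (pullback M \<chi> f) = f"
proof
  fix w
  show "pullback L \<psi> (pullback M \<chi> f) w = f w"
    using wmap_id[of L "\<lambda>i x. \<chi> i (\<psi> i x)" w] id is_word_wmap[OF \<psi>, of w] cochains_supp[OF f, of w]
    by (auto simp: pullback_def wmap_comp)
qed

lemma pullback_zero: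
  assumes \<psi>: "dgla_hom L M \<psi>" and N: "dgla N" and f: "f \<in> cochains N m"
    and zero: "\<And>i x. x \<in> gr L i \<Longrightarrow> \<chi> i (\<psi> i x) = \<zero>\<^bsub>homog N i\<^esub>"
  shows "pullback L \<psi> (pullback M \<chi> f) = (\<lambda>w. 0)"
proof
  fix w
  show "pullback L \<psi> (pullback M \<chi> f) w = 0"
  proof (cases w)
    case Nil
    then show ?thesis using cochains_supp[OF f, of "[]"] by (auto simp: pullback_def)
  next
    case (Cons p v)
    obtain i x where "p = (i, x)" by fastforce
    then show ?thesis
      using dgla.cochains_zero[OF N f, of "[]" i] zero[of x i] Cons by (simp add: pullback_def wmap_comp)
  qed
qed

end

context two_dglas
begin

text \<open>The retracted functional is still invariant, so words of \<epsilon>-letters suffice.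
  There it is the difference of \<open>f\<close> and the differential of \<open>\<theta>\<close> on
  words coming from \<open>L\<close>, which is zero by \<open>eq\<close>.\<close>

lemma retract_vanish:
  assumes f: "f \<in> cochains GH m" and \<theta>: "\<theta> \<in> cochains GH (m - 1)"
    and L: "dgla L" and \<iota>: "dgla_hom L GH \<iota>" and \<pi>: "dgla_hom GH L \<pi>"
    and eq: "ce_d L (pullback L \<iota> \<theta>) = pullback L \<iota> f"
  shows "P.lift_cochain f (map (lmap GH GH (\<lambda>i x. \<iota> i (\<pi> i x))) w) -
      P.D (P.lift_cochain \<theta>) (map (lmap GH GH (\<lambda>i x. \<iota> i (\<pi> i x))) w) = 0"
proof -
  let ?r = "lmap GH GH (\<lambda>i x. \<iota> i (\<pi> i x))"
  let ?F = "\<lambda>w. P.lift_cochain f w - P.D (P.lift_cochain \<theta>) w"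
  note \<rho> = dgla_hom_comp[OF \<pi> \<iota>]
  have F: "P.cone.env ?F" by (intro P.cone.env_diff P.D_env P.lift_cochain_env[OF f] P.lift_cochain_env[OF \<theta>])
  have inv: "?F (w @ [(False, i, x)]) = 0" for w i x
    by (simp add: P.lift_cochain_snoc[OF f] P.D_lift_cochain_snoc[OF \<theta>])
  show ?thesis
  proof (rule P.env_inv_eq_0[where F = "\<lambda>w. ?F (map ?r w)"])
    show "P.cone.env (\<lambda>w. ?F (map ?r w))"
      by (rule P.cone.env_map[OF lpar_simps(6) P.lmap_lin[OF \<rho>] P.lmap_lbr[OF \<rho>] F])
    fix w i x
    show "?F (map ?r (w @ [(False, i, x)])) = 0"
      using inv by (simp add: lmap_def)
  next
    fix w assume w: "is_word GH w"
    let ?v = "wmap \<pi> w"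
    have v: "is_word L ?v" by (rule is_word_wmap[OF \<pi> w])
    have "map ?r (map (Pair True) w) = map (Pair True) (wmap \<iota> ?v)"
      using w by (induction w) (auto simp: lmap_def)
    then have "?F (map ?r (map (Pair True) w)) = f (wmap \<iota> ?v) - ce_d GH \<theta> (wmap \<iota> ?v)"
      using P.D_eps[OF P.lift_cochain_env[OF \<theta>] P.lift_cochain_snoc[OF \<theta>] is_word_wmap[OF \<iota> v]] by (simp add: P.lift_cochain_eps)
    also have "\<dots> = pullback L \<iota> f ?v - pullback L \<iota> (ce_d GH \<theta>) ?v"
      using v by (simp add: pullback_def)
    also have "\<dots> = 0" using dgla.pullback_ce_d[OF L \<iota>, of \<theta>] eq by (metis diff_self)
    finally show "?F (map ?r (map (Pair True) w)) = 0" .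
  qed
qed

text \<open>The two pullbacks along the projections are added. The cross terms vanish because each
  projection kills the other factor and reduced cochains live on nonempty words.\<close>

theorem restriction_surjective:
  assumes g: "g \<in> cochains G m" and h: "h \<in> cochains H m"
  obtains f where "f \<in> cochains GH m" "pullback G incl_left f = g" "pullback H incl_right f = h"
    "ce_d G g = (\<lambda>w. 0) \<Longrightarrow> ce_d H h = (\<lambda>w. 0) \<Longrightarrow> ce_d GH f = (\<lambda>w. 0)"
proof -
  obtain \<alpha> \<beta> where \<alpha>: "dgla_hom GH G \<alpha>" and \<beta>: "dgla_hom GH H \<beta>"
    and \<alpha>l: "\<And>i x. x \<in> gr G i \<Longrightarrow> \<alpha> i (incl_left i x) = x"
    and \<alpha>r: "\<And>i y. y \<in> gr H i \<Longrightarrow> \<alpha> i (incl_right i y) = \<zero>\<^bsub>homog G i\<^esub>"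
    and \<beta>l: "\<And>i x. x \<in> gr G i \<Longrightarrow> \<beta> i (incl_left i x) = \<zero>\<^bsub>homog H i\<^esub>"
    and \<beta>r: "\<And>i y. y \<in> gr H i \<Longrightarrow> \<beta> i (incl_right i y) = y"
    using projections by metis
  define \<theta> where "\<theta> = (\<lambda>w. pullback GH \<alpha> g w + pullback GH \<beta> h w)"
  have \<theta>: "\<theta> \<in> cochains GH m"
    unfolding \<theta>_def by (intro cochains_add P.pullback_cochains[OF \<alpha> g] P.pullback_cochains[OF \<beta> h])
  have "pullback G incl_left (pullback GH \<alpha> g) = g"
    by (rule G.pullback_retract[OF incl_left_hom g]) (rule \<alpha>l)
  moreover have "pullback G incl_left (pullback GH \<beta> h) = (\<lambda>w. 0)"
    by (rule G.pullback_zero[OF incl_left_hom H.dgla_axioms h]) (rule \<beta>l)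
  ultimately have \<theta>G: "pullback G incl_left \<theta> = g"
    by (simp add: \<theta>_def pullback_add)
  have "pullback H incl_right (pullback GH \<beta> h) = h"
    by (rule H.pullback_retract[OF incl_right_hom h]) (rule \<beta>r)
  moreover have "pullback H incl_right (pullback GH \<alpha> g) = (\<lambda>w. 0)"
    by (rule H.pullback_zero[OF incl_right_hom G.dgla_axioms g]) (rule \<alpha>r)
  ultimately have \<theta>H: "pullback H incl_right \<theta> = h"
    by (simp add: \<theta>_def pullback_add)
  show thesis
  proof (rule that[OF \<theta> \<theta>G \<theta>H])
    assume "ce_d G g = (\<lambda>w. 0)" "ce_d H h = (\<lambda>w. 0)"
    then show "ce_d GH \<theta> = (\<lambda>w. 0)"
      by (simp add: \<theta>_def ce_d_linear fun_eq_iff P.pullback_ce_d[OF \<alpha>] P.pullback_ce_d[OF \<beta>])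
        (simp add: pullback_def)
  qed
qed

theorem restriction_injective:
  assumes f: "f \<in> cochains GH m" and df: "ce_d GH f = (\<lambda>w. 0)"
    and g: "g \<in> cochains G (m - 1)" "ce_d G g = pullback G incl_left f"
    and h: "h \<in> cochains H (m - 1)" "ce_d H h = pullback H incl_right f"
  shows "\<exists>k\<in>cochains GH (m - 1). ce_d GH k = f"
proof -
  obtain \<alpha> \<beta> where \<alpha>: "dgla_hom GH G \<alpha>" and \<beta>: "dgla_hom GH H \<beta>"
    and \<alpha>l: "\<And>i x. x \<in> gr G i \<Longrightarrow> \<alpha> i (incl_left i x) = x"
    and \<alpha>r: "\<And>i y. y \<in> gr H i \<Longrightarrow> \<alpha> i (incl_right i y) = \<zero>\<^bsub>homog G i\<^esub>"
    and \<beta>l: "\<And>i x. x \<in> gr G i \<Longrightarrow> \<beta> i (incl_left i x) = \<zero>\<^bsub>homog H i\<^esub>"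
    and \<beta>r: "\<And>i y. y \<in> gr H i \<Longrightarrow> \<beta> i (incl_right i y) = y"
    using projections by metis
  \<comment> \<open>A common extension of the two primitives. Subtracting its differential makes the
    cocycle restrict to zero on both factors, not merely to a coboundary, as the retraction
    homotopies require.\<close>
  obtain \<theta> where \<theta>: "\<theta> \<in> cochains GH (m - 1)"
    and \<theta>G: "pullback G incl_left \<theta> = g" and \<theta>H: "pullback H incl_right \<theta> = h"
    using restriction_surjective[OF g(1) h(1)] by metis
  from \<theta>G g(2) have \<theta>l: "ce_d G (pullback G incl_left \<theta>) = pullback G incl_left f" by simp
  from \<theta>H h(2) have \<theta>r: "ce_d H (pullback H incl_right \<theta>) = pullback H incl_right f" by simp
  let ?F = "\<lambda>w. P.lift_cochain f w - P.D (P.lift_cochain \<theta>) w"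
  have F: "P.cone.env ?F" by (intro P.cone.env_diff P.D_env P.lift_cochain_env[OF f] P.lift_cochain_env[OF \<theta>])
  have Df: "P.D (P.lift_cochain f) w = 0" for w
  proof (rule P.env_inv_eq_0[OF P.D_env[OF P.lift_cochain_env[OF f]] P.D_lift_cochain_snoc[OF f]])
    fix w assume "is_word GH w"
    then show "P.D (P.lift_cochain f) (map (Pair True) w) = 0"
      using P.D_eps[OF P.lift_cochain_env[OF f] P.lift_cochain_snoc[OF f]] df by (simp add: P.lift_cochain_eps)
  qed
  have DF: "P.D ?F w = 0" for w by (simp add: P.D_linear Df P.D_D[OF P.lift_cochain_env[OF \<theta>]])
  have inv: "?F (w @ [(False, i, x)]) = 0" for w i x
    by (simp add: P.lift_cochain_snoc[OF f] P.D_lift_cochain_snoc[OF \<theta>])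
  obtain K where K: "P.cone.env K" "\<And>w. P.D K w = ?F w" "\<And>w i x. K (w @ [(False, i, x)]) = 0"
  proof (rule glue[OF F DF inv dgla_hom_comp[OF \<alpha> incl_left_hom] _ dgla_hom_comp[OF \<beta> incl_right_hom]])
    show "?F (map (lmap GH GH (\<lambda>i x. incl_left i (\<alpha> i x))) w) = 0" for w
      by (rule retract_vanish[OF f \<theta> G.dgla_axioms incl_left_hom \<alpha> \<theta>l])
    show "?F (map (lmap GH GH (\<lambda>i x. incl_right i (\<beta> i x))) w) = 0" for w
      by (rule retract_vanish[OF f \<theta> H.dgla_axioms incl_right_hom \<beta> \<theta>r])
  qed (simp_all add: \<alpha>l \<beta>r)
  let ?K = "\<lambda>w. K w + P.lift_cochain \<theta> w"
  have K': "P.cone.env ?K" by (intro P.cone.env_add K P.lift_cochain_env[OF \<theta>])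
  have "P.D ?K = P.lift_cochain f" by (simp add: P.D_linear K fun_eq_iff)
  then have "ce_d GH (P.cut (m - 1) ?K) = f"
    using P.ce_d_cut[OF K', of "m - 1"] by (simp add: K P.lift_cochain_snoc[OF \<theta>] P.cut_lift_cochain[OF f])
  then show ?thesis using P.cut_cochains[OF K'] by blast
qed

end

lemma continuous_pullback:
  assumes "dgla L" "dgla_hom L M \<psi>"
  shows "continuous_map (atop (chevalley_eilenberg M) m) (atop (chevalley_eilenberg L) m) (pullback L \<psi>)"
  unfolding ce_simps continuous_map_in_subtopology continuous_map_componentwise_UNIV
proof (intro conjI allI)
  fix w
  show "continuous_map (subtopology (product_topology (\<lambda>w. discrete_topology UNIV) UNIV) (cochains M m))
      (discrete_topology UNIV) (\<lambda>f. pullback L \<psi> f w)"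
  proof (cases "is_word L w")
    case True
    have "continuous_map (product_topology (\<lambda>w. discrete_topology UNIV) UNIV) (discrete_topology UNIV) (\<lambda>f. f (wmap \<psi> w))"
      by (rule continuous_map_product_projection) simp
    from continuous_map_from_subtopology[OF this] True show ?thesis by (simp add: pullback_def)
  qed (simp add: pullback_def)
next
  show "pullback L \<psi> \<in> topspace (subtopology (product_topology (\<lambda>w. discrete_topology UNIV) UNIV) (cochains M m)) \<rightarrow> cochains L m"
    using dgla.pullback_cochains[OF assms] by auto
qed

section \<open>Passage to cohomology\<close>

definition complex :: "('k, 'c) cdga \<Rightarrow> bool"
  where "complex A \<longleftrightarrow> (\<forall>m. comm_group (add_monoid (comp A m))) \<and>
    (\<forall>m. cobdry A m \<in> hom (add_monoid (comp A m)) (add_monoid (comp A (m + 1)))) \<and>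
    (\<forall>m. \<forall>x\<in>carrier (comp A m). cobdry A (m + 1) (cobdry A m x) = \<zero>\<^bsub>comp A (m + 1 + 1)\<^esub>)"

lemma complex_groups:
  assumes "complex A"
  shows "comm_group (add_monoid (comp A m)\<lparr>carrier := cocycles A m\<rparr>)"
    and "subgroup (coboundaries A m) (add_monoid (comp A m)\<lparr>carrier := cocycles A m\<rparr>)"
proof -
  have comm: "comm_group (add_monoid (comp A m))" for m using assms by (simp add: complex_def)
  have gh: "group_hom (add_monoid (comp A m)) (add_monoid (comp A (m + 1))) (cobdry A m)" for m
    using assms comm comm_group.axioms(2) by (auto simp: complex_def group_hom_def group_hom_axioms_def)
  have "cocycles A m = kernel (add_monoid (comp A m)) (add_monoid (comp A (m + 1))) (cobdry A m)"
    by (simp add: cocycles_def kernel_def)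
  then have Z: "subgroup (cocycles A m) (add_monoid (comp A m))"
    using group_hom.subgroup_kernel[OF gh] by simp
  show "comm_group (add_monoid (comp A m)\<lparr>carrier := cocycles A m\<rparr>)"
  proof (rule group.group_comm_groupI)
    show "group (add_monoid (comp A m)\<lparr>carrier := cocycles A m\<rparr>)"
      by (rule subgroup.subgroup_is_group[OF Z comm_group.axioms(2)[OF comm]])
  qed (use comm_groupE(4)[OF comm] subgroup.mem_carrier[OF Z] in simp)
  have "coboundaries A m = cobdry A (m - 1) ` carrier (add_monoid (comp A (m - 1)))"
    by (simp add: coboundaries_def)
  then have B: "subgroup (coboundaries A m) (add_monoid (comp A m))"
    using group_hom.img_is_subgroup[OF gh, of "m - 1"] by simp
  have "coboundaries A m \<subseteq> cocycles A m"
  proof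
    fix y assume "y \<in> coboundaries A m"
    then obtain x where x: "x \<in> carrier (comp A (m - 1))" "y = cobdry A (m - 1) x" by (auto simp: coboundaries_def)
    have "cobdry A (m - 1 + 1) (cobdry A (m - 1) x) = \<zero>\<^bsub>comp A (m - 1 + 1 + 1)\<^esub>"
      using assms x(1) unfolding complex_def by blast
    moreover have "y \<in> carrier (comp A m)"
      using subgroup.mem_carrier[OF B] \<open>y \<in> coboundaries A m\<close> by simp
    ultimately show "y \<in> cocycles A m" using x(2) by (simp add: cocycles_def)
  qed
  then show "subgroup (coboundaries A m) (add_monoid (comp A m)\<lparr>carrier := cocycles A m\<rparr>)"
    using group.subgroup_incl[OF comm_group.axioms(2)[OF comm] B Z] by simp
qed

lemma complex_ce:
  assumes "dgla L"
  shows "complex (chevalley_eilenberg L)"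
  unfolding complex_def
proof (intro conjI allI ballI)
  fix m
  show "comm_group (add_monoid (comp (chevalley_eilenberg L) m))"
  proof (rule comm_groupI)
    fix f assume "f \<in> carrier (add_monoid (comp (chevalley_eilenberg L) m))"
    then have "(\<lambda>w. - 1 * f w) \<in> cochains L m" using cochains_mult[of f L m "- 1"] by (simp add: ce_simps)
    then show "\<exists>g\<in>carrier (add_monoid (comp (chevalley_eilenberg L) m)).
        g \<otimes>\<^bsub>add_monoid (comp (chevalley_eilenberg L) m)\<^esub> f = \<one>\<^bsub>add_monoid (comp (chevalley_eilenberg L) m)\<^esub>"
      by (intro bexI[of _ "\<lambda>w. - 1 * f w"]) (simp_all add: ce_simps)
  qed (simp_all add: ce_simps cochains_0 cochains_add add_ac)
  show "cobdry (chevalley_eilenberg L) m \<in> hom (add_monoid (comp (chevalley_eilenberg L) m))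
      (add_monoid (comp (chevalley_eilenberg L) (m + 1)))"
    by (rule homI) (simp_all add: ce_simps dgla.ce_d_cochains[OF assms] ce_d_linear fun_eq_iff)
  fix f assume "f \<in> carrier (comp (chevalley_eilenberg L) m)"
  then show "cobdry (chevalley_eilenberg L) (m + 1) (cobdry (chevalley_eilenberg L) m f) =
      \<zero>\<^bsub>comp (chevalley_eilenberg L) (m + 1 + 1)\<^esub>"
    by (simp add: ce_simps dgla.ce_d_ce_d[OF assms])
qed

lemma complex_product:
  assumes A: "complex A" and B: "complex B"
  shows "complex (cdga_product A B)"
  unfolding complex_def
proof (intro conjI allI ballI)
  fix m
  interpret A: comm_group "add_monoid (comp A m)" using A by (simp add: complex_def)
  interpret B: comm_group "add_monoid (comp B m)" using B by (simp add: complex_def)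
  show "comm_group (add_monoid (comp (cdga_product A B) m))"
  proof (rule comm_groupI)
    fix x assume "x \<in> carrier (add_monoid (comp (cdga_product A B) m))"
    then obtain a b where ab: "x = (a, b)" "a \<in> carrier (comp A m)" "b \<in> carrier (comp B m)"
      by (auto simp: product_simps)
    then show "\<exists>y\<in>carrier (add_monoid (comp (cdga_product A B) m)).
        y \<otimes>\<^bsub>add_monoid (comp (cdga_product A B) m)\<^esub> x = \<one>\<^bsub>add_monoid (comp (cdga_product A B) m)\<^esub>"
      using A.l_inv_ex[of a] B.l_inv_ex[of b] by (auto simp: product_simps)
  qed (use A.m_closed B.m_closed A.one_closed B.one_closed A.m_assoc B.m_assoc A.m_comm B.m_comm A.l_one B.l_one
      in \<open>auto simp: product_simps\<close>)
  show "cobdry (cdga_product A B) m \<in> hom (add_monoid (comp (cdga_product A B) m))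
      (add_monoid (comp (cdga_product A B) (m + 1)))"
    using A B by (auto simp: complex_def hom_def product_simps Pi_iff)
  fix x assume "x \<in> carrier (comp (cdga_product A B) m)"
  then show "cobdry (cdga_product A B) (m + 1) (cobdry (cdga_product A B) m x) =
      \<zero>\<^bsub>comp (cdga_product A B) (m + 1 + 1)\<^esub>"
    using A B by (auto simp: complex_def product_simps)
qed

lemma quasi_isomorphismI:
  assumes A: "complex A" and B: "complex B" and \<phi>: "cdga_hom A B \<phi>"
    and inj: "\<And>m a. a \<in> cocycles A m \<Longrightarrow> \<phi> m a \<in> coboundaries B m \<Longrightarrow> a \<in> coboundaries A m"
    and surj: "\<And>m b. b \<in> cocycles B m \<Longrightarrow> \<exists>a\<in>cocycles A m. \<phi> m a = b"
  shows "quasi_isomorphism A B \<phi>"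
  unfolding quasi_isomorphism_def
proof (intro conjI allI \<phi>)
  fix m
  let ?A = "add_monoid (comp A m)\<lparr>carrier := cocycles A m\<rparr>"
  let ?B = "add_monoid (comp B m)\<lparr>carrier := cocycles B m\<rparr>"
  have closed: "\<phi> m x \<in> carrier (comp B m)" if "x \<in> carrier (comp A m)" for m x
    using \<phi> that unfolding cdga_hom_def by blast
  have add: "\<phi> m (x \<oplus>\<^bsub>comp A m\<^esub> y) = \<phi> m x \<oplus>\<^bsub>comp B m\<^esub> \<phi> m y"
    if "x \<in> carrier (comp A m)" "y \<in> carrier (comp A m)" for m x y
    using \<phi> that unfolding cdga_hom_def by blast
  have d: "\<phi> (m + 1) (cobdry A m x) = cobdry B m (\<phi> m x)" if "x \<in> carrier (comp A m)" for m x
    using \<phi> that unfolding cdga_hom_def by blast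
  have zero: "\<phi> m \<zero>\<^bsub>comp A m\<^esub> = \<zero>\<^bsub>comp B m\<^esub>" for m
  proof -
    have "group (add_monoid (comp A m))" "group (add_monoid (comp B m))"
      using A B by (simp_all add: complex_def comm_group.axioms(2))
    moreover have "\<phi> m \<in> hom (add_monoid (comp A m)) (add_monoid (comp B m))"
      by (rule homI) (simp_all add: closed add)
    ultimately show ?thesis using hom_one by fastforce
  qed
  have "\<phi> m \<in> hom ?A ?B"
    by (rule homI) (auto simp: cocycles_def closed add d[symmetric] zero)
  moreover have "\<phi> m a \<in> coboundaries B m" if a: "a \<in> coboundaries A m" for a
  proof -
    obtain x where "x \<in> carrier (comp A (m - 1))" "a = cobdry A (m - 1) x"
      using a by (auto simp: coboundaries_def)
    then show ?thesis using d[of x "m - 1"] closed[of x "m - 1"] by (auto simp: coboundaries_def)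
  qed
  ultimately have "(\<lambda>C. coboundaries B m <#>\<^bsub>?B\<^esub> (\<phi> m ` C)) \<in> iso (?A Mod coboundaries A m) (?B Mod coboundaries B m)"
    by (rule factor_group_iso[OF complex_groups(1)[OF A] complex_groups(1)[OF B]
          complex_groups(2)[OF A] complex_groups(2)[OF B]]) (simp_all add: inj surj)
  moreover have "cohomology_map B \<phi> m = (\<lambda>C. coboundaries B m <#>\<^bsub>?B\<^esub> (\<phi> m ` C))"
    by (simp add: cohomology_map_def[abs_def] set_mult_def)
  ultimately show "cohomology_map B \<phi> m \<in> iso (cohomology A m) (cohomology B m)"
    by (simp add: cohomology_def)
qed

context two_dglas
begin

lemma restriction_hom:
  "cdga_hom (chevalley_eilenberg GH) (cdga_product (chevalley_eilenberg G) (chevalley_eilenberg H))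
    (\<lambda>m f. (pullback G incl_left f, pullback H incl_right f))"
  unfolding cdga_hom_def
proof (intro conjI allI ballI)
  fix m
  show "continuous_map (atop (chevalley_eilenberg GH) m)
      (atop (cdga_product (chevalley_eilenberg G) (chevalley_eilenberg H)) m)
      (\<lambda>f. (pullback G incl_left f, pullback H incl_right f))"
    unfolding product_simps(7)
    by (simp add: continuous_map_pairwise o_def continuous_pullback[OF G.dgla_axioms incl_left_hom]
        continuous_pullback[OF H.dgla_axioms incl_right_hom])
qed (simp_all add: ce_simps product_simps G.pullback_cochains[OF incl_left_hom] H.pullback_cochains[OF incl_right_hom]
    pullback_add pullback_smult fun_eq_iff pullback_mult
    G.pullback_ce_d[OF incl_left_hom] H.pullback_ce_d[OF incl_right_hom])

theorem restriction_quasi_isomorphism: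
  "quasi_isomorphism (chevalley_eilenberg GH)
    (cdga_product (chevalley_eilenberg G) (chevalley_eilenberg H))
    (\<lambda>m f. (pullback G incl_left f, pullback H incl_right f))"
proof (rule quasi_isomorphismI)
  show "complex (chevalley_eilenberg GH)"
    by (rule complex_ce[OF P.dgla_axioms])
  show "complex (cdga_product (chevalley_eilenberg G) (chevalley_eilenberg H))"
    by (rule complex_product[OF complex_ce[OF G.dgla_axioms] complex_ce[OF H.dgla_axioms]])
  fix m
  show "f \<in> coboundaries (chevalley_eilenberg GH) m"
    if f: "f \<in> cocycles (chevalley_eilenberg GH) m"
      and b: "(pullback G incl_left f, pullback H incl_right f) \<in>
        coboundaries (cdga_product (chevalley_eilenberg G) (chevalley_eilenberg H)) m" for f
  proof -
    obtain g h where "g \<in> cochains G (m - 1)" "h \<in> cochains H (m - 1)"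
      "ce_d G g = pullback G incl_left f" "ce_d H h = pullback H incl_right f"
      using b by (auto simp: coboundaries_def ce_simps product_simps)
    then show ?thesis
      using restriction_injective[of f m g h] f
      by (auto simp: coboundaries_def cocycles_def ce_simps)
  qed
  show "\<exists>f\<in>cocycles (chevalley_eilenberg GH) m.
      (pullback G incl_left f, pullback H incl_right f) = gh"
    if z: "gh \<in> cocycles (cdga_product (chevalley_eilenberg G) (chevalley_eilenberg H)) m" for gh
  proof -
    obtain g h where gh: "gh = (g, h)" "g \<in> cochains G m" "h \<in> cochains H m" "ce_d G g = (\<lambda>w. 0)" "ce_d H h = (\<lambda>w. 0)"
      using z by (auto simp: cocycles_def ce_simps product_simps)
    obtain f where f: "f \<in> cochains GH m" "pullback G incl_left f = g" "pullback H incl_right f = h"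
      "ce_d GH f = (\<lambda>w. 0)"
      using restriction_surjective[OF gh(2,3)] gh(4,5) by metis
    then show ?thesis using gh by (auto simp: cocycles_def ce_simps)
  qed
qed (rule restriction_hom)

end

theorem theoremA4:
  fixes G :: "('k::field_char_0, 'a) dgla" and H :: "('k, 'b) dgla"
  assumes "dgla G" and "dgla H"
  shows "\<exists>\<phi>. quasi_isomorphism (chevalley_eilenberg (free_product G H))
    (cdga_product (chevalley_eilenberg G) (chevalley_eilenberg H)) \<phi>"
proof -
  interpret two_dglas G H using assms by (simp add: two_dglas_def)
  show ?thesis using restriction_quasi_isomorphism by blast
qed

end
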